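(* Let $p,q$ be positive integers and let $\alpha\in\mathcal W_+^{p\times p}$, $\beta\in\mathcal W_+^{p\times q}$, $\gamma\in\mathcal W_-^{q\times p}$, $\delta\in\mathcal W_-^{q\times q}$, and let $a_0$ and $d_0$ be the zeroth Fourier coefficients of $\alpha$ and $\delta$, respectively. Then the twofold EG inverse problem associated with the data set $\{\alpha,\beta,\gamma,\delta\}$ has a solution $g$ with the additional property that the Hankel operator $H_{+,g}$ is a strict contraction if and only if the following three conditions are satisfied: (i) $a_0$ and $d_0$ are positive definite; (ii) $\alpha^*\alpha-\gamma^*\gamma=a_0$, $\ \delta^*\delta-\beta^*\beta=d_0$, $\ \alpha^*\beta=\gamma^*\delta$ on $\mathbb T$; (iii) $\det\alpha$ and $\det\delta$ have no zeros in $|\lambda|\le1$ and $|\lambda|\ge1$, respectively.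
   Context: Wiener spaces. $\mathcal W^{n\times m}$ is the set of $n\times m$ matrix functions on the unit circle $\mathbb T$ whose entries lie in the Wiener algebra, i.e. $\rho(\zeta)=\sum_{\nu\in\mathbb Z}\zeta^\nu r_\nu$ with $\sum_\nu\|r_\nu\|<\infty$; $r_\nu$ is the $\nu$-th Fourier coefficient. $\mathcal W_+^{n\times m}$ (resp. $\mathcal W_-^{n\times m}$) consists of those with $r_\nu=0$ for $\nu<0$ (resp. $\nu>0$); $\mathcal W_{+,0}^{n\times m}$ (resp. $\mathcal W_{-,0}^{n\times m}$) of those with $r_\nu=0$ for $\nu\le0$ (resp. $\nu\ge0$). Functions in $\mathcal W_+^{n\times m}$ extend to $|\lambda|\le1$ by $\rho(\lambda)=\sum_{\nu\ge0}\lambda^\nu r_\nu$, and functions in $\mathcal W_-^{n\times m}$ extend to $|\lambda|\ge1$ by $\rho(\lambda)=\sum_{\nu\ge0}\lambda^{-\nu}r_{-\nu}$. Put $\rho^*(\zeta)=\rho(\zeta)^*$ for $\zeta\in\mathbb T$. $e_p,e_q$ denote the constant functions $I_p,I_q$; constant matrices are identified with constant functions. Twofold EG inverse problem. A solution associated with $\{\alpha,\beta,\gamma,\delta\}$ is a function $g\in\mathcal W_+^{p\times q}$ such that $\alpha+g\gamma-e_p\in\mathcal W_{-,0}^{p\times p}$, $\ g^*\alpha+\gamma\in\mathcal W_{+,0}^{q\times p}$, $\ \delta+g^*\beta-e_q\in\mathcal W_{+,0}^{q\times q}$, $\ g\delta+\beta\in\mathcal W_{-,0}^{p\times q}$. Hankel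 operator. $\ell^2_+(\mathbb C^n)$ and $\ell^2_-(\mathbb C^n)$ are the Hilbert spaces of square summable $\mathbb C^n$-valued sequences $(x_j)_{j\ge0}$ and $(x_j)_{j\le0}$, respectively. For $g=\sum_{\nu\ge0}\zeta^\nu g_\nu\in\mathcal W_+^{p\times q}$, $H_{+,g}:\ell^2_-(\mathbb C^q)\to\ell^2_+(\mathbb C^p)$ is given by $(H_{+,g}x)_i=\sum_{j\le0}g_{i-j}x_j$, $i\ge0$. A strict contraction is an operator with norm $<1$. *)

theory Defs
  imports "HOL-Analysis.Analysis"
begin

text \<open>An \<open>n \<times> m\<close> matrix has type \<open>complex^'m^'n\<close> (rows indexed by \<open>'n\<close>). Matrix functions on the
  unit circle are functions on all of \<open>complex\<close> of which only the values on the circle matter.\<close>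

definition unit_circle :: "complex set" where
  "unit_circle = sphere 0 1"

definition conj_transpose :: "complex^'m^'n \<Rightarrow> complex^'n^'m" where
  "conj_transpose A = map_matrix cnj (transpose A)"

definition pos_def :: "complex^'n^'n \<Rightarrow> bool" where
  "pos_def A \<longleftrightarrow> conj_transpose A = A \<and>
     (\<forall>x. x \<noteq> 0 \<longrightarrow> Re (\<Sum>i\<in>UNIV. cnj (x $ i) * (A *v x) $ i) > 0)"

text \<open>\<open>map_matrix ((*) c) A\<close> is the matrix \<open>A\<close> multiplied by the complex scalar \<open>c\<close>.\<close>

definition fourier_series :: "(complex \<Rightarrow> complex^'m^'n) \<Rightarrow> (int \<Rightarrow> complex^'m^'n) \<Rightarrow> bool" where
  "fourier_series \<rho> r \<longleftrightarrow>
     (\<lambda>\<nu>. norm (r \<nu>)) summable_on UNIV \<and>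
     (\<forall>\<zeta>\<in>unit_circle. ((\<lambda>\<nu>. map_matrix ((*) (\<zeta> powi \<nu>)) (r \<nu>)) has_sum \<rho> \<zeta>) UNIV)"

definition wiener :: "(complex \<Rightarrow> complex^'m^'n) set" where
  "wiener = {\<rho>. \<exists>r. fourier_series \<rho> r}"

text \<open>Meaningful for \<open>\<rho> \<in> wiener\<close>; the coefficients are unique by \<open>fourier_series_unique\<close> below.\<close>

definition fourier_coeff :: "(complex \<Rightarrow> complex^'m^'n) \<Rightarrow> int \<Rightarrow> complex^'m^'n" where
  "fourier_coeff \<rho> = (THE r. fourier_series \<rho> r)"

definition wiener_plus :: "(complex \<Rightarrow> complex^'m^'n) set" where
  "wiener_plus = {\<rho>\<in>wiener. \<forall>\<nu><0. fourier_coeff \<rho> \<nu> = 0}"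

definition wiener_minus :: "(complex \<Rightarrow> complex^'m^'n) set" where
  "wiener_minus = {\<rho>\<in>wiener. \<forall>\<nu>>0. fourier_coeff \<rho> \<nu> = 0}"

definition wiener_plus0 :: "(complex \<Rightarrow> complex^'m^'n) set" where
  "wiener_plus0 = {\<rho>\<in>wiener. \<forall>\<nu>\<le>0. fourier_coeff \<rho> \<nu> = 0}"

definition wiener_minus0 :: "(complex \<Rightarrow> complex^'m^'n) set" where
  "wiener_minus0 = {\<rho>\<in>wiener. \<forall>\<nu>\<ge>0. fourier_coeff \<rho> \<nu> = 0}"

text \<open>The extensions of functions in \<open>wiener_plus\<close> to the closed unit disc and of functions in
  \<open>wiener_minus\<close> to the closed exterior of the disc.\<close>

definition ext_plus :: "(complex \<Rightarrow> complex^'m^'n) \<Rightarrow> complex \<Rightarrow> complex^'m^'n" where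
  "ext_plus \<rho> z = (\<Sum>\<^sub>\<infinity>\<nu>::nat. map_matrix ((*) (z ^ \<nu>)) (fourier_coeff \<rho> (int \<nu>)))"

definition ext_minus :: "(complex \<Rightarrow> complex^'m^'n) \<Rightarrow> complex \<Rightarrow> complex^'m^'n" where
  "ext_minus \<rho> z = (\<Sum>\<^sub>\<infinity>\<nu>::nat. map_matrix ((*) (z powi (- int \<nu>))) (fourier_coeff \<rho> (- int \<nu>)))"

definition twofold_EG_solution ::
  "(complex \<Rightarrow> complex^'p^'p) \<Rightarrow> (complex \<Rightarrow> complex^'q^'p) \<Rightarrow> (complex \<Rightarrow> complex^'p^'q) \<Rightarrow>
   (complex \<Rightarrow> complex^'q^'q) \<Rightarrow> (complex \<Rightarrow> complex^'q^'p) \<Rightarrow> bool" where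
  "twofold_EG_solution \<alpha> \<beta> \<gamma> \<delta> g \<longleftrightarrow>
     g \<in> wiener_plus \<and>
     (\<lambda>\<zeta>. \<alpha> \<zeta> + g \<zeta> ** \<gamma> \<zeta> - mat 1) \<in> wiener_minus0 \<and>
     (\<lambda>\<zeta>. conj_transpose (g \<zeta>) ** \<alpha> \<zeta> + \<gamma> \<zeta>) \<in> wiener_plus0 \<and>
     (\<lambda>\<zeta>. \<delta> \<zeta> + conj_transpose (g \<zeta>) ** \<beta> \<zeta> - mat 1) \<in> wiener_plus0 \<and>
     (\<lambda>\<zeta>. g \<zeta> ** \<delta> \<zeta> + \<beta> \<zeta>) \<in> wiener_minus0"

text \<open>Square summable sequences indexed by \<open>J\<close> are represented by their extensions by zero to all
  integers.\<close>

definition ell2 :: "int set \<Rightarrow> (int \<Rightarrow> complex^'n) set" where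
  "ell2 J = {x. (\<forall>j. j \<notin> J \<longrightarrow> x j = 0) \<and> (\<lambda>j. (norm (x j))\<^sup>2) summable_on J}"

definition ell2_norm :: "int set \<Rightarrow> (int \<Rightarrow> complex^'n) \<Rightarrow> real" where
  "ell2_norm J x = sqrt (\<Sum>\<^sub>\<infinity>j\<in>J. (norm (x j))\<^sup>2)"

definition bounded_operator ::
  "int set \<Rightarrow> int set \<Rightarrow> ((int \<Rightarrow> complex^'n) \<Rightarrow> (int \<Rightarrow> complex^'m)) \<Rightarrow> bool" where
  "bounded_operator J K T \<longleftrightarrow>
     (\<forall>x\<in>ell2 J. T x \<in> ell2 K) \<and>
     (\<forall>x\<in>ell2 J. \<forall>y\<in>ell2 J. T (\<lambda>j. x j + y j) = (\<lambda>i. T x i + T y i)) \<and>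
     (\<forall>c. \<forall>x\<in>ell2 J. T (\<lambda>j. c *s x j) = (\<lambda>i. c *s T x i)) \<and>
     (\<exists>B. \<forall>x\<in>ell2 J. ell2_norm K (T x) \<le> B * ell2_norm J x)"

definition operator_norm ::
  "int set \<Rightarrow> int set \<Rightarrow> ((int \<Rightarrow> complex^'n) \<Rightarrow> (int \<Rightarrow> complex^'m)) \<Rightarrow> real" where
  "operator_norm J K T = (SUP x\<in>{x\<in>ell2 J. ell2_norm J x \<le> 1}. ell2_norm K (T x))"

definition strict_contraction ::
  "int set \<Rightarrow> int set \<Rightarrow> ((int \<Rightarrow> complex^'n) \<Rightarrow> (int \<Rightarrow> complex^'m)) \<Rightarrow> bool" where
  "strict_contraction J K T \<longleftrightarrow> bounded_operator J K T \<and> operator_norm J K T < 1"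

text \<open>\<open>hankel_plus g\<close> maps \<open>ell2 {..0}\<close> to \<open>ell2 {0..}\<close>.\<close>

definition hankel_plus ::
  "(complex \<Rightarrow> complex^'q^'p) \<Rightarrow> (int \<Rightarrow> complex^'q) \<Rightarrow> (int \<Rightarrow> complex^'p)" where
  "hankel_plus g x =
     (\<lambda>i. if i \<ge> 0 then \<Sum>\<^sub>\<infinity>j\<in>{..0}. fourier_coeff g (i - j) *v x j else 0)"


lemma integral_exp_int:
  fixes n :: int
  assumes "n \<noteq> 0"
  shows "((\<lambda>t. exp (\<i> * of_int n * of_real t)) has_integral (0::complex)) {0..2*pi}"
proof -
  define F where "F = (\<lambda>t::real. exp (\<i> * of_int n * of_real t) / (\<i> * of_int n))"
  have "((\<lambda>t. exp (\<i> * of_int n * of_real t)) has_integral (F (2*pi) - F 0)) {0..2*pi}"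
    by (rule fundamental_theorem_of_calculus)
       (use assms in \<open>auto simp: F_def intro!: derivative_eq_intros
          has_vector_derivative_real_field\<close>)
  moreover have "exp (\<i> * of_int n * of_real (2*pi)) = 1"
    using exp_integer_2pi[of "of_int n"] by (simp add: mult_ac)
  ultimately show ?thesis by (simp add: F_def)
qed

lemma fourier_scalar_zero:
  fixes c :: "int \<Rightarrow> complex"
  assumes s: "(\<lambda>\<nu>. norm (c \<nu>)) summable_on UNIV"
    and z: "\<And>\<zeta>. \<zeta> \<in> unit_circle \<Longrightarrow> ((\<lambda>\<nu>. \<zeta> powi \<nu> * c \<nu>) has_sum 0) UNIV"
  shows "c m = 0"
proof -
  define f where "f = (\<lambda>\<nu> (t::real). exp (\<i> * of_int (\<nu> - m) * of_real t) * c \<nu>)"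
  have hs: "((\<lambda>\<nu>. f \<nu> t) has_sum 0) UNIV" for t
  proof -
    define w where "w = exp (\<i> * of_real t)"
    have "w \<in> unit_circle" by (simp add: unit_circle_def w_def)
    from has_sum_cmult_right[OF z[OF this], of "w powi (-m)"]
    have "((\<lambda>\<nu>. w powi (-m) * (w powi \<nu> * c \<nu>)) has_sum 0) UNIV" by simp
    moreover have "w powi (-m) * (w powi \<nu> * c \<nu>) = f \<nu> t" for \<nu>
    proof -
      have "w \<noteq> 0" by (simp add: w_def)
      then have "w powi (-m) * w powi \<nu> = w powi (\<nu> - m)"
        by (metis add.commute power_int_add uminus_add_conv_diff)
      also have "\<dots> = exp (\<i> * of_int (\<nu> - m) * of_real t)"
        unfolding w_def by (subst exp_power_int) (simp add: mult_ac)
      finally show ?thesis by (simp add: f_def flip: mult.assoc)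
    qed
    ultimately show ?thesis by simp
  qed
  have "uniform_limit {0..2*pi} (\<lambda>X t. \<Sum>\<nu>\<in>X. f \<nu> t) (\<lambda>_. 0) (finite_subsets_at_top UNIV)"
    by (rule Weierstrass_m_test_general'[where M = "\<lambda>\<nu>. norm (c \<nu>)"])
       (use s hs in \<open>auto simp: f_def norm_mult\<close>)
  then obtain I J where I: "\<And>X. ((\<lambda>t. \<Sum>\<nu>\<in>X. f \<nu> t) has_integral I X) {0..2*pi}"
    and J: "((\<lambda>_. 0::complex) has_integral J) {0..2*pi}"
    and IJ: "(I \<longlongrightarrow> J) (finite_subsets_at_top UNIV)"
    by (rule uniform_limit_integral) (auto simp: f_def intro!: continuous_intros)
  have "J = 0" using J by (simp add: has_integral_0_eq)
  have single: "(f \<nu> has_integral (if \<nu> = m then 2 * pi * c m else 0)) {0..2*pi}" for \<nu>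
  proof (cases "\<nu> = m")
    case True
    have "((\<lambda>t. c m) has_integral (2 * pi - 0) *\<^sub>R c m) {0..2*pi}"
      using has_integral_const_real[of "c m" 0 "2*pi"] by simp
    then show ?thesis using True by (simp add: f_def scaleR_conv_of_real)
  next
    case False
    then show ?thesis
      using has_integral_mult_left[OF integral_exp_int[of "\<nu> - m"], of "c \<nu>"]
      by (simp add: f_def)
  qed
  have "I X = 2 * pi * c m" if "finite X" "m \<in> X" for X
  proof -
    have "((\<lambda>t. \<Sum>\<nu>\<in>X. f \<nu> t) has_integral
            (\<Sum>\<nu>\<in>X. if \<nu> = m then 2 * pi * c m else 0)) {0..2*pi}"
      by (rule has_integral_sum) (use that single in auto)
    then have "I X = (\<Sum>\<nu>\<in>X. if \<nu> = m then 2 * pi * c m else 0)"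
      by (rule has_integral_unique[OF I])
    with that show ?thesis by simp
  qed
  then have "\<forall>\<^sub>F X in finite_subsets_at_top UNIV. I X = 2 * pi * c m"
    unfolding eventually_finite_subsets_at_top by (intro exI[of _ "{m}"]) simp
  then have "(I \<longlongrightarrow> 2 * pi * c m) (finite_subsets_at_top UNIV)"
    by (rule tendsto_eventually)
  with IJ have "J = 2 * pi * c m"
    by (rule tendsto_unique[rotated]) simp
  with \<open>J = 0\<close> show ?thesis by simp
qed

lemma fourier_series_unique:
  fixes \<rho> :: "complex \<Rightarrow> complex^'m^'n"
  assumes "fourier_series \<rho> r" "fourier_series \<rho> s"
  shows "r = s"
proof -
  have "r m $ i $ j = s m $ i $ j" for m i j
  proof -
    have S: "(\<lambda>\<nu>. norm (r \<nu>) + norm (s \<nu>)) summable_on UNIV"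
      using assms by (intro summable_on_add) (auto simp: fourier_series_def)
    have le: "norm (r \<nu> $ i $ j - s \<nu> $ i $ j) \<le> norm (r \<nu>) + norm (s \<nu>)" for \<nu>
    proof -
      have "norm (r \<nu> $ i $ j) \<le> norm (r \<nu>)" "norm (s \<nu> $ i $ j) \<le> norm (s \<nu>)"
        by (meson Finite_Cartesian_Product.norm_nth_le order_trans)+
      then show ?thesis
        by (meson add_mono norm_triangle_ineq4 order_trans)
    qed
    have sm: "(\<lambda>\<nu>. norm (r \<nu> $ i $ j - s \<nu> $ i $ j)) summable_on UNIV"
      by (rule summable_on_comparison_test[OF S]) (use le in auto)
    have "((\<lambda>\<nu>. \<zeta> powi \<nu> * (r \<nu> $ i $ j - s \<nu> $ i $ j)) has_sum 0) UNIV"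
      if "\<zeta> \<in> unit_circle" for \<zeta>
    proof -
      have bl: "bounded_linear (\<lambda>A::complex^'m^'n. A $ i $ j)"
        using bounded_linear_compose[OF bounded_linear_vec_nth bounded_linear_vec_nth] .
      have "((\<lambda>\<nu>. \<zeta> powi \<nu> * r \<nu> $ i $ j) has_sum \<rho> \<zeta> $ i $ j) UNIV"
        if "fourier_series \<rho> r" for r
        using has_sum_bounded_linear[OF bl, of "\<lambda>\<nu>. map_matrix ((*) (\<zeta> powi \<nu>)) (r \<nu>)"]
          that \<open>\<zeta> \<in> unit_circle\<close> by (simp add: fourier_series_def o_def)
      from has_sum_add[OF this[OF assms(1)] has_sum_cmult_right[OF this[OF assms(2)], of "-1"]]
      show ?thesis by (simp add: algebra_simps)
    qed
    from fourier_scalar_zero[OF sm this] show ?thesis by simp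
  qed
  then show ?thesis by (auto simp: fun_eq_iff vec_eq_iff)
qed

lemma fourier_coeff_eq:
  assumes "fourier_series \<rho> r"
  shows "fourier_coeff \<rho> = r"
  unfolding fourier_coeff_def
  by (rule the_equality[where a = r]) (use assms in \<open>auto intro: fourier_series_unique\<close>)

end

theory Submission
  imports Defs "HOL-Complex_Analysis.Cauchy_Integral_Formula"
begin

text \<open>
  All estimates are stated for zeroth Fourier coefficients, so that \<open>\<ell>\<^sup>2\<close> enters only through the
  description of strict contractivity of \<open>H\<^bsub>+,g\<^esub>\<close> by the inequality
  \<open>- 2 Re [\<phi>* g \<psi>]\<^sub>0 \<le> k ([\<phi>* \<phi>]\<^sub>0 + [\<psi>* \<psi>]\<^sub>0)\<close> for some \<open>k < 1\<close> and all \<open>\<phi> \<in> W\<^sub>+\<close>, \<open>\<psi> \<in> W\<^sub>-\<close>.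

  If \<open>g\<close> is a solution, then \<open>\<alpha>*\<alpha> - \<gamma>*\<gamma> = \<alpha>*(\<alpha> + g\<gamma>) - (\<alpha>*g + \<gamma>*)\<gamma>\<close> lies in \<open>W\<^sub>-\<close> and is selfadjoint,
  hence constant. If \<open>\<alpha>(\<lambda>)u = 0\<close> with \<open>|\<lambda>| < 1\<close>, then \<open>\<phi> = \<alpha>u/(\<zeta> - \<lambda>)\<close> and \<open>\<psi> = \<gamma>u/(\<zeta> - \<lambda>)\<close> satisfy
  \<open>\<phi> + g\<psi> \<in> W\<^bsub>-,0\<^esub>\<close>, so contractivity makes the mean of \<open>\<phi>*\<phi> - \<psi>*\<psi> = u*a\<^sub>0u/|\<zeta> - \<lambda>|\<^sup>2\<close> nonpositive,
  which is absurd.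

  Conversely, \<open>\<alpha>\<close> and \<open>\<delta>\<close> are invertible in \<open>W\<^sub>+\<close> and \<open>W\<^sub>-\<close> by Wiener's lemma, the symbol
  \<open>f = - \<beta>\<delta>\<inverse> = - (\<alpha>*)\<inverse>\<gamma>*\<close> satisfies \<open>ff* = 1 - (\<alpha>*)\<inverse>a\<^sub>0\<alpha>\<inverse>\<close>, so that its norm is uniformly less than
  one, and the projection \<open>g\<close> of \<open>f\<close> onto \<open>W\<^sub>+\<close> is the required solution. The statements about \<open>\<delta>\<close>
  follow from those about \<open>\<alpha>\<close> by the substitution \<open>\<zeta> \<mapsto> 1/\<zeta>\<close>, which turns \<open>(\<delta>, \<beta>, g*)\<close> into data of
  the same type as \<open>(\<alpha>, \<gamma>, g)\<close>.
\<close>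

section \<open>Absolutely convergent Laurent series\<close>

text \<open>Fubini for the family \<open>a k * b m\<close> over pairs of integers, which is
  absolutely summable. The shear sending \<open>(n, k)\<close> to \<open>(k, n - k)\<close> is a
  bijection, so the family may be summed along the diagonals \<open>k + m = n\<close> instead of by
  rows. The norm estimate is what makes the Wiener functions a Banach algebra.\<close>

lemma has_sum_convolution:
  fixes a b :: "int \<Rightarrow> complex"
  assumes "(\<lambda>n. norm (a n)) summable_on UNIV" "(\<lambda>n. norm (b n)) summable_on UNIV"
  shows "(\<lambda>n. norm (\<Sum>\<^sub>\<infinity>k. a k * b (n - k))) summable_on UNIV"
    and "(\<Sum>\<^sub>\<infinity>n. norm (\<Sum>\<^sub>\<infinity>k. a k * b (n - k))) \<le> (\<Sum>\<^sub>\<infinity>n. norm (a n)) * (\<Sum>\<^sub>\<infinity>n. norm (b n))"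
    and "((\<lambda>n. \<Sum>\<^sub>\<infinity>k. a k * b (n - k)) has_sum infsum a UNIV * infsum b UNIV) UNIV"
    and "\<And>n. (\<lambda>k. norm (a k * b (n - k))) summable_on UNIV"
proof -
  have P: "(\<lambda>(k,m). norm (a k * b m)) summable_on UNIV \<times> UNIV"
  proof -
    have "(\<lambda>k. norm (\<Sum>\<^sub>\<infinity>m. norm (a k * b m))) summable_on UNIV"
      using summable_on_cmult_left[OF assms(1), of "\<Sum>\<^sub>\<infinity>n. norm (b n)"]
      by (simp add: norm_mult infsum_cmult_right' abs_mult infsum_nonneg)
    moreover have "(\<lambda>m. norm (a k * b m)) summable_on UNIV" for k
      using summable_on_cmult_right[OF assms(2), of "norm (a k)"] by (simp add: norm_mult)
    ultimately have "(\<lambda>p. norm (a (fst p) * b (snd p))) summable_on UNIV \<times> UNIV"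
      by (subst Infinite_Sum.abs_summable_on_Sigma_iff) auto
    then show ?thesis by (simp add: case_prod_unfold)
  qed
  have bij: "bij_betw (\<lambda>(n,k). (k, n - k)) (UNIV \<times> UNIV) (UNIV \<times> (UNIV::int set))"
    by (rule bij_betwI[where g = "\<lambda>(k,m). (k + m, k)"]) auto
  have Q: "(\<lambda>(n,k). norm (a k * b (n - k))) summable_on UNIV \<times> UNIV"
    using summable_on_reindex_bij_betw[OF bij, of "\<lambda>(k,m). norm (a k * b m)"] P
    by (simp add: case_prod_unfold)
  then show R: "(\<lambda>k. norm (a k * b (n - k))) summable_on UNIV" for n
    using summable_on_SigmaD1[OF Q] by simp
  have T: "(\<lambda>n. \<Sum>\<^sub>\<infinity>k. norm (a k * b (n - k))) summable_on UNIV"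
    using summable_on_Sigma_banach[OF Q] by simp
  show U: "(\<lambda>n. norm (\<Sum>\<^sub>\<infinity>k. a k * b (n - k))) summable_on UNIV"
    by (rule summable_on_comparison_test[OF T]) (use R in \<open>auto intro!: norm_infsum_bound\<close>)
  have "(\<Sum>\<^sub>\<infinity>n. norm (\<Sum>\<^sub>\<infinity>k. a k * b (n - k))) \<le> (\<Sum>\<^sub>\<infinity>n. \<Sum>\<^sub>\<infinity>k. norm (a k * b (n - k)))"
    by (rule infsum_mono[OF U T]) (use R in \<open>auto intro!: norm_infsum_bound\<close>)
  also have "\<dots> = infsum (\<lambda>(n,k). norm (a k * b (n - k))) (UNIV \<times> UNIV)"
    using infsum_Sigma'_banach[OF Q] by simp
  also have "\<dots> = infsum (\<lambda>(k,m). norm (a k * b m)) (UNIV \<times> UNIV)"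
    using infsum_reindex_bij_betw[OF bij, of "\<lambda>(k,m). norm (a k * b m)"]
    by (simp add: case_prod_unfold)
  also have "\<dots> = (\<Sum>\<^sub>\<infinity>k. \<Sum>\<^sub>\<infinity>m. norm (a k * b m))"
    using infsum_Sigma'_banach[OF P] by simp
  also have "\<dots> = (\<Sum>\<^sub>\<infinity>n. norm (a n)) * (\<Sum>\<^sub>\<infinity>n. norm (b n))"
    by (simp add: norm_mult infsum_cmult_right' infsum_cmult_left')
  finally show "(\<Sum>\<^sub>\<infinity>n. norm (\<Sum>\<^sub>\<infinity>k. a k * b (n - k))) \<le> (\<Sum>\<^sub>\<infinity>n. norm (a n)) * (\<Sum>\<^sub>\<infinity>n. norm (b n))" .
  have P': "(\<lambda>(k,m). a k * b m) summable_on UNIV \<times> UNIV"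
    by (rule abs_summable_summable) (use P in \<open>simp add: case_prod_unfold\<close>)
  have Q': "(\<lambda>(n,k). a k * b (n - k)) summable_on UNIV \<times> UNIV"
    by (rule abs_summable_summable) (use Q in \<open>simp add: case_prod_unfold\<close>)
  have "(\<Sum>\<^sub>\<infinity>n. \<Sum>\<^sub>\<infinity>k. a k * b (n - k)) = infsum (\<lambda>(n,k). a k * b (n - k)) (UNIV \<times> UNIV)"
    using infsum_Sigma'_banach[OF Q'] by simp
  also have "\<dots> = infsum (\<lambda>(k,m). a k * b m) (UNIV \<times> UNIV)"
    using infsum_reindex_bij_betw[OF bij, of "\<lambda>(k,m). a k * b m"]
    by (simp add: case_prod_unfold)
  also have "\<dots> = (\<Sum>\<^sub>\<infinity>k. \<Sum>\<^sub>\<infinity>m. a k * b m)"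
    using infsum_Sigma'_banach[OF P'] by simp
  also have "\<dots> = infsum a UNIV * infsum b UNIV"
    by (simp add: infsum_cmult_right' infsum_cmult_left')
  finally show "((\<lambda>n. \<Sum>\<^sub>\<infinity>k. a k * b (n - k)) has_sum infsum a UNIV * infsum b UNIV) UNIV"
    using has_sum_infsum[OF abs_summable_summable[OF U]] by simp
qed

lemma one_in_unit_circle: "1 \<in> unit_circle"
  by (simp add: unit_circle_def)

lemma inverse_unit_circle: "z \<in> unit_circle \<Longrightarrow> inverse z \<in> unit_circle"
  by (simp add: unit_circle_def norm_inverse)

lemma unit_circle_subset_disc: "unit_circle \<subseteq> cball 0 1"
  by (auto simp: unit_circle_def)

text \<open>The domain is a parameter because the same algebra is needed on the circle, with spectra
  in all of the integers, and on the closed disc, with nonnegative spectra. Since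
  \<open>0 powi \<nu> = 0\<close> for negative \<open>\<nu>\<close>, the terms remain defined at the
  origin.\<close>

definition wseries :: "complex set \<Rightarrow> (complex \<Rightarrow> complex) \<Rightarrow> (int \<Rightarrow> complex) \<Rightarrow> bool" where
  "wseries D f c \<longleftrightarrow> (\<lambda>\<nu>. norm (c \<nu>)) summable_on UNIV \<and>
     (\<forall>z\<in>D. ((\<lambda>\<nu>. z powi \<nu> * c \<nu>) has_sum f z) UNIV)"

text \<open>\<open>S\<close> contains the spectrum; the domain \<open>D\<close> is the unit circle or, for \<open>S \<subseteq> {0..}\<close>, the closed disc.\<close>

definition wclass :: "complex set \<Rightarrow> int set \<Rightarrow> (complex \<Rightarrow> complex) set" where
  "wclass D S = {f. \<exists>c. wseries D f c \<and> (\<forall>\<nu>. \<nu> \<notin> S \<longrightarrow> c \<nu> = 0)}"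

lemma wclassI: "wseries D f c \<Longrightarrow> (\<And>\<nu>. \<nu> \<notin> S \<Longrightarrow> c \<nu> = 0) \<Longrightarrow> f \<in> wclass D S"
  by (auto simp: wclass_def)

lemma wclassE:
  assumes "f \<in> wclass D S"
  obtains c where "wseries D f c" "\<And>\<nu>. \<nu> \<notin> S \<Longrightarrow> c \<nu> = 0"
  using assms by (auto simp: wclass_def)

lemma wseries_subset: "wseries D f c \<Longrightarrow> E \<subseteq> D \<Longrightarrow> wseries E f c"
  by (auto simp: wseries_def)

lemma wseries_cong: "(\<And>z. z \<in> D \<Longrightarrow> f z = g z) \<Longrightarrow> wseries D f c = wseries D g c"
  by (auto simp: wseries_def)

lemma wclass_cong: "(\<And>z. z \<in> D \<Longrightarrow> f z = g z) \<Longrightarrow> f \<in> wclass D S \<longleftrightarrow> g \<in> wclass D S"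
  unfolding wclass_def by (auto simp: wseries_cong[of D f g])

lemma wclass_mono: "f \<in> wclass D S \<Longrightarrow> S \<subseteq> T \<Longrightarrow> f \<in> wclass D T"
  by (auto simp: wclass_def)

lemma wclass_subset: "f \<in> wclass D S \<Longrightarrow> E \<subseteq> D \<Longrightarrow> f \<in> wclass E S"
  by (auto simp: wclass_def intro: wseries_subset)

lemma wseries_add:
  assumes "wseries D f c" "wseries D g d"
  shows "wseries D (\<lambda>z. f z + g z) (\<lambda>\<nu>. c \<nu> + d \<nu>)"
proof -
  have "(\<lambda>\<nu>. norm (c \<nu>) + norm (d \<nu>)) summable_on UNIV"
    using assms by (intro summable_on_add) (auto simp: wseries_def)
  then have "(\<lambda>\<nu>. norm (c \<nu> + d \<nu>)) summable_on UNIV"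
    by (rule summable_on_comparison_test) (auto simp: norm_triangle_ineq)
  then show ?thesis
    using assms by (auto simp: wseries_def algebra_simps intro: has_sum_add)
qed

lemma wseries_cmult:
  assumes "wseries D f c"
  shows "wseries D (\<lambda>z. a * f z) (\<lambda>\<nu>. a * c \<nu>)"
  using assms by (auto simp: wseries_def norm_mult mult.left_commute[of _ a]
    intro: summable_on_cmult_right has_sum_cmult_right)

lemma wseries_const: "wseries D (\<lambda>z. a) (\<lambda>\<nu>. if \<nu> = 0 then a else 0)"
proof -
  have 1: "(\<lambda>\<nu>. norm (if \<nu> = 0 then a else 0)) summable_on (UNIV::int set)"
    by (rule has_sum_imp_summable, rule has_sum_finite_neutralI[of "{0}"]) auto
  have 2: "((\<lambda>\<nu>. z powi \<nu> * (if \<nu> = 0 then a else 0)) has_sum a) UNIV" for z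
    by (rule has_sum_finite_neutralI[of "{0}"]) auto
  show ?thesis using 1 2 by (simp add: wseries_def)
qed

lemma wclass_add: "f \<in> wclass D S \<Longrightarrow> g \<in> wclass D S \<Longrightarrow> (\<lambda>z. f z + g z) \<in> wclass D S"
  unfolding wclass_def by (force intro: wseries_add)

lemma wclass_cmult: "f \<in> wclass D S \<Longrightarrow> (\<lambda>z. a * f z) \<in> wclass D S"
  unfolding wclass_def by (force intro: wseries_cmult)

lemma wclass_const: "0 \<in> S \<Longrightarrow> (\<lambda>z. a) \<in> wclass D S"
  by (rule wclassI[OF wseries_const]) auto

lemma wclass_zero: "(\<lambda>z. 0) \<in> wclass D S"
  by (rule wclassI[OF wseries_const]) auto

lemma wclass_uminus: "f \<in> wclass D S \<Longrightarrow> (\<lambda>z. - f z) \<in> wclass D S"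
  using wclass_cmult[of f D S "-1"] by simp

lemma wclass_diff: "f \<in> wclass D S \<Longrightarrow> g \<in> wclass D S \<Longrightarrow> (\<lambda>z. f z - g z) \<in> wclass D S"
  using wclass_add[OF _ wclass_uminus] by fastforce

lemma wclass_sum: "(\<And>i. i \<in> I \<Longrightarrow> f i \<in> wclass D S) \<Longrightarrow> (\<lambda>z. \<Sum>i\<in>I. f i z) \<in> wclass D S"
proof (induction I rule: infinite_finite_induct)
qed (auto intro: wclass_add wclass_zero)

section \<open>Products as convolutions of coefficient sequences\<close>

definition conv :: "(int \<Rightarrow> complex) \<Rightarrow> (int \<Rightarrow> complex) \<Rightarrow> int \<Rightarrow> complex" where
  "conv c d n = (\<Sum>\<^sub>\<infinity>k. c k * d (n - k))"

lemma conv_support: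
  assumes "\<And>\<nu>. \<nu> \<notin> S \<Longrightarrow> c \<nu> = 0" "\<And>\<nu>. \<nu> \<notin> T \<Longrightarrow> d \<nu> = 0"
    "\<And>s t. s \<in> S \<Longrightarrow> t \<in> T \<Longrightarrow> s + t \<in> U" "n \<notin> U"
  shows "conv c d n = 0"
  unfolding conv_def
proof (rule infsum_0)
  fix k
  show "c k * d (n - k) = 0"
    using assms(1)[of k] assms(2)[of "n - k"] assms(3)[of k "n - k"] assms(4) by auto
qed

lemma norm_powi_le_1:
  assumes "norm z = 1 \<or> (norm z \<le> 1 \<and> 0 \<le> \<nu>)"
  shows "norm (z powi \<nu> :: complex) \<le> 1"
  using assms by (auto simp: norm_power norm_inverse power_int_def power_le_one)

text \<open>Either alternative in the last hypothesis ensures that multiplying a coefficient by its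
  power of \<open>z\<close> does not increase its modulus, so the convolution theorem applies to the
  terms of the two series at each point. The second claim is submultiplicativity of the Wiener
  norm.\<close>

lemma wseries_mult:
  assumes f: "wseries D f c" "\<And>\<nu>. \<nu> \<notin> S \<Longrightarrow> c \<nu> = 0"
    and g: "wseries D g d" "\<And>\<nu>. \<nu> \<notin> T \<Longrightarrow> d \<nu> = 0"
    and D: "D \<subseteq> unit_circle \<or> (D \<subseteq> cball 0 1 \<and> S \<subseteq> {0..} \<and> T \<subseteq> {0..})"
  shows "wseries D (\<lambda>z. f z * g z) (conv c d)"
    and "(\<Sum>\<^sub>\<infinity>\<nu>. norm (conv c d \<nu>)) \<le> (\<Sum>\<^sub>\<infinity>\<nu>. norm (c \<nu>)) * (\<Sum>\<^sub>\<infinity>\<nu>. norm (d \<nu>))"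
proof -
  have sc: "(\<lambda>n. norm (c n)) summable_on UNIV" and sd: "(\<lambda>n. norm (d n)) summable_on UNIV"
    using f(1) g(1) by (auto simp: wseries_def)
  have "((\<lambda>n. z powi n * conv c d n) has_sum f z * g z) UNIV" if z: "z \<in> D" for z
  proof -
    have nz: "norm z = 1 \<or> (norm z \<le> 1 \<and> S \<subseteq> {0..} \<and> T \<subseteq> {0..})"
      using D z by (auto simp: unit_circle_def)
    have 1: "(\<lambda>n. norm (z powi n * c n)) summable_on UNIV"
    proof (rule summable_on_comparison_test[OF sc])
      fix n
      show "norm (z powi n * c n) \<le> norm (c n)"
        using nz norm_powi_le_1[of z n] f(2)[of n]
        by (cases "n \<in> S") (auto simp: norm_mult intro!: mult_left_le_one_le)
    qed auto
    have 2: "(\<lambda>n. norm (z powi n * d n)) summable_on UNIV"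
    proof (rule summable_on_comparison_test[OF sd])
      fix n
      show "norm (z powi n * d n) \<le> norm (d n)"
        using nz norm_powi_le_1[of z n] g(2)[of n]
        by (cases "n \<in> T") (auto simp: norm_mult intro!: mult_left_le_one_le)
    qed auto
    \<comment> \<open>The law \<open>z powi n = z powi k * z powi (n - k)\<close> can fail only at
      \<open>z = 0\<close> with \<open>n = 0\<close> and \<open>k \<noteq> 0\<close>; nonnegative
      spectra exclude this, since \<open>k\<close> and \<open>n - k\<close> are then both
      nonnegative.\<close>
    have pw: "z powi k * c k * (z powi (n - k) * d (n - k)) = z powi n * (c k * d (n - k))" for k n
    proof (cases "k \<in> S \<and> n - k \<in> T")
      case True
      have "z \<noteq> 0 \<or> n \<noteq> 0 \<or> k = 0 \<and> n = 0"
        using nz subsetD[of S "{0..}" k] subsetD[of T "{0..}" "n - k"] True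
        by (cases "z = 0") auto
      then have "z powi n = z powi k * z powi (n - k)"
        using power_int_add[of z k "n - k"] by auto
      then show ?thesis by simp
    qed (use f(2) g(2) in auto)
    show ?thesis
      using has_sum_convolution(3)[OF 1 2] f(1) g(1) z
      unfolding pw
      by (simp add: wseries_def infsum_cmult_right' conv_def)
         (metis (no_types, lifting) infsumI)
  qed
  then show "wseries D (\<lambda>z. f z * g z) (conv c d)"
    using has_sum_convolution(1)[OF sc sd] by (simp add: wseries_def conv_def)
  show "(\<Sum>\<^sub>\<infinity>\<nu>. norm (conv c d \<nu>)) \<le> (\<Sum>\<^sub>\<infinity>\<nu>. norm (c \<nu>)) * (\<Sum>\<^sub>\<infinity>\<nu>. norm (d \<nu>))"
    using has_sum_convolution(2)[OF sc sd] by (simp add: conv_def)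
qed

lemma wclass_mult:
  assumes f: "f \<in> wclass D S" and g: "g \<in> wclass D T"
    and "\<And>s t. s \<in> S \<Longrightarrow> t \<in> T \<Longrightarrow> s + t \<in> U"
    and D: "D \<subseteq> unit_circle \<or> (D \<subseteq> cball 0 1 \<and> S \<subseteq> {0..} \<and> T \<subseteq> {0..})"
  shows "(\<lambda>z. f z * g z) \<in> wclass D U"
proof -
  obtain c where c: "wseries D f c" "\<And>\<nu>. \<nu> \<notin> S \<Longrightarrow> c \<nu> = 0" using f by (rule wclassE) blast
  obtain d where d: "wseries D g d" "\<And>\<nu>. \<nu> \<notin> T \<Longrightarrow> d \<nu> = 0" using g by (rule wclassE) blast
  show ?thesis
    by (rule wclassI[OF wseries_mult(1)[OF c d D] conv_support[OF c(2) d(2) assms(3)]])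
qed

section \<open>Fourier coefficients of scalar functions\<close>

abbreviation wcirc :: "int set \<Rightarrow> (complex \<Rightarrow> complex) set" where
  "wcirc \<equiv> wclass unit_circle"

lemma wseries_unique:
  assumes "wseries unit_circle f c" "wseries unit_circle f d"
  shows "c = d"
proof
  fix n
  have "wseries unit_circle (\<lambda>z. 0) (\<lambda>\<nu>. c \<nu> + (-1) * d \<nu>)"
    using wseries_add[OF assms(1) wseries_cmult[OF assms(2), of "-1"]] by simp
  then have "c n + (-1) * d n = 0"
    unfolding wseries_def by (intro fourier_scalar_zero) auto
  then show "c n = d n" by simp
qed

text \<open>Scalar counterpart of \<open>fourier_coeff\<close>, meaningful on
  \<open>wcirc UNIV\<close> by \<open>wseries_unique\<close>.\<close>

definition cf :: "(complex \<Rightarrow> complex) \<Rightarrow> int \<Rightarrow> complex" where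
  "cf f = (THE c. wseries unit_circle f c)"

lemma cf_eq: "wseries unit_circle f c \<Longrightarrow> cf f = c"
  unfolding cf_def by (rule the_equality) (auto intro: wseries_unique)

lemma wcirc_cf:
  assumes "f \<in> wcirc S"
  shows "wseries unit_circle f (cf f)" "\<nu> \<notin> S \<Longrightarrow> cf f \<nu> = 0"
  using assms by (auto simp: wclass_def cf_eq)

lemma cf_norm_summable: "f \<in> wcirc S \<Longrightarrow> (\<lambda>\<nu>. norm (cf f \<nu>)) summable_on UNIV"
  using wcirc_cf(1)[of f S] by (simp add: wseries_def)

lemma wcirc_iff: "f \<in> wcirc S \<longleftrightarrow> f \<in> wcirc UNIV \<and> (\<forall>\<nu>. \<nu> \<notin> S \<longrightarrow> cf f \<nu> = 0)"
  using wcirc_cf wclass_mono[of f unit_circle S UNIV] wclassI[OF wcirc_cf(1)[of f UNIV]]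
  by blast

text \<open>By uniqueness both memberships speak about the same coefficient sequence, so the two
  support conditions hold together.\<close>

lemma wcirc_Int: "f \<in> wcirc S \<Longrightarrow> f \<in> wcirc T \<Longrightarrow> f \<in> wcirc (S \<inter> T)"
  by (subst (asm) (1 2) wcirc_iff, subst wcirc_iff) auto

lemma wcirc_UNIV: "f \<in> wcirc S \<Longrightarrow> f \<in> wcirc UNIV"
  by (simp add: wclass_mono)

lemma cf_add: "f \<in> wcirc UNIV \<Longrightarrow> g \<in> wcirc UNIV \<Longrightarrow> cf (\<lambda>z. f z + g z) \<nu> = cf f \<nu> + cf g \<nu>"
  by (simp add: cf_eq[OF wseries_add[OF wcirc_cf(1) wcirc_cf(1)]])

lemma cf_cmult: "f \<in> wcirc UNIV \<Longrightarrow> cf (\<lambda>z. a * f z) \<nu> = a * cf f \<nu>"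
  by (simp add: cf_eq[OF wseries_cmult[OF wcirc_cf(1)]])

lemma cf_uminus: "f \<in> wcirc UNIV \<Longrightarrow> cf (\<lambda>z. - f z) \<nu> = - cf f \<nu>"
  using cf_cmult[of f "-1"] by simp

lemma cf_diff: "f \<in> wcirc UNIV \<Longrightarrow> g \<in> wcirc UNIV \<Longrightarrow> cf (\<lambda>z. f z - g z) \<nu> = cf f \<nu> - cf g \<nu>"
  using cf_add[OF _ wclass_uminus] cf_uminus by fastforce

lemma cf_const: "cf (\<lambda>z. a) \<nu> = (if \<nu> = 0 then a else 0)"
  by (simp add: cf_eq[OF wseries_const])

lemma cf_sum:
  "(\<And>i. i \<in> I \<Longrightarrow> f i \<in> wcirc UNIV) \<Longrightarrow> cf (\<lambda>z. \<Sum>i\<in>I. f i z) \<nu> = (\<Sum>i\<in>I. cf (f i) \<nu>)"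
  by (induction I rule: infinite_finite_induct) (auto simp: cf_const cf_add wclass_sum)

lemma cf_mult: "f \<in> wcirc UNIV \<Longrightarrow> g \<in> wcirc UNIV \<Longrightarrow> cf (\<lambda>z. f z * g z) = conv (cf f) (cf g)"
  by (rule cf_eq, rule wseries_mult[where S = UNIV and T = UNIV]) (auto intro: wcirc_cf)

lemma cf_cong: "(\<And>z. z \<in> unit_circle \<Longrightarrow> f z = g z) \<Longrightarrow> cf f = cf g"
  unfolding cf_def using wseries_cong[of unit_circle f g] by presburger

lemma wcirc_empty: "f \<in> wcirc {} \<Longrightarrow> z \<in> unit_circle \<Longrightarrow> f z = 0"
  by (auto simp: wclass_def wseries_def dest!: bspec intro: infsumI[THEN sym, THEN trans])

section \<open>Conjugation and reflection on the circle\<close>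

lemma cnj_circle: "z \<in> unit_circle \<Longrightarrow> cnj z = inverse z"
  by (simp add: unit_circle_def inverse_complex_def cmod_def complex_eq_iff)

lemma cnj_powi_unit: "z \<in> unit_circle \<Longrightarrow> cnj (z powi \<nu>) = z powi (- \<nu>)"
  by (metis cnj_circle complex_cnj_power_int power_int_inverse power_int_minus)

lemma uminus_notin: "uminus ` S \<subseteq> T \<Longrightarrow> \<nu> \<notin> T \<Longrightarrow> - \<nu> \<notin> (S :: int set)"
  by (auto dest!: subsetD[of "uminus ` S" T \<nu>] simp: image_iff equation_minus_iff)

lemma wseries_cnj:
  assumes "wseries unit_circle f c"
  shows "wseries unit_circle (\<lambda>z. cnj (f z)) (\<lambda>\<nu>. cnj (c (- \<nu>)))"
proof -
  have b: "bij_betw uminus UNIV (UNIV :: int set)"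
    by (rule bij_betwI[where g = uminus]) auto
  have "((\<lambda>\<nu>. z powi \<nu> * cnj (c (- \<nu>))) has_sum cnj (f z)) UNIV" if z: "z \<in> unit_circle" for z
  proof -
    have "((\<lambda>\<nu>. cnj (z powi \<nu> * c \<nu>)) has_sum cnj (f z)) UNIV"
      using assms z by (intro has_sum_cnj_iff[THEN iffD2]) (auto simp: wseries_def)
    then have "((\<lambda>\<nu>. z powi (- \<nu>) * cnj (c \<nu>)) has_sum cnj (f z)) UNIV"
      using cnj_powi_unit[OF z] by simp
    then show ?thesis
      using has_sum_reindex_bij_betw[OF b, of "\<lambda>\<nu>. z powi \<nu> * cnj (c (- \<nu>))"] by simp
  qed
  then show ?thesis
    using assms summable_on_reindex_bij_betw[OF b, of "\<lambda>\<nu>. norm (c \<nu>)"]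
    by (simp add: wseries_def)
qed

lemma wcirc_cnj: "f \<in> wcirc S \<Longrightarrow> uminus ` S \<subseteq> T \<Longrightarrow> (\<lambda>z. cnj (f z)) \<in> wcirc T"
  by (rule wclassI[OF wseries_cnj[OF wcirc_cf(1)]])
     (auto dest: uminus_notin intro: wcirc_cf(2))

lemma cf_cnj: "f \<in> wcirc UNIV \<Longrightarrow> cf (\<lambda>z. cnj (f z)) \<nu> = cnj (cf f (- \<nu>))"
  by (simp add: cf_eq[OF wseries_cnj[OF wcirc_cf(1)]])

lemma wseries_inverse:
  assumes "wseries unit_circle f c"
  shows "wseries unit_circle (\<lambda>z. f (inverse z)) (\<lambda>\<nu>. c (- \<nu>))"
proof -
  have b: "bij_betw uminus UNIV (UNIV :: int set)"
    by (rule bij_betwI[where g = uminus]) auto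
  have "((\<lambda>\<nu>. z powi \<nu> * c (- \<nu>)) has_sum f (inverse z)) UNIV" if z: "z \<in> unit_circle" for z
  proof -
    have "inverse z \<in> unit_circle" using z by (simp add: unit_circle_def norm_inverse)
    then have "((\<lambda>\<nu>. inverse z powi \<nu> * c \<nu>) has_sum f (inverse z)) UNIV"
      using assms by (auto simp: wseries_def)
    then have "((\<lambda>\<nu>. z powi (- \<nu>) * c \<nu>) has_sum f (inverse z)) UNIV"
      by (simp add: power_int_minus power_int_inverse)
    then show ?thesis
      using has_sum_reindex_bij_betw[OF b, of "\<lambda>\<nu>. z powi \<nu> * c (- \<nu>)"] by simp
  qed
  then show ?thesis
    using assms summable_on_reindex_bij_betw[OF b, of "\<lambda>\<nu>. norm (c \<nu>)"]
    by (simp add: wseries_def)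
qed

lemma wcirc_inverse: "f \<in> wcirc S \<Longrightarrow> uminus ` S \<subseteq> T \<Longrightarrow> (\<lambda>z. f (inverse z)) \<in> wcirc T"
  by (rule wclassI[OF wseries_inverse[OF wcirc_cf(1)]])
     (auto dest: uminus_notin intro: wcirc_cf(2))

lemma cf_inverse: "f \<in> wcirc UNIV \<Longrightarrow> cf (\<lambda>z. f (inverse z)) \<nu> = cf f (- \<nu>)"
  by (simp add: cf_eq[OF wseries_inverse[OF wcirc_cf(1)]])

text \<open>Cutting off the coefficients outside \<open>S\<close> preserves absolute summability, so
  the projection onto a part of the spectrum stays in the Wiener algebra.\<close>

lemma wcirc_split:
  assumes "f \<in> wcirc UNIV"
  obtains g where "g \<in> wcirc S" "(\<lambda>z. f z - g z) \<in> wcirc (- S)"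
proof -
  define c where "c = (\<lambda>\<nu>. if \<nu> \<in> S then cf f \<nu> else 0)"
  define g where "g = (\<lambda>z. \<Sum>\<^sub>\<infinity>\<nu>. z powi \<nu> * c \<nu>)"
  have s: "(\<lambda>\<nu>. norm (c \<nu>)) summable_on UNIV"
    by (rule summable_on_comparison_test[OF cf_norm_summable[OF assms]]) (auto simp: c_def)
  have g: "wseries unit_circle g c"
    unfolding wseries_def g_def
  proof (intro conjI s ballI has_sum_infsum)
    fix z assume z: "z \<in> unit_circle"
    have "(\<lambda>\<nu>. norm (z powi \<nu> * c \<nu>)) summable_on UNIV"
      using s z by (simp add: norm_mult norm_power_int unit_circle_def)
    then show "(\<lambda>\<nu>. z powi \<nu> * c \<nu>) summable_on UNIV" by (rule abs_summable_summable)
  qed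
  have gS: "g \<in> wcirc S" by (rule wclassI[OF g]) (simp add: c_def)
  have "(\<lambda>z. f z - g z) \<in> wcirc (- S)"
    by (subst wcirc_iff)
       (use assms gS cf_eq[OF g] in \<open>auto intro!: wclass_diff wcirc_UNIV[OF gS]
          simp: cf_diff wcirc_UNIV[OF gS] c_def\<close>)
  with gS show ?thesis by (rule that)
qed

text \<open>Parseval's formula: conjugation reverses the coefficient sequence, so the zeroth term of
  the convolution pairs coefficients with equal index.\<close>

lemma cf_mult_cnj_has_sum:
  assumes "f \<in> wcirc UNIV" "g \<in> wcirc UNIV"
  shows "((\<lambda>k. cnj (cf f k) * cf g k) has_sum cf (\<lambda>z. cnj (f z) * g z) 0) UNIV"
proof -
  have b: "bij_betw uminus UNIV (UNIV :: int set)"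
    by (rule bij_betwI[where g = uminus]) auto
  have c: "(\<lambda>z. cnj (f z)) \<in> wcirc UNIV" using assms by (auto intro: wcirc_cnj)
  have "(\<lambda>k. cf (\<lambda>z. cnj (f z)) k * cf g (0 - k)) summable_on UNIV"
    using has_sum_convolution(4)[OF cf_norm_summable[OF c] cf_norm_summable[OF assms(2)], of 0]
    by (rule abs_summable_summable)
  then have "((\<lambda>k. cf (\<lambda>z. cnj (f z)) k * cf g (- k)) has_sum cf (\<lambda>z. cnj (f z) * g z) 0) UNIV"
    using has_sum_infsum by (fastforce simp: cf_mult[OF c assms(2)] conv_def)
  then show ?thesis
    using has_sum_reindex_bij_betw[OF b, of "\<lambda>k. cnj (cf f k) * cf g k"] assms(1)
    by (simp add: cf_cnj)
qed

text \<open>The series converges uniformly on the circle and may be integrated term by term, which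
  leaves only the constant term. This representation as a mean is what gives the positivity of
  \<open>Re_cf_0_nonneg\<close>.\<close>

lemma cf_0_has_integral:
  assumes "f \<in> wcirc UNIV"
  shows "((\<lambda>t. f (cis t)) has_integral 2 * pi * cf f 0) {0..2*pi}"
proof -
  define u where "u = (\<lambda>\<nu> t. cis t powi \<nu> * cf f \<nu>)"
  have hs: "((\<lambda>\<nu>. u \<nu> t) has_sum f (cis t)) UNIV" for t
    using wcirc_cf(1)[OF assms] by (simp add: wseries_def u_def unit_circle_def)
  have ct: "continuous_on X (u \<nu>)" for \<nu> X
    unfolding u_def by (intro continuous_intros) auto
  have "uniform_limit {0..2*pi} (\<lambda>X t. \<Sum>\<nu>\<in>X. u \<nu> t) (\<lambda>t. f (cis t)) (finite_subsets_at_top UNIV)"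
    by (rule Weierstrass_m_test_general'[where M = "\<lambda>\<nu>. norm (cf f \<nu>)"])
       (use cf_norm_summable[OF assms] hs in \<open>auto simp: u_def norm_mult norm_power_int\<close>)
  then obtain I J where I: "\<And>X. ((\<lambda>t. \<Sum>\<nu>\<in>X. u \<nu> t) has_integral I X) {0..2*pi}"
    and J: "((\<lambda>t. f (cis t)) has_integral J) {0..2*pi}"
    and IJ: "(I \<longlongrightarrow> J) (finite_subsets_at_top UNIV)"
    by (rule uniform_limit_integral) (auto intro!: continuous_intros ct)
  have single: "(u \<nu> has_integral (if \<nu> = 0 then 2 * pi * cf f 0 else 0)) {0..2*pi}" for \<nu>
  proof (cases "\<nu> = 0")
    case True
    then show ?thesis
      using has_integral_const_real[of "cf f 0" 0 "2*pi"]
      by (simp add: u_def scaleR_conv_of_real)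
  next
    case False
    have "cis t powi \<nu> = exp (\<i> * of_int \<nu> * of_real t)" for t
      by (simp add: cis_conv_exp exp_power_int mult_ac)
    then show ?thesis
      using has_integral_mult_left[OF integral_exp_int[OF False], of "cf f \<nu>"] False
      by (simp add: u_def)
  qed
  have "I X = 2 * pi * cf f 0" if "finite X" "0 \<in> X" for X
  proof -
    have "((\<lambda>t. \<Sum>\<nu>\<in>X. u \<nu> t) has_integral
            (\<Sum>\<nu>\<in>X. if \<nu> = 0 then 2 * pi * cf f 0 else 0)) {0..2*pi}"
      by (rule has_integral_sum) (use that single in auto)
    then have "I X = (\<Sum>\<nu>\<in>X. if \<nu> = 0 then 2 * pi * cf f 0 else 0)"
      by (rule has_integral_unique[OF I])
    with that show ?thesis by simp
  qed
  then have "\<forall>\<^sub>F X in finite_subsets_at_top UNIV. I X = 2 * pi * cf f 0"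
    unfolding eventually_finite_subsets_at_top by (intro exI[of _ "{0}"]) simp
  then have "(I \<longlongrightarrow> 2 * pi * cf f 0) (finite_subsets_at_top UNIV)"
    by (rule tendsto_eventually)
  with IJ have "J = 2 * pi * cf f 0"
    by (rule tendsto_unique[rotated]) simp
  with J show ?thesis by simp
qed

lemma Re_cf_0_nonneg:
  assumes "f \<in> wcirc UNIV" "\<And>z. z \<in> unit_circle \<Longrightarrow> 0 \<le> Re (f z)"
  shows "0 \<le> Re (cf f 0)"
proof -
  have "((\<lambda>t. Re (f (cis t))) has_integral Re (2 * pi * cf f 0)) {0..2*pi}"
    using has_integral_linear[OF cf_0_has_integral[OF assms(1)] bounded_linear_Re]
    by (simp add: o_def)
  then have "0 \<le> Re (2 * pi * cf f 0)"
    by (rule has_integral_nonneg) (use assms(2) in \<open>auto simp: unit_circle_def\<close>)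
  then show ?thesis using pi_gt_zero by (auto simp: zero_le_mult_iff)
qed

section \<open>Wiener's lemma for absolutely convergent power series\<close>

lemma has_sum_int_nonneg_iff:
  fixes h :: "int \<Rightarrow> 'a :: real_normed_vector"
  assumes "\<And>\<nu>. \<nu> < 0 \<Longrightarrow> h \<nu> = 0"
  shows "(h has_sum s) UNIV \<longleftrightarrow> ((\<lambda>n. h (int n)) has_sum s) UNIV"
proof -
  have "h \<nu> = 0" if "\<nu> \<notin> range int" for \<nu>
    using that assms[of \<nu>] zero_le_imp_eq_int[of \<nu>] by (cases "\<nu> < 0") auto
  then have "(h has_sum s) UNIV \<longleftrightarrow> (h has_sum s) (range int)"
    by (intro has_sum_cong_neutral) auto
  then show ?thesis by (simp add: has_sum_reindex o_def)
qed

abbreviation wdisc :: "(complex \<Rightarrow> complex) set" where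
  "wdisc \<equiv> wclass (cball 0 1) {0..}"

text \<open>The Wiener norm, that is, the sum of the moduli of the Taylor coefficients, is at most
  \<open>B\<close>.\<close>

definition wdisc_bound :: "(complex \<Rightarrow> complex) \<Rightarrow> real \<Rightarrow> bool" where
  "wdisc_bound f B \<longleftrightarrow> (\<exists>c. wseries (cball 0 1) f c \<and> (\<forall>\<nu><0. c \<nu> = 0) \<and> (\<Sum>\<^sub>\<infinity>\<nu>. norm (c \<nu>)) \<le> B)"

lemma wdisc_bound_mult:
  assumes "wdisc_bound f A" "wdisc_bound g B"
  shows "wdisc_bound (\<lambda>z. f z * g z) (A * B)"
proof -
  obtain c where c: "wseries (cball 0 1) f c" "\<And>\<nu>. \<nu> \<notin> {0..} \<Longrightarrow> c \<nu> = 0" "(\<Sum>\<^sub>\<infinity>\<nu>. norm (c \<nu>)) \<le> A"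
    using assms(1) by (auto simp: wdisc_bound_def)
  obtain d where d: "wseries (cball 0 1) g d" "\<And>\<nu>. \<nu> \<notin> {0..} \<Longrightarrow> d \<nu> = 0" "(\<Sum>\<^sub>\<infinity>\<nu>. norm (d \<nu>)) \<le> B"
    using assms(2) by (auto simp: wdisc_bound_def)
  note m = wseries_mult[OF c(1,2) d(1,2)]
  have "(\<Sum>\<^sub>\<infinity>\<nu>. norm (conv c d \<nu>)) \<le> (\<Sum>\<^sub>\<infinity>\<nu>. norm (c \<nu>)) * (\<Sum>\<^sub>\<infinity>\<nu>. norm (d \<nu>))"
    by (rule m(2)) auto
  also have "\<dots> \<le> A * B"
    by (intro mult_mono' c d infsum_nonneg) auto
  finally show ?thesis
    unfolding wdisc_bound_def
    by (intro exI[of _ "conv c d"] conjI m(1) allI impI conv_support[of "{0..}" c "{0..}" d "{0..}"])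
       (use c(2) d(2) in auto)
qed

lemma wdisc_bound_norm:
  assumes "wdisc_bound f B" "norm z \<le> 1"
  shows "norm (f z) \<le> B"
proof -
  obtain c where c: "wseries (cball 0 1) f c" "\<And>\<nu>. \<nu> < 0 \<Longrightarrow> c \<nu> = 0" "(\<Sum>\<^sub>\<infinity>\<nu>. norm (c \<nu>)) \<le> B"
    using assms(1) by (auto simp: wdisc_bound_def)
  have s: "(\<lambda>\<nu>. norm (c \<nu>)) summable_on UNIV" using c(1) by (simp add: wseries_def)
  have le: "norm (z powi \<nu> * c \<nu>) \<le> norm (c \<nu>)" for \<nu>
    using norm_powi_le_1[of z \<nu>] c(2)[of \<nu>] assms(2)
    by (cases "0 \<le> \<nu>") (auto simp: norm_mult intro!: mult_left_le_one_le)
  have t: "(\<lambda>\<nu>. norm (z powi \<nu> * c \<nu>)) summable_on UNIV"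
    by (rule summable_on_comparison_test[OF s]) (use le in auto)
  have "f z = (\<Sum>\<^sub>\<infinity>\<nu>. z powi \<nu> * c \<nu>)"
    using c(1) assms(2) by (auto simp: wseries_def intro!: infsumI[symmetric])
  then have "norm (f z) \<le> (\<Sum>\<^sub>\<infinity>\<nu>. norm (z powi \<nu> * c \<nu>))"
    using norm_infsum_bound[OF t] by simp
  also have "\<dots> \<le> (\<Sum>\<^sub>\<infinity>\<nu>. norm (c \<nu>))"
    by (rule infsum_mono[OF t s]) (rule le)
  finally show ?thesis using c(3) by simp
qed

lemma wdisc_bound_const: "wdisc_bound (\<lambda>z. a) (norm a)"
proof -
  have "(\<Sum>\<^sub>\<infinity>\<nu>::int. norm (if \<nu> = 0 then a else 0)) = norm a"
    by (rule infsumI, rule has_sum_finite_neutralI[of "{0}"]) auto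
  then show ?thesis unfolding wdisc_bound_def
    by (intro exI[of _ "\<lambda>\<nu>. if \<nu> = 0 then a else 0"] conjI wseries_const) auto
qed

lemma wdisc_bound_power: "wdisc_bound f A \<Longrightarrow> wdisc_bound (\<lambda>z. f z ^ n) (A ^ n)"
  by (induction n) (auto intro: wdisc_bound_mult simp: wdisc_bound_const[of 1, simplified])

text \<open>Completeness of the algebra: the coefficients of all the summands form an absolutely
  summable double family, so the sums over \<open>n\<close> and over \<open>\<nu>\<close> may be
  exchanged, and the coefficients of the limit are the sums of the coefficients.\<close>

lemma wdisc_bound_series:
  assumes f: "\<And>n. wdisc_bound (f n) (B n)" and B: "summable B"
    and F: "\<And>z. norm z \<le> 1 \<Longrightarrow> (\<lambda>n. f n z) sums F z"
  shows "F \<in> wdisc"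
proof -
  from f obtain c where c: "\<And>n. wseries (cball 0 1) (f n) (c n)" "\<And>n \<nu>. \<nu> < 0 \<Longrightarrow> c n \<nu> = 0"
    "\<And>n. (\<Sum>\<^sub>\<infinity>\<nu>. norm (c n \<nu>)) \<le> B n"
    unfolding wdisc_bound_def by metis
  have s: "(\<lambda>\<nu>. norm (c n \<nu>)) summable_on UNIV" for n
    using c(1) by (simp add: wseries_def)
  have B0: "0 \<le> B n" for n
    using c(3)[of n] infsum_nonneg[of UNIV "\<lambda>\<nu>. norm (c n \<nu>)"] by simp
  have Bs: "B summable_on UNIV"
    using B B0 by (simp add: summable_on_UNIV_nonneg_real_iff)
  have T: "(\<lambda>n. norm (\<Sum>\<^sub>\<infinity>\<nu>. norm (c n \<nu>))) summable_on UNIV"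
    by (rule summable_on_comparison_test[OF Bs]) (use c(3) in \<open>auto simp: infsum_nonneg\<close>)
  have P: "(\<lambda>p. norm (c (fst p) (snd p))) summable_on UNIV \<times> UNIV"
    by (subst Infinite_Sum.abs_summable_on_Sigma_iff) (use s T in auto)
  define d where "d = (\<lambda>\<nu>. \<Sum>\<^sub>\<infinity>n. c n \<nu>)"
  have bij: "bij_betw (\<lambda>(\<nu>,n). (n,\<nu>)) (UNIV \<times> UNIV) (UNIV \<times> UNIV)"
    by (rule bij_betwI[where g = "\<lambda>(n,\<nu>). (\<nu>,n)"]) auto
  have swap: "(\<lambda>p. norm (h (snd p) (fst p))) summable_on UNIV \<times> UNIV"
    if "(\<lambda>p. norm (h (fst p) (snd p))) summable_on UNIV \<times> UNIV" for h :: "nat \<Rightarrow> int \<Rightarrow> complex"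
    using summable_on_reindex_bij_betw[OF bij, of "\<lambda>p. norm (h (fst p) (snd p))"] that
    by (simp add: case_prod_unfold)
  have Q: "(\<lambda>p. norm (c (snd p) (fst p))) summable_on UNIV \<times> UNIV" by (rule swap[OF P])
  have cs: "(\<lambda>n. norm (c n \<nu>)) summable_on UNIV" for \<nu>
    using Infinite_Sum.abs_summable_on_Sigma_iff[THEN iffD1, OF Q] by simp
  have "(\<lambda>\<nu>. norm (\<Sum>\<^sub>\<infinity>n. norm (c n \<nu>))) summable_on UNIV"
    using Infinite_Sum.abs_summable_on_Sigma_iff[THEN iffD1, OF Q] by simp
  then have dn: "(\<lambda>\<nu>. norm (d \<nu>)) summable_on UNIV"
  proof (rule summable_on_comparison_test)
    show "norm (d \<nu>) \<le> norm (\<Sum>\<^sub>\<infinity>n. norm (c n \<nu>))" for \<nu>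
      unfolding d_def using norm_infsum_bound[OF cs[of \<nu>]] by (simp add: infsum_nonneg)
  qed auto
  have "((\<lambda>\<nu>. z powi \<nu> * d \<nu>) has_sum F z) UNIV" if z: "z \<in> cball 0 1" for z
  proof -
    have "(\<lambda>p. norm (z powi (snd p) * c (fst p) (snd p))) summable_on UNIV \<times> UNIV"
    proof (rule summable_on_comparison_test[OF P])
      fix p :: "nat \<times> int"
      show "norm (z powi (snd p) * c (fst p) (snd p)) \<le> norm (c (fst p) (snd p))"
        using norm_powi_le_1[of z "snd p"] c(2)[of "snd p" "fst p"] z
        by (cases "0 \<le> snd p") (auto simp: norm_mult intro!: mult_left_le_one_le)
    qed auto
    from abs_summable_summable[OF this] abs_summable_summable[OF swap[OF this]]
    have X: "(\<lambda>(n,\<nu>). z powi \<nu> * c n \<nu>) summable_on UNIV \<times> UNIV"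
      and Y: "(\<lambda>(\<nu>,n). z powi \<nu> * c n \<nu>) summable_on UNIV \<times> UNIV"
      by (simp_all add: case_prod_unfold)
    have fz: "(\<Sum>\<^sub>\<infinity>\<nu>. z powi \<nu> * c n \<nu>) = f n z" for n
      using c(1)[of n] z by (auto simp: wseries_def intro!: infsumI)
    have Z: "(\<lambda>n. f n z) summable_on UNIV"
      using summable_on_Sigma_banach[OF X] by (simp add: fz)
    have "(\<Sum>\<^sub>\<infinity>n. f n z) = (\<Sum>\<^sub>\<infinity>\<nu>. \<Sum>\<^sub>\<infinity>n. z powi \<nu> * c n \<nu>)"
      using infsum_swap_banach[OF X] by (simp add: fz)
    also have "\<dots> = (\<Sum>\<^sub>\<infinity>\<nu>. z powi \<nu> * d \<nu>)"
      by (simp add: d_def infsum_cmult_right')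
    finally have e: "(\<Sum>\<^sub>\<infinity>n. f n z) = (\<Sum>\<^sub>\<infinity>\<nu>. z powi \<nu> * d \<nu>)" .
    have "(\<lambda>n. f n z) sums (\<Sum>\<^sub>\<infinity>n. f n z)"
      using has_sum_imp_sums[OF has_sum_infsum[OF Z]] .
    then have "F z = (\<Sum>\<^sub>\<infinity>\<nu>. z powi \<nu> * d \<nu>)"
      using F[of z] z sums_unique2 unfolding e by auto
    moreover have "(\<lambda>\<nu>. z powi \<nu> * d \<nu>) summable_on UNIV"
      using summable_on_Sigma_banach[OF Y] by (simp add: d_def infsum_cmult_right')
    ultimately show ?thesis by (simp add: has_sum_infsum)
  qed
  with dn have "wseries (cball 0 1) F d" by (simp add: wseries_def)
  then show ?thesis
    by (rule wclassI) (auto simp: d_def c(2) infsum_0)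
qed

section \<open>Taylor series, Cauchy estimates and division by a zero\<close>

lemma wdisc_bound_nat:
  assumes c: "summable (\<lambda>n. norm (c n))" and f: "\<And>z. norm z \<le> 1 \<Longrightarrow> (\<lambda>n. c n * z ^ n) sums f z"
    and B: "(\<Sum>n. norm (c n)) \<le> B"
  shows "wdisc_bound f B"
proof -
  define d where "d = (\<lambda>\<nu>. if 0 \<le> \<nu> then c (nat \<nu>) else 0)"
  have s1: "((\<lambda>n. norm (c n)) has_sum (\<Sum>n. norm (c n))) UNIV"
    using c by (intro norm_summable_imp_has_sum) (auto intro: summable_sums)
  then have s2: "((\<lambda>\<nu>. norm (d \<nu>)) has_sum (\<Sum>n. norm (c n))) UNIV"
    by (subst has_sum_int_nonneg_iff) (auto simp: d_def)
  have "((\<lambda>\<nu>. z powi \<nu> * d \<nu>) has_sum f z) UNIV" if z: "norm z \<le> 1" for z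
  proof -
    have "summable (\<lambda>n. norm (c n * z ^ n))"
      by (rule summable_comparison_test'[OF c, of 0])
         (use z in \<open>auto simp: norm_mult norm_power power_le_one intro!: mult_left_le\<close>)
    then have "((\<lambda>n. c n * z ^ n) has_sum f z) UNIV"
      by (rule norm_summable_imp_has_sum) (rule f[OF z])
    then show ?thesis by (subst has_sum_int_nonneg_iff) (auto simp: d_def mult.commute)
  qed
  then show ?thesis unfolding wdisc_bound_def
    by (intro exI[of _ d]) (use s2 B in \<open>auto simp: wseries_def d_def infsumI has_sum_imp_summable\<close>)
qed

lemma wdisc_natE:
  assumes "f \<in> wdisc"
  obtains c where "summable (\<lambda>n. norm (c n))" "\<And>z. norm z \<le> 1 \<Longrightarrow> (\<lambda>n. c n * z ^ n) sums f z"
proof -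
  obtain d where d: "wseries (cball 0 1) f d" "\<And>\<nu>. \<nu> \<notin> {0..} \<Longrightarrow> d \<nu> = 0"
    using assms by (rule wclassE) blast
  have s: "(\<lambda>\<nu>. norm (d \<nu>)) summable_on UNIV" using d(1) by (simp add: wseries_def)
  have ext: "(\<lambda>n. h (int n)) sums s"
    if "\<And>\<nu>. \<nu> < 0 \<Longrightarrow> h \<nu> = 0" "(h has_sum s) UNIV" for h :: "int \<Rightarrow> 'a :: banach" and s
    using that has_sum_int_nonneg_iff has_sum_imp_sums by blast
  show ?thesis
  proof (rule that[of "\<lambda>n. d (int n)"])
    show "summable (\<lambda>n. norm (d (int n)))"
      using ext[of "\<lambda>\<nu>. norm (d \<nu>)", OF _ has_sum_infsum[OF s]] d(2) by (auto simp: sums_iff)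
    fix z :: complex assume "norm z \<le> 1"
    then have "((\<lambda>\<nu>. z powi \<nu> * d \<nu>) has_sum f z) UNIV"
      using d(1) by (auto simp: wseries_def)
    from ext[OF _ this] show "(\<lambda>n. d (int n) * z ^ n) sums f z"
      using d(2) by (simp add: mult.commute)
  qed
qed

text \<open>Cauchy's inequality on the circle of radius \<open>R\<close> bounds the
  \<open>n\<close>-th coefficient by \<open>M / R ^ n\<close>, and the geometric series sums to
  \<open>M * (R / (R - 1))\<close>. The factor of \<open>M\<close> depends on \<open>R\<close>
  alone, so one factor serves all powers of a function.\<close>

lemma wdisc_bound_holomorphic:
  assumes R: "1 < R" and h: "h holomorphic_on ball 0 R'" "R < R'"
    and M: "\<And>z. norm z = R \<Longrightarrow> norm (h z) \<le> M"
  shows "wdisc_bound h (M * (R / (R - 1)))"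
proof -
  define c where "c = (\<lambda>n. (deriv ^^ n) h 0 / fact n)"
  have cn: "norm (c n) \<le> M * (1 / R) ^ n" for n
  proof -
    have "norm ((deriv ^^ n) h 0) \<le> fact n * M / R ^ n"
    proof (rule Cauchy_inequality)
      show "h holomorphic_on ball 0 R"
        using h by (auto intro: holomorphic_on_subset)
      show "continuous_on (cball 0 R) h"
        using h by (auto intro!: holomorphic_on_imp_continuous_on intro: holomorphic_on_subset)
    qed (use R M in auto)
    then show ?thesis
      by (simp add: c_def norm_divide field_simps)
  qed
  have g: "(\<lambda>n. M * (1 / R) ^ n) sums (M * (R / (R - 1)))"
  proof -
    have "(\<lambda>n. (1 / R) ^ n) sums (1 / (1 - 1 / R))"
      by (rule geometric_sums) (use R in auto)
    moreover have "1 / (1 - 1 / R) = R / (R - 1)" using R by (simp add: field_simps)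
    ultimately show ?thesis by (metis sums_mult)
  qed
  have s: "summable (\<lambda>n. norm (c n))"
    by (rule summable_comparison_test'[OF sums_summable[OF g], of 0]) (use cn in auto)
  show ?thesis
  proof (rule wdisc_bound_nat[OF s])
    show "(\<lambda>n. c n * z ^ n) sums h z" if "norm z \<le> 1" for z
      using holomorphic_power_series[OF h(1), of z] that R h(2) by (simp add: c_def)
    show "(\<Sum>n. norm (c n)) \<le> M * (R / (R - 1))"
      using suminf_le[OF cn s sums_summable[OF g]] g by (simp add: sums_iff)
  qed
qed

lemma wdisc_continuous_on:
  assumes "f \<in> wdisc"
  shows "continuous_on (cball 0 1) f"
proof -
  obtain c where c: "summable (\<lambda>n. norm (c n))" "\<And>z. norm z \<le> 1 \<Longrightarrow> (\<lambda>n. c n * z ^ n) sums f z"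
    by (rule wdisc_natE[OF assms]) blast
  have "uniform_limit (cball 0 1) (\<lambda>n z. \<Sum>i<n. c i * z ^ i) (\<lambda>z. suminf (\<lambda>i. c i * z ^ i)) sequentially"
    by (rule Weierstrass_m_test[OF _ c(1)])
       (auto simp: norm_mult norm_power power_le_one intro!: mult_left_le)
  then have "continuous_on (cball 0 1) (\<lambda>z. suminf (\<lambda>i. c i * z ^ i))"
    by (rule uniform_limit_theorem[rotated]) (auto intro!: continuous_intros always_eventually)
  then show ?thesis
    by (rule continuous_on_cong[THEN iffD1, rotated 2]) (use c(2) in \<open>auto simp: sums_iff\<close>)
qed

text \<open>The points of the disc of radius 2 where \<open>norm (P z) \<le> m\<close> form a
  compact set that misses the closed unit disc. A point of it nearest to the origin has norm greater
  than 1, and any radius strictly between will do; if the set is empty, 2 will do.\<close>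

lemma poly_lower_bound_larger_disc:
  fixes P :: "complex \<Rightarrow> complex"
  assumes "continuous_on UNIV P" "\<And>z. norm z \<le> 1 \<Longrightarrow> m < norm (P z)"
  obtains R where "1 < R" "\<And>z. norm z \<le> R \<Longrightarrow> m \<le> norm (P z)"
proof -
  define K :: "complex set" where "K = cball 0 2 \<inter> {z. norm (P z) \<le> m}"
  have "compact K"
    unfolding K_def by (intro compact_Int_closed compact_cball closed_Collect_le continuous_intros assms(1))
  show ?thesis
  proof (cases "K = {}")
    case True
    show ?thesis by (rule that[of 2]) (use True in \<open>auto simp: K_def\<close>)
  next
    case False
    obtain w where w: "w \<in> K" "\<And>z. z \<in> K \<Longrightarrow> norm w \<le> norm z"
      using continuous_attains_inf[OF \<open>compact K\<close> False continuous_on_norm_id] by auto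
    have "1 < norm w" using w(1) assms(2)[of w] by (force simp: K_def)
    then obtain R where R: "1 < R" "R < norm w" using dense by blast
    show ?thesis
    proof (rule that[OF R(1)])
      fix z :: complex assume "norm z \<le> R"
      then have "z \<notin> K" "norm z \<le> 2" using w(2)[of z] R w(1) by (auto simp: K_def)
      then show "m \<le> norm (P z)" by (auto simp: K_def)
    qed
  qed
qed

lemma wdisc_bound_poly: "wdisc_bound (\<lambda>z. \<Sum>i<n. c i * z ^ i) (\<Sum>i<n. norm (c i))"
proof (rule wdisc_bound_nat)
  have 1: "(\<lambda>i. if i \<in> {..<n} then norm (c i) else 0) sums (\<Sum>i<n. norm (c i))"
    by (rule sums_If_finite_set) simp
  then have 2: "(\<lambda>i. norm (if i < n then c i else 0)) sums (\<Sum>i<n. norm (c i))"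
    by (rule sums_cong[THEN iffD1, rotated]) auto
  from 2 show "summable (\<lambda>i. norm (if i < n then c i else 0))"
    and "(\<Sum>i. norm (if i < n then c i else 0)) \<le> (\<Sum>i<n. norm (c i))"
    by (simp_all add: sums_iff)
  show "(\<lambda>i. (if i < n then c i else 0) * z ^ i) sums (\<Sum>i<n. c i * z ^ i)" for z
    by (rule sums_cong[THEN iffD1, OF _ sums_If_finite_set[of "{..<n}"]]) auto
qed

text \<open>As \<open>f l = 0\<close>, the function is the sum of the terms
  \<open>c n * (z ^ n - l ^ n)\<close>. Each has the factor \<open>z - l\<close>, and the cofactor
  \<open>q n\<close> has Wiener norm at most \<open>norm (c n) / (1 - norm l)\<close>, which is
  summable because \<open>norm l < 1\<close>.\<close>

lemma wdisc_divide_zero: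
  assumes f: "f \<in> wdisc" and l: "norm l < 1" "f l = 0"
  obtains h where "h \<in> wdisc" "\<And>z. norm z \<le> 1 \<Longrightarrow> f z = (z - l) * h z"
proof -
  obtain c where c: "summable (\<lambda>n. norm (c n))" "\<And>z. norm z \<le> 1 \<Longrightarrow> (\<lambda>n. c n * z ^ n) sums f z"
    by (rule wdisc_natE[OF f]) blast
  define q where "q = (\<lambda>n z. c n * (\<Sum>i<n. l ^ (n - Suc i) * z ^ i))"
  have "(\<Sum>i<n. norm (l ^ (n - Suc i))) \<le> 1 / (1 - norm l)" for n
  proof -
    have "(\<Sum>i<n. norm (l ^ (n - Suc i))) = (\<Sum>i<n. norm l ^ i)"
      unfolding norm_power by (rule sum.nat_diff_reindex)
    also have "\<dots> \<le> (\<Sum>i. norm l ^ i)"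
      by (rule sum_le_suminf) (use l in \<open>auto intro: summable_geometric\<close>)
    finally show ?thesis using l by (simp add: suminf_geometric)
  qed
  then have b: "wdisc_bound (\<lambda>z. \<Sum>i<n. l ^ (n - Suc i) * z ^ i) (1 / (1 - norm l))" for n
    using wdisc_bound_poly[where n = n and c = "\<lambda>i. l ^ (n - Suc i)"]
    unfolding wdisc_bound_def by (meson order_trans)
  have qb: "wdisc_bound (q n) (norm (c n) * (1 / (1 - norm l)))" for n
    unfolding q_def by (intro wdisc_bound_mult wdisc_bound_const b)
  have s: "summable (\<lambda>n. norm (c n) * (1 / (1 - norm l)))"
    by (rule summable_mult2[OF c(1)])
  have qs: "summable (\<lambda>n. q n z)" if "norm z \<le> 1" for z
    by (rule summable_norm_cancel, rule summable_comparison_test'[OF s, of 0])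
       (use wdisc_bound_norm[OF qb that] in auto)
  show ?thesis
  proof (rule that[of "\<lambda>z. \<Sum>n. q n z"])
    show "(\<lambda>z. \<Sum>n. q n z) \<in> wdisc"
      by (rule wdisc_bound_series[OF qb s]) (use qs in \<open>auto simp: summable_sums\<close>)
    fix z :: complex assume z: "norm z \<le> 1"
    have "(\<lambda>n. c n * z ^ n - c n * l ^ n) sums (f z - f l)"
      using l by (intro sums_diff c(2) z) auto
    moreover have "c n * z ^ n - c n * l ^ n = (z - l) * q n z" for n
    proof -
      have "c n * z ^ n - c n * l ^ n = c n * (z ^ n - l ^ n)" by (simp add: algebra_simps)
      then show ?thesis unfolding power_diff_sumr2 q_def by (simp add: mult_ac)
    qed
    ultimately have "(\<lambda>n. (z - l) * q n z) sums f z" using l(2) by simp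
    then show "f z = (z - l) * (\<Sum>n. q n z)"
      using suminf_mult[OF qs[OF z], of "z - l"] by (simp add: sums_iff)
  qed
qed

text \<open>Newman's argument: \<open>1/f = (\<Sum>n. (P - f)^n / P^(n+1))\<close> for a partial sum \<open>P\<close> of the power
  series of \<open>f\<close>; the powers of \<open>1/P\<close> are controlled by Cauchy estimates on a larger disc.\<close>

theorem wdisc_inverse:
  assumes f: "f \<in> wdisc" and nz: "\<And>z. norm z \<le> 1 \<Longrightarrow> f z \<noteq> 0"
  shows "(\<lambda>z. 1 / f z) \<in> wdisc"
proof -
  obtain c where c: "summable (\<lambda>n. norm (c n))" "\<And>z. norm z \<le> 1 \<Longrightarrow> (\<lambda>n. c n * z ^ n) sums f z"
    by (rule wdisc_natE[OF f]) blast
  obtain w where w: "norm w \<le> 1" "\<And>z. norm z \<le> 1 \<Longrightarrow> norm (f w) \<le> norm (f z)"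
    using continuous_attains_inf[OF compact_cball _ continuous_on_norm[OF wdisc_continuous_on[OF f]]]
    by fastforce
  define m where "m = norm (f w)"
  have m: "0 < m" using nz[OF w(1)] by (simp add: m_def)
  \<comment> \<open>With tail below \<open>m / 4\<close>, the partial sum \<open>P\<close> differs
    from \<open>f\<close> by at most \<open>m / 4\<close> in Wiener norm, while
    \<open>norm (P z)\<close> stays above \<open>m / 2\<close> on the disc. The ratio of the two
    bounds is \<open>1 / 2\<close>, so Newman's series is dominated by a geometric one.\<close>
  obtain N where N: "(\<Sum>n. norm (c (n + N))) < m / 4"
  proof -
    obtain N where "\<forall>n\<ge>N. norm (\<Sum>i. norm (c (i + n))) < m / 4"
      using suminf_exist_split[OF _ c(1), of "m / 4"] m by auto
    then have "(\<Sum>n. norm (c (n + N))) < m / 4"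
      by (metis abs_ge_self le_less_trans order_refl real_norm_def)
    then show ?thesis by (rule that)
  qed
  define P where "P = (\<lambda>z. \<Sum>n<N. c n * z ^ n)"
  have fP: "wdisc_bound (\<lambda>z. P z - f z) (m / 4)"
  proof (rule wdisc_bound_nat)
    let ?d = "\<lambda>n. if n < N then 0 else - c n"
    have s: "summable (\<lambda>n. norm (?d n))"
      by (rule summable_comparison_test'[OF c(1), of 0]) auto
    then show "summable (\<lambda>n. norm (?d n))" .
    have "(\<Sum>n. norm (?d n)) = (\<Sum>n. norm (?d (n + N))) + (\<Sum>n<N. norm (?d n))"
      by (rule suminf_split_initial_segment[OF s])
    then show "(\<Sum>n. norm (?d n)) \<le> m / 4" using N by simp
    fix z :: complex assume z: "norm z \<le> 1"
    have "(\<lambda>n. if n \<in> {..<N} then c n * z ^ n else 0) sums P z"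
      unfolding P_def by (rule sums_If_finite_set) simp
    from sums_diff[OF this c(2)[OF z]]
    show "(\<lambda>n. ?d n * z ^ n) sums (P z - f z)"
      by (rule sums_cong[THEN iffD1, rotated]) auto
  qed
  have nfP: "norm (P z - f z) \<le> m / 4" if z: "norm z \<le> 1" for z
    by (rule wdisc_bound_norm[OF fP z])
  have Pm: "m / 2 < norm (P z)" if z: "norm z \<le> 1" for z
    using nfP[OF z] w(2)[OF z, folded m_def] norm_triangle_ineq2[of "f z" "f z - P z"] m
      norm_minus_commute[of "f z" "P z"] by simp
  have contP: "continuous_on UNIV P" unfolding P_def by (intro continuous_intros)
  obtain R' where R': "1 < R'" "\<And>z. norm z \<le> R' \<Longrightarrow> m / 2 \<le> norm (P z)"
    by (rule poly_lower_bound_larger_disc[OF contP Pm]) blast+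
  \<comment> \<open>Two radii are used: \<open>P\<close> has no zero up to \<open>R'\<close>, and
    the Cauchy estimates are taken on the circle of radius \<open>R\<close>, strictly
    inside.\<close>
  obtain R where R: "1 < R" "R < R'" using dense[OF R'(1)] by blast
  define K where "K = R / (R - 1)"
  have P0: "P z \<noteq> 0" if "norm z \<le> R'" for z using R'(2)[OF that] m by auto
  have bP: "wdisc_bound (\<lambda>z. 1 / P z ^ Suc n) ((2 / m) ^ Suc n * K)" for n
    unfolding K_def
  proof (rule wdisc_bound_holomorphic[OF R(1) _ R(2)])
    show "(\<lambda>z. 1 / P z ^ Suc n) holomorphic_on ball 0 R'"
      using P0 by (auto intro!: holomorphic_intros simp: P_def)
    show "norm (1 / P z ^ Suc n) \<le> (2 / m) ^ Suc n" if "norm z = R" for z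
    proof -
      have "norm (1 / P z) \<le> 2 / m"
        using frac_le[of 1 1 "m / 2" "norm (P z)"] R'(2)[of z] that R m by (simp add: norm_divide)
      from power_mono[OF this, of "Suc n"] show ?thesis
        by (simp add: norm_divide norm_power norm_mult power_divide)
    qed
  qed
  show ?thesis
  proof (rule wdisc_bound_series)
    show "wdisc_bound (\<lambda>z. (P z - f z) ^ n * (1 / P z ^ Suc n)) ((m / 4) ^ n * ((2 / m) ^ Suc n * K))" for n
      by (intro wdisc_bound_mult wdisc_bound_power fP bP)
    have "(m / 4) ^ n * ((2 / m) ^ Suc n * K) = (2 / m * K) * (1 / 2) ^ n" for n
    proof -
      have "(m / 4) ^ n * (2 / m) ^ n = (1 / 2) ^ n"
        using m by (simp add: power_mult_distrib[symmetric])
      then show ?thesis by simp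
    qed
    then show "summable (\<lambda>n. (m / 4) ^ n * ((2 / m) ^ Suc n * K))"
      by (simp only:) (intro summable_mult summable_geometric, simp)
    fix z :: complex assume z: "norm z \<le> 1"
    have Pz: "P z \<noteq> 0" using P0 z R' by simp
    let ?q = "(P z - f z) / P z"
    have "norm ?q < 1"
      using nfP[OF z] Pm[OF z] m by (subst norm_divide) (simp add: divide_less_eq_1)
    then have "(\<lambda>n. 1 / P z * ?q ^ n) sums (1 / P z * (1 / (1 - ?q)))"
      by (intro sums_mult geometric_sums)
    moreover have "1 / P z * ?q ^ n = (P z - f z) ^ n * (1 / P z ^ Suc n)" for n
      by (simp add: power_divide)
    moreover have "1 / P z * (1 / (1 - ?q)) = 1 / f z"
      using Pz nz[OF z] by (simp add: field_simps)
    ultimately show "(\<lambda>n. (P z - f z) ^ n * (1 / P z ^ Suc n)) sums (1 / f z)" by simp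
  qed
qed

section \<open>Matrix and vector functions\<close>

lemma has_sum_sum:
  fixes f :: "'i \<Rightarrow> 'a \<Rightarrow> 'b::real_normed_vector"
  assumes "\<And>i. i \<in> I \<Longrightarrow> (f i has_sum s i) A"
  shows "((\<lambda>x. \<Sum>i\<in>I. f i x) has_sum (\<Sum>i\<in>I. s i)) A"
  using assms by (induction I rule: infinite_finite_induct) (auto intro: has_sum_add has_sum_0)

lemma has_sum_vec_iff:
  fixes f :: "'a \<Rightarrow> 'b::real_normed_vector^'n"
  shows "(f has_sum s) A \<longleftrightarrow> (\<forall>i. ((\<lambda>x. f x $ i) has_sum s $ i) A)"
proof
  show "(f has_sum s) A \<Longrightarrow> \<forall>i. ((\<lambda>x. f x $ i) has_sum s $ i) A"
    using has_sum_bounded_linear[OF bounded_linear_vec_nth] by (fastforce simp: o_def)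
  assume "\<forall>i. ((\<lambda>x. f x $ i) has_sum s $ i) A"
  then show "(f has_sum s) A"
    unfolding has_sum_def by (intro vec_tendstoI) (simp add: sum_component)
qed

text \<open>With the spectrum as a parameter the four Wiener classes become rays of integers,
  products are governed by sums of spectra, and adjoint and reflection by negation.\<close>

definition wmat :: "int set \<Rightarrow> (complex \<Rightarrow> complex^'m^'n) set" where
  "wmat S = {\<rho>. \<forall>i j. (\<lambda>z. \<rho> z $ i $ j) \<in> wcirc S}"

definition wvec :: "int set \<Rightarrow> (complex \<Rightarrow> complex^'n) set" where
  "wvec S = {\<phi>. \<forall>i. (\<lambda>z. \<phi> z $ i) \<in> wcirc S}"

lemma wmat_cong: "(\<And>z. z \<in> unit_circle \<Longrightarrow> \<rho> z = \<sigma> z) \<Longrightarrow> \<rho> \<in> wmat S \<longleftrightarrow> \<sigma> \<in> wmat S"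
  unfolding wmat_def
  by (simp, intro all_cong1 wclass_cong) auto

lemma wmat_mono: "\<rho> \<in> wmat S \<Longrightarrow> S \<subseteq> T \<Longrightarrow> \<rho> \<in> wmat T"
  by (auto simp: wmat_def intro: wclass_mono)

lemma wvec_mono: "\<rho> \<in> wvec S \<Longrightarrow> S \<subseteq> T \<Longrightarrow> \<rho> \<in> wvec T"
  by (auto simp: wvec_def intro: wclass_mono)

lemma wvec_UNIV: "\<phi> \<in> wvec S \<Longrightarrow> \<phi> \<in> wvec UNIV"
  by (simp add: wvec_mono)

lemma wmat_UNIV: "\<rho> \<in> wmat S \<Longrightarrow> \<rho> \<in> wmat UNIV"
  by (simp add: wmat_mono)

lemma wmat_add: "\<rho> \<in> wmat S \<Longrightarrow> \<sigma> \<in> wmat S \<Longrightarrow> (\<lambda>z. \<rho> z + \<sigma> z) \<in> wmat S"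
  by (simp add: wmat_def wclass_add)

lemma wmat_diff: "\<rho> \<in> wmat S \<Longrightarrow> \<sigma> \<in> wmat S \<Longrightarrow> (\<lambda>z. \<rho> z - \<sigma> z) \<in> wmat S"
  by (simp add: wmat_def wclass_diff)

lemma wmat_uminus: "\<rho> \<in> wmat S \<Longrightarrow> (\<lambda>z. - \<rho> z) \<in> wmat S"
  by (simp add: wmat_def wclass_uminus)

lemma wmat_const: "0 \<in> S \<Longrightarrow> (\<lambda>z. A) \<in> wmat S"
  by (simp add: wmat_def wclass_const)

lemma wmat_mult:
  assumes "\<rho> \<in> wmat S" "\<sigma> \<in> wmat T" "\<And>s t. s \<in> S \<Longrightarrow> t \<in> T \<Longrightarrow> s + t \<in> U"
  shows "(\<lambda>z. \<rho> z ** \<sigma> z) \<in> wmat U"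
  using assms by (auto simp: wmat_def matrix_matrix_mult_def intro!: wclass_sum wclass_mult[of _ _ S _ T])

lemma wmat_conj_transpose:
  assumes "\<rho> \<in> wmat S" "uminus ` S \<subseteq> T"
  shows "(\<lambda>z. conj_transpose (\<rho> z)) \<in> wmat T"
  using assms by (auto simp: wmat_def conj_transpose_def transpose_def intro!: wcirc_cnj[of _ S])

lemma wmat_inverse:
  assumes "\<rho> \<in> wmat S" "uminus ` S \<subseteq> T"
  shows "(\<lambda>z. \<rho> (inverse z)) \<in> wmat T"
  using assms by (auto simp: wmat_def intro: wcirc_inverse[where f = "\<lambda>z. \<rho> z $ _ $ _"])

lemma wvec_inverse:
  assumes "\<phi> \<in> wvec S" "uminus ` S \<subseteq> T"
  shows "(\<lambda>z. \<phi> (inverse z)) \<in> wvec T"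
  using assms by (auto simp: wvec_def intro: wcirc_inverse[where f = "\<lambda>z. \<phi> z $ _"])

lemma wmat_Int: "\<rho> \<in> wmat S \<Longrightarrow> \<rho> \<in> wmat T \<Longrightarrow> \<rho> \<in> wmat (S \<inter> T)"
  by (simp add: wmat_def wcirc_Int)

text \<open>The source of the identities in condition (ii): an expression is grouped in two ways
  that show incompatible spectra.\<close>

lemma wmat_disjoint_eq_0:
  assumes "\<rho> \<in> wmat S" "\<rho> \<in> wmat T" "S \<inter> T = {}" "z \<in> unit_circle"
  shows "\<rho> z = 0"
  using wmat_Int[OF assms(1,2)] assms(3,4) wcirc_empty[of "\<lambda>z. \<rho> z $ _ $ _" z]
  by (simp add: wmat_def vec_eq_iff)

lemma wmat_split:
  assumes "\<rho> \<in> wmat UNIV"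
  obtains \<sigma> where "\<sigma> \<in> wmat S" "(\<lambda>z. \<rho> z - \<sigma> z) \<in> wmat (- S)"
proof -
  have "\<exists>g. g \<in> wcirc S \<and> (\<lambda>z. \<rho> z $ i $ j - g z) \<in> wcirc (- S)" for i j
    using assms wcirc_split[of "\<lambda>z. \<rho> z $ i $ j" S] unfolding wmat_def by blast
  then obtain g where "\<And>i j. g i j \<in> wcirc S" "\<And>i j. (\<lambda>z. \<rho> z $ i $ j - g i j z) \<in> wcirc (- S)"
    by metis
  then show ?thesis
    by (intro that[of "\<lambda>z. \<chi> i j. g i j z"]) (auto simp: wmat_def)
qed

lemma wvec_const: "0 \<in> S \<Longrightarrow> (\<lambda>z. v) \<in> wvec S"
  by (simp add: wvec_def wclass_const)

lemma wvec_mult: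
  assumes "\<rho> \<in> wmat S" "\<phi> \<in> wvec T" "\<And>s t. s \<in> S \<Longrightarrow> t \<in> T \<Longrightarrow> s + t \<in> U"
  shows "(\<lambda>z. \<rho> z *v \<phi> z) \<in> wvec U"
  using assms by (auto simp: wmat_def wvec_def matrix_vector_mult_def intro!: wclass_sum wclass_mult[of _ _ S _ T])

lemma wvec_mult_const: "\<rho> \<in> wmat S \<Longrightarrow> (\<lambda>z. \<rho> z *v u) \<in> wvec S"
  by (rule wvec_mult[where T = "{0}"]) (auto intro: wvec_const)

lemma wvec_smult:
  assumes "f \<in> wcirc S" "\<phi> \<in> wvec T" "\<And>s t. s \<in> S \<Longrightarrow> t \<in> T \<Longrightarrow> s + t \<in> U"
  shows "(\<lambda>z. f z *s \<phi> z) \<in> wvec U"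
  using assms by (auto simp: wvec_def intro!: wclass_mult[of _ _ S _ T])

lemma summable_vecI:
  fixes r :: "int \<Rightarrow> complex^'m^'n"
  assumes "\<And>i j. (\<lambda>\<nu>. norm (r \<nu> $ i $ j)) summable_on UNIV"
  shows "(\<lambda>\<nu>. norm (r \<nu>)) summable_on UNIV"
proof -
  have "(\<lambda>\<nu>. \<Sum>i\<in>UNIV. \<Sum>j\<in>UNIV. norm (r \<nu> $ i $ j)) summable_on UNIV"
    by (rule has_sum_imp_summable, (rule has_sum_sum)+, rule has_sum_infsum, rule assms)
  moreover have "norm (r \<nu>) \<le> (\<Sum>i\<in>UNIV. \<Sum>j\<in>UNIV. norm (r \<nu> $ i $ j))" for \<nu>
  proof -
    have "norm (r \<nu>) \<le> (\<Sum>i\<in>UNIV. norm (r \<nu> $ i))"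
      unfolding norm_vec_def by (rule L2_set_le_sum) auto
    also have "\<dots> \<le> (\<Sum>i\<in>UNIV. \<Sum>j\<in>UNIV. norm (r \<nu> $ i $ j))"
      by (intro sum_mono) (simp add: norm_vec_def L2_set_le_sum)
    finally show ?thesis .
  qed
  ultimately show ?thesis by (auto intro: summable_on_comparison_test)
qed

lemma fourier_series_iff:
  "fourier_series \<rho> r \<longleftrightarrow> (\<forall>i j. wseries unit_circle (\<lambda>z. \<rho> z $ i $ j) (\<lambda>\<nu>. r \<nu> $ i $ j))"
proof -
  have "(\<lambda>\<nu>. norm (r \<nu>)) summable_on UNIV \<longleftrightarrow> (\<forall>i j. (\<lambda>\<nu>. norm (r \<nu> $ i $ j)) summable_on UNIV)"
  proof (intro iffI allI)
    fix i j assume "(\<lambda>\<nu>. norm (r \<nu>)) summable_on UNIV"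
    then show "(\<lambda>\<nu>. norm (r \<nu> $ i $ j)) summable_on UNIV"
      by (rule summable_on_comparison_test)
        (auto intro: order_trans[OF Finite_Cartesian_Product.norm_nth_le Finite_Cartesian_Product.norm_nth_le])
  qed (auto intro: summable_vecI)
  then show ?thesis
    by (auto simp: fourier_series_def wseries_def has_sum_vec_iff)
qed

lemma wiener_iff: "\<rho> \<in> wiener \<longleftrightarrow> \<rho> \<in> wmat UNIV"
proof
  assume "\<rho> \<in> wmat UNIV"
  then have "fourier_series \<rho> (\<lambda>\<nu>. \<chi> i j. cf (\<lambda>z. \<rho> z $ i $ j) \<nu>)"
    using wcirc_cf(1)[of "\<lambda>z. \<rho> z $ _ $ _" UNIV] by (simp add: fourier_series_iff wmat_def)
  then show "\<rho> \<in> wiener" by (auto simp: wiener_def)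
qed (auto simp: wiener_def fourier_series_iff wmat_def wclass_def)

lemma fourier_coeff_nth:
  assumes "\<rho> \<in> wmat UNIV"
  shows "fourier_coeff \<rho> \<nu> $ i $ j = cf (\<lambda>z. \<rho> z $ i $ j) \<nu>"
proof -
  have "fourier_series \<rho> (\<lambda>\<nu>. \<chi> i j. cf (\<lambda>z. \<rho> z $ i $ j) \<nu>)"
    using assms wcirc_cf(1)[of "\<lambda>z. \<rho> z $ _ $ _" UNIV] by (simp add: fourier_series_iff wmat_def)
  from fourier_coeff_eq[OF this] show ?thesis by simp
qed

lemma wmat_iff_fourier_coeff: "\<rho> \<in> wmat S \<longleftrightarrow> \<rho> \<in> wiener \<and> (\<forall>\<nu>. \<nu> \<notin> S \<longrightarrow> fourier_coeff \<rho> \<nu> = 0)"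
proof -
  have "\<rho> \<in> wmat S \<longleftrightarrow> \<rho> \<in> wmat UNIV \<and> (\<forall>i j \<nu>. \<nu> \<notin> S \<longrightarrow> cf (\<lambda>z. \<rho> z $ i $ j) \<nu> = 0)"
    unfolding wmat_def using wcirc_iff[of "\<lambda>z. \<rho> z $ _ $ _" S] by blast
  then show ?thesis
    by (auto simp: wiener_iff vec_eq_iff fourier_coeff_nth)
qed

lemma wiener_classes:
  "wiener_plus = wmat {0..}" "wiener_minus = wmat {..0}"
  "wiener_plus0 = wmat {1..}" "wiener_minus0 = wmat {..-1}"
  by (auto simp: wiener_plus_def wiener_minus_def wiener_plus0_def wiener_minus0_def
      wmat_iff_fourier_coeff set_eq_iff not_le)

lemma wmat_minus_fourier_coeff_0:
  assumes "\<rho> \<in> wmat S"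
  shows "(\<lambda>z. \<rho> z - fourier_coeff \<rho> 0) \<in> wmat (S - {0})"
proof -
  have u: "\<rho> \<in> wmat UNIV" using assms by (auto intro: wmat_mono)
  have "(\<lambda>z. \<rho> z $ i $ j - cf (\<lambda>z. \<rho> z $ i $ j) 0) \<in> wcirc (S - {0})" for i j
  proof (subst wcirc_iff, intro conjI allI impI)
    have 1: "(\<lambda>z. \<rho> z $ i $ j) \<in> wcirc S" and 2: "(\<lambda>z. \<rho> z $ i $ j) \<in> wcirc UNIV"
      using assms u by (auto simp: wmat_def)
    show "(\<lambda>z. \<rho> z $ i $ j - cf (\<lambda>z. \<rho> z $ i $ j) 0) \<in> wcirc UNIV"
      by (intro wclass_diff 2 wclass_const) auto
    show "cf (\<lambda>z. \<rho> z $ i $ j - cf (\<lambda>z. \<rho> z $ i $ j) 0) \<nu> = 0" if "\<nu> \<notin> S - {0}" for \<nu>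
      using that wcirc_cf(2)[OF 1, of \<nu>]
      by (cases "\<nu> = 0") (auto simp: cf_diff[OF 2 wclass_const] cf_const)
  qed
  then show ?thesis by (simp add: wmat_def fourier_coeff_nth[OF u])
qed

section \<open>Reflection of matrix functions\<close>

lemma fourier_coeff_inverse:
  "\<rho> \<in> wmat UNIV \<Longrightarrow> fourier_coeff (\<lambda>z. \<rho> (inverse z)) \<nu> = fourier_coeff \<rho> (- \<nu>)"
  using wmat_inverse[of \<rho> UNIV UNIV] cf_inverse[of "\<lambda>z. \<rho> z $ _ $ _"]
  by (simp add: vec_eq_iff fourier_coeff_nth) (simp add: wmat_def)

lemma wmat_inverse_plus: "\<rho> \<in> wmat {..0} \<Longrightarrow> (\<lambda>z. \<rho> (inverse z)) \<in> wmat {0..}"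
  by (rule wmat_inverse) auto

lemma wmat_inverse_minus: "\<rho> \<in> wmat {0..} \<Longrightarrow> (\<lambda>z. \<rho> (inverse z)) \<in> wmat {..0}"
  by (rule wmat_inverse) auto

lemma wmat_inverse_plus0: "\<rho> \<in> wmat {..-1} \<Longrightarrow> (\<lambda>z. \<rho> (inverse z)) \<in> wmat {1..}"
  by (rule wmat_inverse) auto

lemma wmat_inverse_minus0: "\<rho> \<in> wmat {1..} \<Longrightarrow> (\<lambda>z. \<rho> (inverse z)) \<in> wmat {..-1}"
  by (rule wmat_inverse) auto

text \<open>Adjoint and reflection each negate the spectrum, so together they preserve it.\<close>

lemma wmat_adjoint_inverse_plus:
  assumes "\<rho> \<in> wmat {0..}"
  shows "(\<lambda>z. conj_transpose (\<rho> (inverse z))) \<in> wmat {0..}"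
  by (rule wmat_conj_transpose[OF wmat_inverse_minus[OF assms]]) auto

lemma wmat_minus_fourier_coeff_0_plus:
  "\<rho> \<in> wmat {0..} \<Longrightarrow> (\<lambda>z. \<rho> z - fourier_coeff \<rho> 0) \<in> wmat {1..}"
  by (rule wmat_mono[OF wmat_minus_fourier_coeff_0]) auto

section \<open>Matrix algebra, the Hermitian form and positive definiteness\<close>

lemma matrix_add_rdistrib: "(A + B) ** (C :: 'a::semiring_1^'k^'m) = A ** C + B ** C"
  by (simp add: matrix_matrix_mult_def vec_eq_iff sum.distrib distrib_right)

lemma matrix_mult_minus_left: "(- A) ** (B :: 'a::ring_1^'k^'m) = - (A ** B)"
  by (simp add: matrix_matrix_mult_def vec_eq_iff sum_negf)

lemma matrix_vector_mult_minus_left: "(- A) *v (x :: 'a::ring_1^'m) = - (A *v x)"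
  by (simp add: matrix_vector_mult_def vec_eq_iff sum_negf)

lemma matrix_sub_ldistrib: "A ** (B - C :: 'a::ring_1^'k^'m) = A ** B - A ** C"
  by (simp add: matrix_matrix_mult_def vec_eq_iff sum_subtractf right_diff_distrib)

lemma matrix_sub_rdistrib: "(A - B) ** (C :: 'a::ring_1^'k^'m) = A ** C - B ** C"
  by (simp add: matrix_matrix_mult_def vec_eq_iff sum_subtractf left_diff_distrib)

lemma matrix_mult_minus_right: "A ** (- B :: 'a::ring_1^'k^'m) = - (A ** B)"
  by (simp add: matrix_matrix_mult_def vec_eq_iff sum_negf)

text \<open>Conjugate linear in the first argument; its real part is the real inner product
  \<open>\<bullet>\<close>, so Cauchy-Schwarz is available through \<open>Re_hinner\<close>.\<close>

definition hinner :: "complex^'n \<Rightarrow> complex^'n \<Rightarrow> complex" where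
  "hinner x y = (\<Sum>i\<in>UNIV. cnj (x $ i) * y $ i)"

lemma hinner_add_right: "hinner x (y + z) = hinner x y + hinner x z"
  by (simp add: hinner_def algebra_simps sum.distrib)

lemma hinner_diff_right: "hinner x (y - z) = hinner x y - hinner x z"
  by (simp add: hinner_def algebra_simps sum_subtractf)

lemma hinner_smult_right: "hinner x (c *s y) = c * hinner x y"
  by (simp add: hinner_def sum_distrib_left mult_ac)

lemma cnj_hinner: "cnj (hinner x y) = hinner y x"
  by (simp add: hinner_def mult_ac)

lemma hinner_smult_left: "hinner (c *s x) y = cnj c * hinner x y"
  by (simp add: hinner_def sum_distrib_left mult_ac)

lemma hinner_self: "hinner x x = of_real ((norm x)\<^sup>2)"
  by (simp add: hinner_def norm_vec_def L2_set_def sum_nonneg complex_norm_square[symmetric] mult.commute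
      real_sqrt_pow2 of_real_sum[symmetric] of_real_power[symmetric] del: of_real_sum of_real_power)

lemma Re_hinner_self: "Re (hinner x x) = (norm x)\<^sup>2"
  unfolding hinner_self by (rule Re_complex_of_real)

lemma Re_hinner: "Re (hinner x y) = x \<bullet> y"
  by (simp add: hinner_def inner_vec_def inner_complex_def)

lemma Re_hinner_smult_self: "Re (hinner (c *s v) (c *s v)) = (norm c)\<^sup>2 * (norm v)\<^sup>2"
proof -
  have "hinner (c *s v) (c *s v) = (cnj c * c) * hinner v v"
    by (simp only: hinner_smult_left hinner_smult_right mult_ac)
  also have "\<dots> = of_real ((norm c)\<^sup>2 * (norm v)\<^sup>2)"
    using complex_norm_square[of c] by (simp add: hinner_self mult.commute)
  finally show ?thesis by (metis Re_complex_of_real)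
qed

lemma hinner_zero [simp]: "hinner 0 x = 0" "hinner x 0 = 0"
  by (simp_all add: hinner_def)

lemma norm_complex_smult: "norm (c *s v) = norm c * norm (v :: complex^'n)"
proof -
  have "(norm (c *s v))\<^sup>2 = (norm c * norm v)\<^sup>2"
    using Re_hinner_smult_self[of c v] by (simp only: Re_hinner_self power_mult_distrib)
  then show ?thesis by simp
qed

lemma hinner_mult_right: "hinner x (A *v y) = hinner (conj_transpose A *v x) y"
proof -
  have "hinner x (A *v y) = (\<Sum>i\<in>UNIV. \<Sum>j\<in>UNIV. cnj (x $ i) * (A $ i $ j * y $ j))"
    by (simp add: hinner_def matrix_vector_mult_def sum_distrib_left)
  also have "\<dots> = (\<Sum>j\<in>UNIV. \<Sum>i\<in>UNIV. cnj (x $ i) * (A $ i $ j * y $ j))"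
    by (rule sum.swap)
  also have "\<dots> = hinner (conj_transpose A *v x) y"
    by (simp add: hinner_def matrix_vector_mult_def conj_transpose_def transpose_def
        sum_distrib_left sum_distrib_right mult_ac)
  finally show ?thesis .
qed

lemma conj_transpose_conj_transpose [simp]: "conj_transpose (conj_transpose A) = A"
  by (simp add: conj_transpose_def transpose_def vec_eq_iff)

lemma conj_transpose_mult: "conj_transpose (A ** B) = conj_transpose B ** conj_transpose A"
  by (simp add: conj_transpose_def transpose_def matrix_matrix_mult_def vec_eq_iff mult.commute)

lemma conj_transpose_add: "conj_transpose (A + B) = conj_transpose A + conj_transpose B"
  by (simp add: conj_transpose_def transpose_def vec_eq_iff)

lemma conj_transpose_diff: "conj_transpose (A - B) = conj_transpose A - conj_transpose B"
  by (simp add: conj_transpose_def transpose_def vec_eq_iff)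

lemma conj_transpose_minus: "conj_transpose (- A) = - conj_transpose A"
  by (simp add: conj_transpose_def transpose_def vec_eq_iff)

lemma conj_transpose_mat_1 [simp]: "conj_transpose (mat 1) = mat 1"
  by (simp add: conj_transpose_def transpose_def vec_eq_iff mat_def)

lemma hinner_mult_left: "hinner (A *v x) y = hinner x (conj_transpose A *v y)"
  by (simp add: hinner_mult_right)

lemma hinner_gram_diff:
  "hinner (A *v u) (A *v u) - hinner (C *v u) (C *v u)
     = hinner u ((conj_transpose A ** A - conj_transpose C ** C) *v u)"
  by (simp add: hinner_mult_left matrix_vector_mult_diff_rdistrib hinner_diff_right matrix_vector_mul_assoc)

text \<open>Turns the matrix identities of condition (ii) into identities between squared norms at a
  point of the circle.\<close>

lemma norm_gram_diff:
  assumes "conj_transpose A ** A - conj_transpose C ** C = B"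
  shows "(norm (A *v u))\<^sup>2 - (norm (C *v u))\<^sup>2 = Re (hinner u (B *v u))"
  using hinner_gram_diff[of A u C] unfolding assms by (metis Re_hinner_self minus_complex.sel(1))

lemma pos_def_iff: "pos_def A \<longleftrightarrow> conj_transpose A = A \<and> (\<forall>x. x \<noteq> 0 \<longrightarrow> Re (hinner x (A *v x)) > 0)"
  by (simp add: pos_def_def hinner_def)

text \<open>The constant is the minimum of the quadratic form on the compact unit sphere;
  homogeneity carries the bound to all vectors.\<close>

lemma pos_def_coercive:
  fixes A :: "complex^'n^'n"
  assumes "pos_def A"
  obtains c where "0 < c" "\<And>x. c * (norm x)\<^sup>2 \<le> Re (hinner x (A *v x))"
proof -
  have ne: "sphere (0::complex^'n) 1 \<noteq> {}"
    by (simp add: sphere_eq_empty)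
  have ct: "continuous_on (sphere 0 1) (\<lambda>x. Re (hinner x (A *v x)))"
    unfolding hinner_def matrix_vector_mult_def by (auto intro!: continuous_intros)
  obtain u where u: "norm u = 1" "\<And>v. norm v = 1 \<Longrightarrow> Re (hinner u (A *v u)) \<le> Re (hinner v (A *v v))"
    using continuous_attains_inf[OF compact_sphere ne ct] by auto
  show ?thesis
  proof (rule that)
    show "0 < Re (hinner u (A *v u))" using assms u(1) by (cases "u = 0") (auto simp: pos_def_iff)
    fix x :: "complex^'n"
    show "Re (hinner u (A *v u)) * (norm x)\<^sup>2 \<le> Re (hinner x (A *v x))"
    proof (cases "x = 0")
      case False
      define v where "v = inverse (norm x) *\<^sub>R x"
      have x: "x = of_real (norm x) *s v" using False
        by (simp add: v_def vec_eq_iff scaleR_conv_of_real[of _ "_ :: complex"])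
      have "norm v = 1" using False by (simp add: v_def)
      have "Re (hinner x (A *v x)) = (norm x)\<^sup>2 * Re (hinner v (A *v v))"
        by (subst (1 2) x) (simp add: hinner_smult_left hinner_smult_right vector_scalar_commute
          power2_eq_square)
      then show ?thesis using u(2)[OF \<open>norm v = 1\<close>] by (simp add: mult_right_mono mult.commute[of "(norm x)\<^sup>2"])
    qed simp
  qed
qed

lemma det_eq_0_vector:
  fixes A :: "complex^'n^'n"
  assumes "det A = 0"
  obtains u where "u \<noteq> 0" "A *v u = 0"
proof -
  have "\<not> invertible A" using assms by (simp add: invertible_det_nz)
  then have "\<not> (\<exists>B. B ** A = mat 1)" by (metis invertible_left_inverse)
  then have "\<not> (\<forall>x. A *v x = 0 \<longrightarrow> x = 0)" by (simp add: matrix_left_invertible_ker)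
  then show ?thesis using that by auto
qed

lemma pos_def_det_nonzero:
  fixes A :: "complex^'n^'n"
  assumes "pos_def A"
  shows "det A \<noteq> 0"
proof
  assume "det A = 0"
  then obtain u where "u \<noteq> 0" "A *v u = 0" by (rule det_eq_0_vector)
  then show False using assms by (auto simp: pos_def_iff)
qed

section \<open>Extension to the disc and inversion\<close>

text \<open>The extension has the same coefficients as the function on the circle, so the results on
  the closed disc, inversion and division by a zero, apply to its entries.\<close>

lemma wseries_ext_plus:
  assumes "\<rho> \<in> wmat {0..}"
  shows "wseries (cball 0 1) (\<lambda>z. ext_plus \<rho> z $ i $ j) (cf (\<lambda>z. \<rho> z $ i $ j))"
proof -
  have u: "\<rho> \<in> wmat UNIV" using assms by (rule wmat_UNIV)
  let ?c = "\<lambda>i j. cf (\<lambda>z. \<rho> z $ i $ j)"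
  have s: "(\<lambda>\<nu>. norm (?c i j \<nu>)) summable_on UNIV" and z: "\<And>\<nu>. \<nu> < 0 \<Longrightarrow> ?c i j \<nu> = 0" for i j
    using assms cf_norm_summable wcirc_cf(2)[of "\<lambda>z. \<rho> z $ i $ j" "{0..}"] by (auto simp: wmat_def)
  have "((\<lambda>\<nu>. w powi \<nu> * ?c i j \<nu>) has_sum ext_plus \<rho> w $ i $ j) UNIV" if w: "norm w \<le> 1" for w
  proof -
    have h: "((\<lambda>n. w ^ n * ?c i j (int n)) has_sum (\<Sum>\<^sub>\<infinity>\<nu>. w powi \<nu> * ?c i j \<nu>)) UNIV" for i j
    proof -
      have "(\<lambda>\<nu>. norm (w powi \<nu> * ?c i j \<nu>)) summable_on UNIV"
      proof (rule summable_on_comparison_test[OF s[of i j]])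
        show "norm (w powi \<nu> * ?c i j \<nu>) \<le> norm (?c i j \<nu>)" for \<nu>
          using norm_powi_le_1[of w \<nu>] w z[of \<nu> i j]
          by (cases "0 \<le> \<nu>") (auto simp: norm_mult intro!: mult_left_le_one_le)
      qed auto
      from has_sum_infsum[OF abs_summable_summable[OF this]]
      show ?thesis by (subst (asm) has_sum_int_nonneg_iff) (auto simp: z)
    qed
    have "((\<lambda>n. map_matrix ((*) (w ^ n)) (fourier_coeff \<rho> (int n))) has_sum
        (\<chi> i j. \<Sum>\<^sub>\<infinity>\<nu>. w powi \<nu> * ?c i j \<nu>)) UNIV"
      using h by (simp add: has_sum_vec_iff fourier_coeff_nth[OF u])
    then have "ext_plus \<rho> w = (\<chi> i j. \<Sum>\<^sub>\<infinity>\<nu>. w powi \<nu> * ?c i j \<nu>)"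
      unfolding ext_plus_def by (rule infsumI)
    then show ?thesis
      using h[of i j] by (subst has_sum_int_nonneg_iff) (auto simp: z)
  qed
  with s show ?thesis by (auto simp: wseries_def)
qed

lemma ext_plus_wdisc:
  assumes "\<rho> \<in> wmat {0..}"
  shows "(\<lambda>z. ext_plus \<rho> z $ i $ j) \<in> wdisc"
  using assms wcirc_cf(2)[of "\<lambda>z. \<rho> z $ i $ j" "{0..}"]
  by (intro wclassI[OF wseries_ext_plus]) (auto simp: wmat_def)

lemma ext_plus_unit_circle:
  assumes "\<rho> \<in> wmat {0..}" "z \<in> unit_circle"
  shows "ext_plus \<rho> z = \<rho> z"
proof -
  have "ext_plus \<rho> z $ i $ j = \<rho> z $ i $ j" for i j
  proof (rule has_sum_unique)
    show "((\<lambda>\<nu>. z powi \<nu> * cf (\<lambda>z. \<rho> z $ i $ j) \<nu>) has_sum ext_plus \<rho> z $ i $ j) UNIV"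
      using wseries_ext_plus[OF assms(1), of i j] assms(2) by (auto simp: wseries_def unit_circle_def)
    show "((\<lambda>\<nu>. z powi \<nu> * cf (\<lambda>z. \<rho> z $ i $ j) \<nu>) has_sum \<rho> z $ i $ j) UNIV"
      using wcirc_cf(1)[of "\<lambda>z. \<rho> z $ i $ j" "{0..}"] assms by (auto simp: wseries_def wmat_def)
  qed
  then show ?thesis by (simp add: vec_eq_iff)
qed

lemma ext_plus_0:
  assumes "\<rho> \<in> wmat {0..}"
  shows "ext_plus \<rho> 0 = fourier_coeff \<rho> 0"
proof -
  have "((\<lambda>\<nu>. map_matrix ((*) (0 ^ \<nu>)) (fourier_coeff \<rho> (int \<nu>))) has_sum fourier_coeff \<rho> 0) UNIV"
    by (rule has_sum_finite_neutralI[of "{0}"]) (auto simp: vec_eq_iff)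
  then show ?thesis unfolding ext_plus_def by (rule infsumI)
qed

lemma ext_minus_eq:
  assumes "\<rho> \<in> wmat UNIV"
  shows "ext_minus \<rho> z = ext_plus (\<lambda>z. \<rho> (inverse z)) (inverse z)"
  unfolding ext_minus_def ext_plus_def fourier_coeff_inverse[OF assms]
  by (simp add: power_int_minus power_inverse)

text \<open>With \<open>w = inverse z\<close> the function is \<open>w / (1 - l * w)\<close>. The
  denominator has no zero in the closed disc, so \<open>wdisc_inverse\<close> inverts it; the factor
  \<open>w\<close> removes the constant term, and reflection makes the spectrum negative.\<close>

lemma wcirc_inverse_diff:
  assumes "norm l < 1"
  shows "(\<lambda>z. 1 / (z - l)) \<in> wcirc {..-1}"
proof -
  have idser: "wdisc_bound (\<lambda>z. z) 1"
    using wdisc_bound_poly[where n = 2 and c = "\<lambda>i. of_nat i"] by (simp add: numeral_2_eq_2)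
  have W: "(\<lambda>w. 1 - l * w) \<in> wdisc"
    using idser by (intro wclass_diff wclass_const wclass_cmult) (auto simp: wdisc_bound_def wclass_def)
  have inv: "(\<lambda>w. 1 / (1 - l * w)) \<in> wdisc"
  proof (rule wdisc_inverse[OF W])
    fix z :: complex assume "norm z \<le> 1"
    then have "norm (l * z) < 1"
      using assms by (simp add: norm_mult) (metis mult_left_le norm_ge_zero order.strict_trans1)
    then show "1 - l * z \<noteq> 0" by auto
  qed
  have id1: "(\<lambda>z. z) \<in> wcirc {1..}"
  proof (rule wclassI)
    show "wseries unit_circle (\<lambda>z. z) (\<lambda>\<nu>. if \<nu> = 1 then 1 else 0)"
      unfolding wseries_def
      by (intro conjI ballI has_sum_imp_summable[OF has_sum_finite_neutralI[of "{1}"]]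
          has_sum_finite_neutralI[of "{1}"]) auto
  qed auto
  have "(\<lambda>w. 1 / (1 - l * w)) \<in> wcirc {0..}"
    using inv by (rule wclass_subset) (auto simp: unit_circle_def)
  from wclass_mult[OF id1 this, of "{1..}"]
  have "(\<lambda>w. w * (1 / (1 - l * w))) \<in> wcirc {1..}" by auto
  then have "(\<lambda>z. inverse z * (1 / (1 - l * inverse z))) \<in> wcirc {..-1}"
    by (rule wcirc_inverse) auto
  moreover have "inverse z * (1 / (1 - l * inverse z)) = 1 / (z - l)" if "z \<in> unit_circle" for z
    using that by (auto simp: unit_circle_def field_simps)
  ultimately show ?thesis using wclass_cong by (metis (no_types, lifting))
qed

lemma wdisc_mult: "f \<in> wdisc \<Longrightarrow> g \<in> wdisc \<Longrightarrow> (\<lambda>z. f z * g z) \<in> wdisc"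
  by (rule wclass_mult[of _ _ "{0..}" _ "{0..}"]) auto

lemma wdisc_prod: "(\<And>i. i \<in> I \<Longrightarrow> f i \<in> wdisc) \<Longrightarrow> (\<lambda>z. \<Prod>i\<in>I. f i z) \<in> wdisc"
  by (induction I rule: infinite_finite_induct) (auto intro: wdisc_mult wclass_const)

lemma wdisc_det:
  fixes M :: "complex \<Rightarrow> complex^'n^'n"
  assumes "\<And>i j. (\<lambda>z. M z $ i $ j) \<in> wdisc"
  shows "(\<lambda>z. det (M z)) \<in> wdisc"
  unfolding det_def by (intro wclass_sum wdisc_mult wdisc_prod wclass_const assms) auto

text \<open>By Cramer's rule the entries of the inverse are determinants divided by
  \<open>det (ext_plus \<alpha> z)\<close>. Determinants of disc functions are disc functions, so
  the scalar form of Wiener's lemma, applied to the denominator, suffices.\<close>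

lemma wmat_plus_invertible:
  fixes \<alpha> :: "complex \<Rightarrow> complex^'n^'n"
  assumes \<alpha>: "\<alpha> \<in> wmat {0..}" and nz: "\<And>z. norm z \<le> 1 \<Longrightarrow> det (ext_plus \<alpha> z) \<noteq> 0"
  obtains \<alpha>' where "\<alpha>' \<in> wmat {0..}"
    "\<And>z. z \<in> unit_circle \<Longrightarrow> \<alpha> z ** \<alpha>' z = mat 1" "\<And>z. z \<in> unit_circle \<Longrightarrow> \<alpha>' z ** \<alpha> z = mat 1"
proof -
  let ?E = "ext_plus \<alpha>"
  \<comment> \<open>The entry in row \<open>i\<close> of the solution of
    \<open>?E z *v x = axis j 1\<close>: column \<open>i\<close> of the matrix is replaced by the
    right-hand side.\<close>
  define B where "B = (\<lambda>z. \<chi> i j. det (\<chi> a b. if b = i then axis j 1 $ a else ?E z $ a $ b) / det (?E z))"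
  have "(\<lambda>z. B z $ i $ j) \<in> wdisc" for i j
  proof -
    have "(\<lambda>z. det (\<chi> a b. if b = i then axis j 1 $ a else ?E z $ a $ b) * (1 / det (?E z))) \<in> wdisc"
    proof (intro wdisc_mult wdisc_inverse wdisc_det nz)
      fix a b
      show "(\<lambda>z. (\<chi> a b. if b = i then axis j 1 $ a else ?E z $ a $ b) $ a $ b) \<in> wdisc"
        using ext_plus_wdisc[OF \<alpha>] wclass_const by (cases "b = i") auto
    qed (rule ext_plus_wdisc[OF \<alpha>])
    then show ?thesis by (simp add: B_def)
  qed
  then have B: "B \<in> wmat {0..}"
    unfolding wmat_def using wclass_subset[OF _ unit_circle_subset_disc] by blast
  have EB: "?E z ** B z = mat 1" if "norm z \<le> 1" for z
  proof -
    have "?E z *v (\<chi> i. B z $ i $ j) = axis j 1" for j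
      using cramer[OF nz[OF that], of "\<chi> i. B z $ i $ j" "axis j 1"] by (simp add: B_def)
    then have "(\<Sum>k\<in>UNIV. ?E z $ i $ k * B z $ k $ j) = axis j 1 $ i" for i j
      by (simp add: matrix_vector_mult_def vec_eq_iff)
    then show ?thesis
      by (simp add: matrix_matrix_mult_def vec_eq_iff mat_def axis_def eq_commute)
  qed
  show ?thesis
  proof (rule that[OF B])
    fix z assume z: "z \<in> unit_circle"
    show "\<alpha> z ** B z = mat 1"
      using EB[of z] z ext_plus_unit_circle[OF \<alpha> z] by (simp add: unit_circle_def)
    then show "B z ** \<alpha> z = mat 1" by (simp add: matrix_left_right_inverse)
  qed
qed

section \<open>Means of sesquilinear forms\<close>

text \<open>The inner product of \<open>\<phi>\<close> and \<open>\<psi>\<close> in the space of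
  square integrable functions on the circle with normalized measure, expressed by a Fourier
  coefficient.\<close>

definition mip :: "(complex \<Rightarrow> complex^'n) \<Rightarrow> (complex \<Rightarrow> complex^'n) \<Rightarrow> complex" where
  "mip \<phi> \<psi> = cf (\<lambda>z. hinner (\<phi> z) (\<psi> z)) 0"

lemma wcirc_hinner:
  assumes "\<phi> \<in> wvec S" "\<psi> \<in> wvec T" "\<And>s t. s \<in> S \<Longrightarrow> t \<in> T \<Longrightarrow> t - s \<in> U"
  shows "(\<lambda>z. hinner (\<phi> z) (\<psi> z)) \<in> wcirc U"
  unfolding hinner_def
proof (rule wclass_sum)
  fix i
  show "(\<lambda>z. cnj (\<phi> z $ i) * \<psi> z $ i) \<in> wcirc U"
  proof (rule wclass_mult)
    show "(\<lambda>z. cnj (\<phi> z $ i)) \<in> wcirc (uminus ` S)"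
      using assms(1) by (intro wcirc_cnj[of _ S]) (auto simp: wvec_def)
    show "(\<lambda>z. \<psi> z $ i) \<in> wcirc T" using assms(2) by (simp add: wvec_def)
    show "s + t \<in> U" if "s \<in> uminus ` S" "t \<in> T" for s t
      using that assms(3) by force
  qed auto
qed

lemma wcirc_hinner_UNIV: "\<phi> \<in> wvec S \<Longrightarrow> \<psi> \<in> wvec T \<Longrightarrow> (\<lambda>z. hinner (\<phi> z) (\<psi> z)) \<in> wcirc UNIV"
  by (rule wcirc_hinner) auto

lemma mip_add_right:
  "\<phi> \<in> wvec UNIV \<Longrightarrow> \<psi> \<in> wvec UNIV \<Longrightarrow> \<psi>' \<in> wvec UNIV \<Longrightarrow>
     mip \<phi> (\<lambda>z. \<psi> z + \<psi>' z) = mip \<phi> \<psi> + mip \<phi> \<psi>'"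
  unfolding mip_def hinner_add_right by (intro cf_add wcirc_hinner_UNIV)

lemma mip_diff_right:
  "\<phi> \<in> wvec UNIV \<Longrightarrow> \<psi> \<in> wvec UNIV \<Longrightarrow> \<psi>' \<in> wvec UNIV \<Longrightarrow>
     mip \<phi> (\<lambda>z. \<psi> z - \<psi>' z) = mip \<phi> \<psi> - mip \<phi> \<psi>'"
  unfolding mip_def hinner_diff_right by (intro cf_diff wcirc_hinner_UNIV)

lemma int_rays_disjoint:
  "{..-1} \<inter> {0..} = ({} :: int set)" "{0..} \<inter> {..-1} = ({} :: int set)"
  "{1..} \<inter> {..0} = ({} :: int set)" "{..0} \<inter> {1..} = ({} :: int set)"
  by auto

lemma mip_cnj:
  assumes "\<phi> \<in> wvec UNIV" "\<psi> \<in> wvec UNIV"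
  shows "mip \<psi> \<phi> = cnj (mip \<phi> \<psi>)"
  using cf_cnj[OF wcirc_hinner_UNIV[OF assms], of 0] unfolding mip_def cnj_hinner by simp

text \<open>Disjoint spectra are orthogonal: a difference \<open>t - s\<close> of frequencies is
  never zero, so the Hermitian product has no constant term.\<close>

lemma mip_disjoint:
  assumes "\<phi> \<in> wvec S" "\<psi> \<in> wvec T" "S \<inter> T = {}"
  shows "mip \<phi> \<psi> = 0"
  unfolding mip_def
  by (rule wcirc_cf(2)[of _ "- {0}"], rule wcirc_hinner[OF assms(1,2)]) (use assms(3) in auto)

lemma mip_adjoint: "mip \<phi> (\<lambda>z. \<rho> z *v \<psi> z) = mip (\<lambda>z. conj_transpose (\<rho> z) *v \<phi> z) \<psi>"
  unfolding mip_def hinner_mult_right ..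

lemma mip_inverse:
  assumes "\<phi> \<in> wvec UNIV" "\<psi> \<in> wvec UNIV"
  shows "mip (\<lambda>z. \<phi> (inverse z)) (\<lambda>z. \<psi> (inverse z)) = mip \<phi> \<psi>"
  using cf_inverse[OF wcirc_hinner_UNIV[OF assms], of 0] unfolding mip_def by simp

lemma mip_has_sum:
  assumes "\<phi> \<in> wvec UNIV" "\<psi> \<in> wvec UNIV"
  shows "((\<lambda>k. \<Sum>i\<in>UNIV. cnj (cf (\<lambda>z. \<phi> z $ i) k) * cf (\<lambda>z. \<psi> z $ i) k) has_sum mip \<phi> \<psi>) UNIV"
proof -
  have c: "(\<lambda>z. cnj (\<phi> z $ i) * \<psi> z $ i) \<in> wcirc UNIV" for i
    using assms by (intro wclass_mult[of _ _ UNIV _ UNIV] wcirc_cnj[of _ UNIV]) (auto simp: wvec_def)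
  have "mip \<phi> \<psi> = (\<Sum>i\<in>UNIV. cf (\<lambda>z. cnj (\<phi> z $ i) * \<psi> z $ i) 0)"
    unfolding mip_def hinner_def by (rule cf_sum) (rule c)
  moreover have "((\<lambda>k. \<Sum>i\<in>UNIV. cnj (cf (\<lambda>z. \<phi> z $ i) k) * cf (\<lambda>z. \<psi> z $ i) k) has_sum
      (\<Sum>i\<in>UNIV. cf (\<lambda>z. cnj (\<phi> z $ i) * \<psi> z $ i) 0)) UNIV"
    by (intro has_sum_sum cf_mult_cnj_has_sum) (use assms in \<open>auto simp: wvec_def\<close>)
  ultimately show ?thesis by simp
qed

lemma Re_mip_self_nonneg: "\<phi> \<in> wvec UNIV \<Longrightarrow> 0 \<le> Re (mip \<phi> \<phi>)"
  unfolding mip_def by (rule Re_cf_0_nonneg) (auto intro: wcirc_hinner_UNIV simp del: of_real_power simp: Re_hinner_self)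

text \<open>By Parseval the squared norm of every single coefficient is at most
  \<open>Re (mip \<phi> \<phi>)\<close>, so all coefficients vanish.\<close>

lemma mip_self_eq_0:
  assumes "\<phi> \<in> wvec UNIV" "Re (mip \<phi> \<phi>) \<le> 0" "z \<in> unit_circle"
  shows "\<phi> z = 0"
proof -
  let ?c = "\<lambda>k. \<chi> i. cf (\<lambda>z. \<phi> z $ i) k"
  have "((\<lambda>k. hinner (?c k) (?c k)) has_sum mip \<phi> \<phi>) UNIV"
    using mip_has_sum[OF assms(1,1)] by (simp add: hinner_def)
  from has_sum_Re[OF this] have s: "((\<lambda>k. (norm (?c k))\<^sup>2) has_sum Re (mip \<phi> \<phi>)) UNIV"
    by (simp add: Re_hinner_self)
  have "(norm (?c k))\<^sup>2 \<le> Re (mip \<phi> \<phi>)" for k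
    using has_sum_mono_neutral[OF has_sum_finite[of "{k}" "\<lambda>k. (norm (?c k))\<^sup>2"] s] by simp
  with assms(2) have "(norm (?c k))\<^sup>2 \<le> 0" for k
    by (meson order_trans)
  then have "cf (\<lambda>z. \<phi> z $ i) k = 0" for i k
    by (simp add: vec_eq_iff)
  then have "(\<lambda>z. \<phi> z $ i) \<in> wcirc {}" for i
    using assms(1) wcirc_iff[of "\<lambda>z. \<phi> z $ i" "{}"] by (simp add: wvec_def)
  from wcirc_empty[OF this assms(3)] show ?thesis by (simp add: vec_eq_iff)
qed

text \<open>For positive \<open>k\<close> this is the bound \<open>k\<close> on the norm of the
  Hankel operator: \<open>\<phi>\<close> sees only the nonnegative frequencies of
  \<open>g *v \<psi>\<close>. The sum of squares on the right replaces a product of norms, so a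
  pointwise inequality on the circle can simply be averaged. The sign is free, as
  \<open>\<phi>\<close> may be negated.\<close>

definition form_contraction :: "(complex \<Rightarrow> complex^'q^'p) \<Rightarrow> real \<Rightarrow> bool" where
  "form_contraction g k \<longleftrightarrow> (\<forall>\<phi>\<in>wvec {0..}. \<forall>\<psi>\<in>wvec {..0}.
     - 2 * Re (mip \<phi> (\<lambda>z. g z *v \<psi> z)) \<le> k * (Re (mip \<phi> \<phi>) + Re (mip \<psi> \<psi>)))"

lemma form_contractionD:
  "form_contraction g k \<Longrightarrow> \<phi> \<in> wvec {0..} \<Longrightarrow> \<psi> \<in> wvec {..0} \<Longrightarrow>
     - 2 * Re (mip \<phi> (\<lambda>z. g z *v \<psi> z)) \<le> k * (Re (mip \<phi> \<phi>) + Re (mip \<psi> \<psi>))"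
  unfolding form_contraction_def by blast

text \<open>Reflection exchanges \<open>wvec {0..}\<close> with \<open>wvec {..0}\<close>, and the
  adjoint moves the matrix function to the other argument; the inequality returns with the roles of
  \<open>\<phi>\<close> and \<open>\<psi>\<close> exchanged.\<close>

lemma form_contraction_reflect:
  fixes g :: "complex \<Rightarrow> complex^'q^'p"
  assumes "form_contraction g k" "g \<in> wmat UNIV"
  shows "form_contraction (\<lambda>z. conj_transpose (g (inverse z))) k"
  unfolding form_contraction_def
proof (intro ballI)
  fix \<phi> :: "complex \<Rightarrow> complex^'q" and \<psi> :: "complex \<Rightarrow> complex^'p"
  assume \<phi>: "\<phi> \<in> wvec {0..}" and \<psi>: "\<psi> \<in> wvec {..0}"
  note U = wvec_UNIV[OF \<phi>] wvec_UNIV[OF \<psi>]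
  let ?\<phi> = "\<lambda>z. \<phi> (inverse z)" and ?\<psi> = "\<lambda>z. \<psi> (inverse z)"
  have r: "?\<psi> \<in> wvec {0..}" "?\<phi> \<in> wvec {..0}"
    using \<phi> \<psi> by (auto intro: wvec_inverse)
  have g\<phi>: "(\<lambda>z. g z *v ?\<phi> z) \<in> wvec UNIV"
    using assms(2) r(2) by (rule wvec_mult) auto
  have g': "(\<lambda>z. g (inverse z) *v \<phi> z) \<in> wvec UNIV"
    using wvec_inverse[OF g\<phi>, of UNIV] by simp
  have "mip \<phi> (\<lambda>z. conj_transpose (g (inverse z)) *v \<psi> z) = mip (\<lambda>z. g (inverse z) *v \<phi> z) \<psi>"
    by (simp add: mip_adjoint)
  also have "\<dots> = mip (\<lambda>z. g z *v ?\<phi> z) ?\<psi>"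
    using mip_inverse[OF g\<phi> wvec_UNIV[OF r(1)]] by simp
  also have "\<dots> = cnj (mip ?\<psi> (\<lambda>z. g z *v ?\<phi> z))"
    by (rule mip_cnj[OF wvec_UNIV[OF r(1)] g\<phi>])
  finally have "Re (mip \<phi> (\<lambda>z. conj_transpose (g (inverse z)) *v \<psi> z)) = Re (mip ?\<psi> (\<lambda>z. g z *v ?\<phi> z))"
    by simp
  moreover have "- 2 * Re (mip ?\<psi> (\<lambda>z. g z *v ?\<phi> z)) \<le> k * (Re (mip ?\<psi> ?\<psi>) + Re (mip ?\<phi> ?\<phi>))"
    using assms(1) r by (auto simp: form_contraction_def)
  ultimately show "- 2 * Re (mip \<phi> (\<lambda>z. conj_transpose (g (inverse z)) *v \<psi> z))
      \<le> k * (Re (mip \<phi> \<phi>) + Re (mip \<psi> \<psi>))"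
    using mip_inverse[OF U(1,1)] mip_inverse[OF U(2,2)] by (simp add: add.commute)
qed

section \<open>Necessity of the three conditions\<close>

text \<open>The hypothesis \<open>a0\<close> says that the constant term of \<open>\<alpha>\<close>
  is \<open>a0\<close>. The Gram difference \<open>F\<close> is selfadjoint, so one-sided
  information on its spectrum becomes two-sided; tracking the constant terms identifies
  \<open>F\<close> with both \<open>a0\<close> and its adjoint.\<close>

lemma EG_identity:
  fixes \<alpha> :: "complex \<Rightarrow> complex^'p^'p" and \<gamma> :: "complex \<Rightarrow> complex^'p^'q"
  assumes \<alpha>: "\<alpha> \<in> wmat {0..}" and \<gamma>: "\<gamma> \<in> wmat {..0}"
    and a0: "(\<lambda>z. \<alpha> z - a0) \<in> wmat {1..}"
    and e1: "(\<lambda>z. \<alpha> z + g z ** \<gamma> z - mat 1) \<in> wmat {..-1}"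
    and e2: "(\<lambda>z. conj_transpose (g z) ** \<alpha> z + \<gamma> z) \<in> wmat {1..}"
  shows "\<And>z. z \<in> unit_circle \<Longrightarrow>
      conj_transpose (\<alpha> z) ** \<alpha> z - conj_transpose (\<gamma> z) ** \<gamma> z = a0"
    and "conj_transpose a0 = a0"
proof -
  define F where "F = (\<lambda>z. conj_transpose (\<alpha> z) ** \<alpha> z - conj_transpose (\<gamma> z) ** \<gamma> z)"
  let ?b = "conj_transpose a0"
  \<comment> \<open>The terms containing \<open>g\<close> cancel. Subtracting \<open>mat 1\<close>
    costs the adjoint of \<open>\<alpha>\<close>, whose part apart from the constant
    \<open>?b\<close> is the second summand; every summand then has negative spectrum.\<close>
  have F: "F z - ?b = conj_transpose (\<alpha> z) ** (\<alpha> z + g z ** \<gamma> z - mat 1)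
     + conj_transpose (\<alpha> z - a0)
     - conj_transpose (conj_transpose (g z) ** \<alpha> z + \<gamma> z) ** \<gamma> z" for z
    by (simp add: F_def conj_transpose_add conj_transpose_diff conj_transpose_mult
        matrix_add_ldistrib matrix_sub_ldistrib matrix_add_rdistrib matrix_mul_assoc)
  have 1: "(\<lambda>z. F z - ?b) \<in> wmat {..-1}"
    unfolding F
    by (intro wmat_add wmat_diff wmat_mult[of _ "{..0}" _ "{..-1}" "{..-1}"]
        wmat_mult[of _ "{..-1}" _ "{..0}" "{..-1}"] wmat_conj_transpose[OF \<alpha>]
        wmat_conj_transpose[OF a0] wmat_conj_transpose[OF e2] e1 \<gamma>) auto
  \<comment> \<open>The adjoint of the preceding fact, as \<open>F z\<close> is its own
    adjoint.\<close>
  have 2: "(\<lambda>z. F z - a0) \<in> wmat {1..}"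
    using wmat_conj_transpose[OF 1, of "{1..}"]
    by (simp add: F_def conj_transpose_diff conj_transpose_mult image_subset_iff)
  have 3: "(\<lambda>z. F z - ?b) \<in> wmat {0..}"
    using wmat_add[OF wmat_mono[OF 2, of "{0..}"] wmat_const[of "{0..}" "a0 - ?b"]] by auto
  have Fb: "F z = ?b" if "z \<in> unit_circle" for z
    using wmat_disjoint_eq_0[OF 1 3 int_rays_disjoint(1) that] by simp
  have "(\<lambda>z. F z - a0) \<in> wmat {..0}"
    using wmat_add[OF wmat_mono[OF 1, of "{..0}"] wmat_const[of "{..0}" "?b - a0"]] by auto
  from wmat_disjoint_eq_0[OF 2 this int_rays_disjoint(3)] have Fa: "F z = a0" if "z \<in> unit_circle" for z
    using that by simp
  then show "\<And>z. z \<in> unit_circle \<Longrightarrow>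
      conj_transpose (\<alpha> z) ** \<alpha> z - conj_transpose (\<gamma> z) ** \<gamma> z = a0"
    by (simp add: F_def)
  show "?b = a0" using Fa Fb one_in_unit_circle by metis
qed

text \<open>The difference of the two sides is written twice: \<open>e4\<close> and
  \<open>e2\<close> show that its spectrum is negative, \<open>e1\<close> and \<open>e3\<close> that
  it is nonnegative. In both forms the terms with \<open>g\<close> cancel.\<close>

lemma EG_identity_mixed:
  fixes \<alpha> :: "complex \<Rightarrow> complex^'p^'p" and \<delta> :: "complex \<Rightarrow> complex^'q^'q"
  assumes \<alpha>: "\<alpha> \<in> wmat {0..}" and \<beta>: "\<beta> \<in> wmat {0..}" and \<gamma>: "\<gamma> \<in> wmat {..0}" and \<delta>: "\<delta> \<in> wmat {..0}"
    and e1: "(\<lambda>z. \<alpha> z + g z ** \<gamma> z - mat 1) \<in> wmat {..-1}"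
    and e2: "(\<lambda>z. conj_transpose (g z) ** \<alpha> z + \<gamma> z) \<in> wmat {1..}"
    and e3: "(\<lambda>z. \<delta> z + conj_transpose (g z) ** \<beta> z - mat 1) \<in> wmat {1..}"
    and e4: "(\<lambda>z. g z ** \<delta> z + \<beta> z) \<in> wmat {..-1}"
    and z: "z \<in> unit_circle"
  shows "conj_transpose (\<alpha> z) ** \<beta> z = conj_transpose (\<gamma> z) ** \<delta> z"
proof -
  define F where "F = (\<lambda>z. conj_transpose (\<alpha> z) ** \<beta> z - conj_transpose (\<gamma> z) ** \<delta> z)"
  have F1: "F z = conj_transpose (\<alpha> z) ** (g z ** \<delta> z + \<beta> z)
     - conj_transpose (conj_transpose (g z) ** \<alpha> z + \<gamma> z) ** \<delta> z" for z
    by (simp add: F_def conj_transpose_add conj_transpose_mult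
        matrix_add_ldistrib matrix_add_rdistrib matrix_mul_assoc)
  have 1: "F \<in> wmat {..-1}"
    unfolding F1[abs_def]
    by (intro wmat_diff wmat_mult[of _ "{..0}" _ "{..-1}" "{..-1}"]
        wmat_mult[of _ "{..-1}" _ "{..0}" "{..-1}"] wmat_conj_transpose[OF \<alpha>]
        wmat_conj_transpose[OF e2] e4 \<delta>) auto
  have F2: "F z = conj_transpose (\<alpha> z + g z ** \<gamma> z - mat 1) ** \<beta> z + \<beta> z
     - (conj_transpose (\<gamma> z) ** (\<delta> z + conj_transpose (g z) ** \<beta> z - mat 1) + conj_transpose (\<gamma> z))" for z
    by (simp add: F_def conj_transpose_add conj_transpose_diff conj_transpose_mult
        matrix_add_ldistrib matrix_add_rdistrib matrix_sub_ldistrib matrix_sub_rdistrib matrix_mul_assoc)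
  have 2: "F \<in> wmat {0..}"
    unfolding F2[abs_def]
    by (intro wmat_diff wmat_add wmat_mult[of _ "{1..}" _ "{0..}" "{0..}"]
        wmat_mult[of _ "{0..}" _ "{1..}" "{0..}"] wmat_conj_transpose[OF \<gamma>]
        wmat_conj_transpose[OF e1] e3 \<beta>) auto
  show ?thesis using wmat_disjoint_eq_0[OF 1 2 int_rays_disjoint(1) z] by (simp add: F_def)
qed

text \<open>By the identity, the form of \<open>a0\<close> at \<open>u\<close> is the mean of the
  squared norm of \<open>\<alpha> u\<close> minus that of \<open>\<gamma> u\<close>. Pairing
  \<open>e2\<close> with \<open>\<gamma> u\<close> expresses the latter mean through
  \<open>g\<close>, and the contraction bound with \<open>k < 1\<close> makes it the smaller one,
  provided that \<open>\<alpha> u\<close> does not vanish.\<close>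

lemma EG_pos_def:
  fixes \<alpha> :: "complex \<Rightarrow> complex^'p^'p" and \<gamma> :: "complex \<Rightarrow> complex^'p^'q"
  assumes \<alpha>: "\<alpha> \<in> wmat {0..}" and \<gamma>: "\<gamma> \<in> wmat {..0}" and g: "g \<in> wmat {0..}"
    and a0: "(\<lambda>z. \<alpha> z - a0) \<in> wmat {1..}"
    and e1: "(\<lambda>z. \<alpha> z + g z ** \<gamma> z - mat 1) \<in> wmat {..-1}"
    and e2: "(\<lambda>z. conj_transpose (g z) ** \<alpha> z + \<gamma> z) \<in> wmat {1..}"
    and k: "form_contraction g k" "k < 1"
  shows "pos_def a0"
  unfolding pos_def_iff
proof (intro conjI allI impI)
  note id = EG_identity[OF \<alpha> \<gamma> a0 e1 e2]
  show "conj_transpose a0 = a0" by (rule id(2))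
  fix u :: "complex^'p" assume u: "u \<noteq> 0"
  let ?x = "\<lambda>z. \<alpha> z *v u" and ?y = "\<lambda>z. \<gamma> z *v u"
  have x: "?x \<in> wvec {0..}" and y: "?y \<in> wvec {..0}"
    using \<alpha> \<gamma> by (auto intro: wvec_mult_const)
  note U = wvec_UNIV[OF x] wvec_UNIV[OF y]
  have gx: "(\<lambda>z. conj_transpose (g z) *v ?x z) \<in> wvec UNIV"
    by (rule wvec_mult[OF wmat_conj_transpose[OF wmat_UNIV[OF g], of UNIV] U(1)]) auto
  have gy: "(\<lambda>z. g z *v ?y z) \<in> wvec UNIV"
    by (rule wvec_mult[OF wmat_UNIV[OF g] U(2)]) auto
  have "mip ?y (\<lambda>z. conj_transpose (g z) *v ?x z + ?y z) = 0"
    by (rule mip_disjoint[OF y, of _ "{1..}"])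
       (use wvec_mult_const[OF e2, of u] in \<open>auto simp: matrix_vector_mult_add_rdistrib matrix_vector_mul_assoc\<close>)
  then have "mip ?y ?y = - mip ?y (\<lambda>z. conj_transpose (g z) *v ?x z)"
    using mip_add_right[OF U(2) gx U(2)] by (simp add: add_eq_0_iff)
  also have "\<dots> = - mip (\<lambda>z. g z *v ?y z) ?x" by (simp add: mip_adjoint)
  also have "\<dots> = - cnj (mip ?x (\<lambda>z. g z *v ?y z))" by (simp add: mip_cnj[OF U(1) gy])
  finally have "Re (mip ?y ?y) = - Re (mip ?x (\<lambda>z. g z *v ?y z))" by simp
  moreover have "- 2 * Re (mip ?x (\<lambda>z. g z *v ?y z)) \<le> k * (Re (mip ?x ?x) + Re (mip ?y ?y))"
    by (rule form_contractionD[OF k(1) x y])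
  ultimately have yx: "2 * Re (mip ?y ?y) \<le> k * (Re (mip ?x ?x) + Re (mip ?y ?y))"
    by linarith
  \<comment> \<open>If \<open>?x\<close> vanished on the circle, \<open>?y\<close> would vanish by
    \<open>yx\<close>, and \<open>e1\<close> applied to \<open>u\<close> would leave the constant
    \<open>- u\<close> in a class with negative spectrum, forcing \<open>u = 0\<close>.\<close>
  have "Re (mip ?x ?x) \<noteq> 0"
  proof
    assume x0: "Re (mip ?x ?x) = 0"
    have "(2 - k) * Re (mip ?y ?y) \<le> 0" using yx x0 by (simp add: algebra_simps)
    then have "Re (mip ?y ?y) \<le> 0" using k(2) by (simp add: mult_le_0_iff)
    then have y0: "?y z = 0" and x0: "?x z = 0" if "z \<in> unit_circle" for z
      using mip_self_eq_0[OF U(2) _ that] mip_self_eq_0[OF U(1) _ that] x0 by auto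
    have "(\<lambda>z. ?x z + g z *v ?y z - u) \<in> wvec {..-1}"
      using wvec_mult_const[OF e1, of u]
      by (simp add: matrix_vector_mult_add_rdistrib matrix_vector_mult_diff_rdistrib matrix_vector_mul_assoc)
    then have w: "(\<lambda>z. (?x z + g z *v ?y z - u) $ i) \<in> wcirc {..-1}" for i by (simp add: wvec_def)
    have "u $ i = 0" for i
    proof -
      have "(\<lambda>z. (?x z + g z *v ?y z - u) $ i) \<in> wcirc {..-1} \<longleftrightarrow> (\<lambda>z. - u $ i) \<in> wcirc {..-1}"
        by (rule wclass_cong) (simp add: x0 y0)
      then have "(\<lambda>z. - u $ i) \<in> wcirc {..-1}" using w by blast
      from wcirc_cf(2)[OF this, of 0] show "u $ i = 0" by (simp add: cf_const)
    qed
    then show False using u by (simp add: vec_eq_iff)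
  qed
  then have xp: "Re (mip ?x ?x) > 0" using Re_mip_self_nonneg[OF U(1)] by simp
  have "hinner (?x z) (?x z) - hinner (?y z) (?y z) = hinner u (a0 *v u)" if "z \<in> unit_circle" for z
    using hinner_gram_diff[of "\<alpha> z" u "\<gamma> z"] unfolding id(1)[OF that] .
  then have "cf (\<lambda>z. hinner (?x z) (?x z) - hinner (?y z) (?y z)) 0 = cf (\<lambda>z. hinner u (a0 *v u)) 0"
    by (metis (no_types, lifting) cf_cong)
  then have "mip ?x ?x - mip ?y ?y = hinner u (a0 *v u)"
    using cf_diff[OF wcirc_hinner_UNIV[OF U(1,1)] wcirc_hinner_UNIV[OF U(2,2)], of 0]
    by (simp add: mip_def cf_const)
  then have e: "Re (hinner u (a0 *v u)) = Re (mip ?x ?x) - Re (mip ?y ?y)" by (metis minus_complex.sel(1))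
  have "Re (mip ?y ?y) < Re (mip ?x ?x)"
  proof (rule ccontr)
    assume "\<not> Re (mip ?y ?y) < Re (mip ?x ?x)"
    then have "Re (mip ?x ?x) \<le> Re (mip ?y ?y)" by simp
    then have "Re (mip ?x ?x) + Re (mip ?y ?y) \<le> 2 * Re (mip ?y ?y)" by simp
    also note yx
    also have "k * (Re (mip ?x ?x) + Re (mip ?y ?y)) < 1 * (Re (mip ?x ?x) + Re (mip ?y ?y))"
      by (rule mult_strict_right_mono[OF k(2)]) (use xp Re_mip_self_nonneg[OF U(2)] in simp)
    finally show False by simp
  qed
  then show "0 < Re (hinner u (a0 *v u))" using e by simp
qed

text \<open>On the circle a kernel vector contradicts the identity at that point. Inside, dividing
  by \<open>z - l\<close> keeps \<open>\<alpha> u\<close> in the plus class, because the zero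
  cancels, but pushes \<open>\<gamma> u\<close> to negative spectrum; contractivity then orders the
  two means in the wrong way.\<close>

lemma EG_det_nonzero:
  fixes \<alpha> :: "complex \<Rightarrow> complex^'p^'p" and \<gamma> :: "complex \<Rightarrow> complex^'p^'q"
  assumes \<alpha>: "\<alpha> \<in> wmat {0..}" and \<gamma>: "\<gamma> \<in> wmat {..0}" and g: "g \<in> wmat {0..}"
    and id: "\<And>z. z \<in> unit_circle \<Longrightarrow>
      conj_transpose (\<alpha> z) ** \<alpha> z - conj_transpose (\<gamma> z) ** \<gamma> z = a0"
    and e1: "(\<lambda>z. \<alpha> z + g z ** \<gamma> z - mat 1) \<in> wmat {..-1}"
    and k: "form_contraction g k" "k < 1"
    and a0: "pos_def a0" and l: "norm l \<le> 1"
  shows "det (ext_plus \<alpha> l) \<noteq> 0"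
proof
  assume "det (ext_plus \<alpha> l) = 0"
  then obtain u where u: "u \<noteq> 0" "ext_plus \<alpha> l *v u = 0" by (rule det_eq_0_vector)
  let ?x = "\<lambda>z. \<alpha> z *v u" and ?y = "\<lambda>z. \<gamma> z *v u"
  define r where "r = Re (hinner u (a0 *v u))"
  have r: "0 < r" using a0 u(1) by (simp add: pos_def_iff r_def)
  have xy: "(norm (?x z))\<^sup>2 - (norm (?y z))\<^sup>2 = r" if "z \<in> unit_circle" for z
    unfolding r_def by (rule norm_gram_diff[OF id[OF that]])
  show False
  proof (cases "norm l = 1")
    case True
    then have l: "l \<in> unit_circle" by (simp add: unit_circle_def)
    have "?x l = 0" using u(2) ext_plus_unit_circle[OF \<alpha> l] by simp
    then show False using xy[OF l] r by (simp, smt (verit) zero_le_power2)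
  next
    case False
    with l have l1: "norm l < 1" by simp
    let ?q = "\<lambda>z. 1 / (z - l)"
    let ?X = "\<lambda>z. ?q z *s ?x z" and ?Y = "\<lambda>z. ?q z *s ?y z"
    have Q: "?q \<in> wcirc {..-1}" by (rule wcirc_inverse_diff[OF l1])
    \<comment> \<open>Each entry of the extended \<open>\<alpha> u\<close> vanishes at
      \<open>l\<close>, so \<open>wdisc_divide_zero\<close> provides a disc function that agrees
      with the quotient on the circle.\<close>
    have X: "?X \<in> wvec {0..}"
      unfolding wvec_def
    proof (intro CollectI allI)
      fix i
      have "(\<lambda>z. (ext_plus \<alpha> z *v u) $ i) \<in> wdisc"
        unfolding matrix_vector_mult_def using ext_plus_wdisc[OF \<alpha>]
        by (auto intro!: wclass_sum wclass_cmult simp: mult.commute[of _ "u $ _"])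
      then obtain h where h: "h \<in> wdisc" "\<And>z. norm z \<le> 1 \<Longrightarrow> (ext_plus \<alpha> z *v u) $ i = (z - l) * h z"
        by (rule wdisc_divide_zero[of _ l]) (use l1 u(2) in auto)
      have "?X z $ i = h z" if "z \<in> unit_circle" for z
        using h(2)[of z] that l1 ext_plus_unit_circle[OF \<alpha> that] by (auto simp: unit_circle_def)
      then have "(\<lambda>z. ?X z $ i) \<in> wcirc {0..} \<longleftrightarrow> h \<in> wcirc {0..}"
        by (rule wclass_cong)
      then show "(\<lambda>z. ?X z $ i) \<in> wcirc {0..}"
        using wclass_subset[OF h(1), of unit_circle] by (auto simp: unit_circle_def)
    qed
    have Y: "?Y \<in> wvec {..-1}"
      by (rule wvec_smult[OF Q wvec_mult_const[OF \<gamma>]]) auto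
    note U = wvec_UNIV[OF X] wvec_UNIV[OF Y]
    have gY: "(\<lambda>z. g z *v ?Y z) \<in> wvec UNIV"
      by (rule wvec_mult[OF wmat_UNIV[OF g] U(2)]) auto
    \<comment> \<open>Here the constant \<open>mat 1\<close> is harmless, since multiplication by
      \<open>?q\<close> makes the spectrum negative. The combination is then orthogonal to
      \<open>?X\<close>.\<close>
    have "(\<lambda>z. \<alpha> z + g z ** \<gamma> z) \<in> wmat {..0}"
      using wmat_add[OF wmat_mono[OF e1, of "{..0}"] wmat_const[of "{..0}" "mat 1"]] by auto
    from wvec_smult[OF Q wvec_mult_const[OF this, of u], of "{..-1}"]
    have "(\<lambda>z. ?X z + g z *v ?Y z) \<in> wvec {..-1}"
      by (auto simp: matrix_vector_mult_add_rdistrib vector_add_ldistrib vector_scalar_commute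
          matrix_vector_mul_assoc)
    then have "mip ?X (\<lambda>z. ?X z + g z *v ?Y z) = 0"
      by (rule mip_disjoint[OF X]) auto
    then have "mip ?X ?X = - mip ?X (\<lambda>z. g z *v ?Y z)"
      using mip_add_right[OF U(1) U(1) gY] by (simp add: add_eq_0_iff2)
    moreover have "- 2 * Re (mip ?X (\<lambda>z. g z *v ?Y z)) \<le> k * (Re (mip ?X ?X) + Re (mip ?Y ?Y))"
    proof -
      have "?Y \<in> wvec {..0}" by (rule wvec_mono[OF Y]) auto
      then show ?thesis by (rule form_contractionD[OF k(1) X])
    qed
    ultimately have "2 * Re (mip ?X ?X) \<le> k * (Re (mip ?X ?X) + Re (mip ?Y ?Y))"
      by simp
    also have "\<dots> \<le> 1 * (Re (mip ?X ?X) + Re (mip ?Y ?Y))"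
      using k(2) Re_mip_self_nonneg[OF U(1)] Re_mip_self_nonneg[OF U(2)]
      by (intro mult_right_mono) auto
    finally have le: "Re (mip ?X ?X) \<le> Re (mip ?Y ?Y)" by simp
    have w: "(\<lambda>z. hinner (?X z) (?X z) - hinner (?Y z) (?Y z)) \<in> wcirc UNIV"
      by (intro wclass_diff wcirc_hinner_UNIV[OF U(1,1)] wcirc_hinner_UNIV[OF U(2,2)])
    \<comment> \<open>As \<open>norm (z - l) \<le> 2\<close>, the factor
      \<open>(norm (?q z))\<^sup>2\<close> is at least \<open>1 / 4\<close>, so the difference of
      the squared norms is at least \<open>r / 4\<close> at every point of the circle. Its mean is
      therefore positive, against \<open>le\<close>.\<close>
    have "0 \<le> Re (cf (\<lambda>z. (hinner (?X z) (?X z) - hinner (?Y z) (?Y z)) - of_real (r / 4)) 0)"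
    proof (rule Re_cf_0_nonneg)
      show "(\<lambda>z. (hinner (?X z) (?X z) - hinner (?Y z) (?Y z)) - of_real (r / 4)) \<in> wcirc UNIV"
        by (intro wclass_diff[OF w] wclass_const) auto
      fix z assume z: "z \<in> unit_circle"
      have "norm (z - l) \<le> 2" "0 < norm (z - l)"
        using norm_triangle_ineq4[of z l] z l1 by (auto simp: unit_circle_def)
      then have "inverse 2 \<le> norm (?q z)" by (simp add: norm_divide inverse_eq_divide frac_le)
      then have "(1/2)\<^sup>2 \<le> (norm (?q z))\<^sup>2" by (intro power_mono) auto
      then have "r / 4 \<le> (norm (?q z))\<^sup>2 * r" using r by (simp add: power2_eq_square)
      also have "\<dots> = (norm (?q z))\<^sup>2 * (norm (?x z))\<^sup>2 - (norm (?q z))\<^sup>2 * (norm (?y z))\<^sup>2"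
        by (simp add: xy[OF z, symmetric] algebra_simps)
      also have "\<dots> = Re (hinner (?X z) (?X z) - hinner (?Y z) (?Y z))"
        by (simp only: minus_complex.sel Re_hinner_smult_self)
      finally show "0 \<le> Re (hinner (?X z) (?X z) - hinner (?Y z) (?Y z) - of_real (r / 4))"
        by simp
    qed
    also have "cf (\<lambda>z. (hinner (?X z) (?X z) - hinner (?Y z) (?Y z)) - of_real (r / 4)) 0
       = mip ?X ?X - mip ?Y ?Y - of_real (r / 4)"
      unfolding mip_def
      by (simp only: cf_diff[OF w wclass_const[OF UNIV_I]]
          cf_diff[OF wcirc_hinner_UNIV[OF U(1,1)] wcirc_hinner_UNIV[OF U(2,2)]] cf_const if_True refl)
    finally show False using le r by simp
  qed
qed

section \<open>Construction of the solution\<close>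

lemma EG_equations:
  fixes \<alpha> \<alpha>' :: "complex \<Rightarrow> complex^'p^'p" and \<gamma> :: "complex \<Rightarrow> complex^'p^'q"
  assumes \<alpha>: "\<alpha> \<in> wmat {0..}" and \<gamma>: "\<gamma> \<in> wmat {..0}" and \<alpha>': "\<alpha>' \<in> wmat {0..}"
    and inv: "\<And>z. z \<in> unit_circle \<Longrightarrow> \<alpha> z ** \<alpha>' z = mat 1"
    and a0: "(\<lambda>z. \<alpha> z - a0) \<in> wmat {1..}" "conj_transpose a0 = a0"
    and id: "\<And>z. z \<in> unit_circle \<Longrightarrow>
      conj_transpose (\<alpha> z) ** \<alpha> z - conj_transpose (\<gamma> z) ** \<gamma> z = a0"
    and f: "\<And>z. z \<in> unit_circle \<Longrightarrow> conj_transpose (\<alpha> z) ** f z = - conj_transpose (\<gamma> z)"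
    and g: "(\<lambda>z. f z - g z) \<in> wmat {..-1}"
  shows "(\<lambda>z. \<alpha> z + g z ** \<gamma> z - mat 1) \<in> wmat {..-1}"
    and "(\<lambda>z. conj_transpose (g z) ** \<alpha> z + \<gamma> z) \<in> wmat {1..}"
proof -
  have "(\<lambda>z. - (conj_transpose (f z - g z) ** \<alpha> z)) \<in> wmat {1..}"
    by (intro wmat_uminus wmat_mult[of _ "{1..}" _ "{0..}"] wmat_conj_transpose[OF g] \<alpha>) auto
  moreover have "- (conj_transpose (f z - g z) ** \<alpha> z) = conj_transpose (g z) ** \<alpha> z + \<gamma> z"
    if "z \<in> unit_circle" for z
  proof -
    have "conj_transpose (f z) ** \<alpha> z = - \<gamma> z"
      using arg_cong[OF f[OF that], of conj_transpose] by (simp add: conj_transpose_mult conj_transpose_minus)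
    then show ?thesis by (simp add: conj_transpose_diff matrix_sub_rdistrib)
  qed
  ultimately show "(\<lambda>z. conj_transpose (g z) ** \<alpha> z + \<gamma> z) \<in> wmat {1..}"
    by (subst (asm) wmat_cong) auto
  define b where "b = fourier_coeff \<alpha>' 0"
  have b: "(\<lambda>z. \<alpha>' z - b) \<in> wmat {1..}"
    unfolding b_def by (rule wmat_mono[OF wmat_minus_fourier_coeff_0[OF \<alpha>']]) auto
  have "(\<lambda>z. (\<alpha> z - a0) ** \<alpha>' z + a0 ** (\<alpha>' z - b)) \<in> wmat {1..}"
    by (intro wmat_add wmat_mult[OF a0(1) \<alpha>'] wmat_mult[OF wmat_const[of "{0}"] b]) auto
  moreover have "(\<alpha> z - a0) ** \<alpha>' z + a0 ** (\<alpha>' z - b) = mat 1 - a0 ** b" if "z \<in> unit_circle" for z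
    using inv[OF that] by (simp add: matrix_sub_rdistrib matrix_sub_ldistrib)
  ultimately have c: "(\<lambda>z. mat 1 - a0 ** b) \<in> wmat {1..}"
    by (subst (asm) wmat_cong) auto
  \<comment> \<open>Comparison of the constant terms in
    \<open>\<alpha> z ** \<alpha>' z = mat 1\<close>: both factors have nonnegative spectrum, so the
    constant term of the product is \<open>a0 ** b\<close>.\<close>
  have "mat 1 - a0 ** b = 0"
    by (rule wmat_disjoint_eq_0[OF c wmat_const[of "{..0}"] int_rays_disjoint(3) one_in_unit_circle]) auto
  then have ab: "conj_transpose b ** a0 = mat 1"
    using conj_transpose_mult[of a0 b] a0(2) by (metis conj_transpose_mat_1 eq_iff_diff_eq_0)
  have "(\<lambda>z. conj_transpose (\<alpha>' z - b) ** a0 - (f z - g z) ** \<gamma> z) \<in> wmat {..-1}"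
    by (intro wmat_diff wmat_mult[OF wmat_conj_transpose[OF b, of "{..-1}"] wmat_const[of "{0}"]]
        wmat_mult[OF g \<gamma>]) auto
  moreover have "conj_transpose (\<alpha>' z - b) ** a0 - (f z - g z) ** \<gamma> z = \<alpha> z + g z ** \<gamma> z - mat 1"
    if z: "z \<in> unit_circle" for z
  proof -
    have ai: "conj_transpose (\<alpha>' z) ** conj_transpose (\<alpha> z) = mat 1"
      using arg_cong[OF inv[OF z], of conj_transpose] by (simp add: conj_transpose_mult)
    \<comment> \<open>Substituting the identity for \<open>a0\<close> and using \<open>f\<close> to
      absorb the adjoint of \<open>\<gamma>\<close> brings out a common left factor, the adjoint of
      \<open>\<alpha>\<close>, which \<open>\<alpha>'\<close> removes.\<close>
    have "conj_transpose (\<alpha>' z) ** a0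
        = conj_transpose (\<alpha>' z) ** (conj_transpose (\<alpha> z) ** \<alpha> z + (conj_transpose (\<alpha> z) ** f z) ** \<gamma> z)"
      unfolding f[OF z] id[OF z, symmetric] by (simp add: matrix_mult_minus_left)
    also have "\<dots> = (conj_transpose (\<alpha>' z) ** conj_transpose (\<alpha> z)) ** (\<alpha> z + f z ** \<gamma> z)"
      by (simp add: matrix_add_ldistrib matrix_mul_assoc)
    also have "\<dots> = \<alpha> z + f z ** \<gamma> z" by (simp add: ai)
    finally show ?thesis
      by (simp add: conj_transpose_diff matrix_sub_rdistrib ab)
  qed
  ultimately show "(\<lambda>z. \<alpha> z + g z ** \<gamma> z - mat 1) \<in> wmat {..-1}"
    by (subst (asm) wmat_cong) auto
qed

section \<open>Norm bounds for the symbol\<close>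

lemma norm_matrix_vector_mult_le:
  fixes A :: "complex^'n^'m"
  shows "norm (A *v x) \<le> (\<Sum>i\<in>UNIV. \<Sum>j\<in>UNIV. norm (A $ i $ j)) * norm x"
proof -
  have "norm (A *v x) \<le> (\<Sum>i\<in>UNIV. norm ((A *v x) $ i))"
    unfolding norm_vec_def by (rule L2_set_le_sum) auto
  also have "\<dots> \<le> (\<Sum>i\<in>UNIV. \<Sum>j\<in>UNIV. norm (A $ i $ j) * norm x)"
  proof (rule sum_mono)
    fix i
    have "norm ((A *v x) $ i) \<le> (\<Sum>j\<in>UNIV. norm (A $ i $ j * x $ j))"
      unfolding matrix_vector_mult_def vec_lambda_beta by (rule norm_sum)
    also have "\<dots> \<le> (\<Sum>j\<in>UNIV. norm (A $ i $ j) * norm x)"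
      by (intro sum_mono) (simp add: norm_mult mult_left_mono Finite_Cartesian_Product.norm_nth_le)
    finally show "norm ((A *v x) $ i) \<le> (\<Sum>j\<in>UNIV. norm (A $ i $ j) * norm x)" .
  qed
  finally show ?thesis by (simp add: sum_distrib_right)
qed

lemma wmat_bounded:
  assumes "\<rho> \<in> wmat UNIV"
  obtains M where "1 \<le> M" "\<And>z x. z \<in> unit_circle \<Longrightarrow> norm (\<rho> z *v x) \<le> M * norm x"
proof -
  define K where "K = (\<lambda>i j. \<Sum>\<^sub>\<infinity>\<nu>. norm (cf (\<lambda>z. \<rho> z $ i $ j) \<nu>))"
  have K: "norm (\<rho> z $ i $ j) \<le> K i j" if z: "z \<in> unit_circle" for z i j
  proof -
    have c: "wseries unit_circle (\<lambda>z. \<rho> z $ i $ j) (cf (\<lambda>z. \<rho> z $ i $ j))"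
      using assms by (auto simp: wmat_def intro: wcirc_cf)
    show ?thesis
      unfolding K_def
    proof (rule norm_has_sum_bound)
      show "((\<lambda>\<nu>. z powi \<nu> * cf (\<lambda>z. \<rho> z $ i $ j) \<nu>) has_sum \<rho> z $ i $ j) UNIV"
        using c z by (simp add: wseries_def)
      show "((\<lambda>\<nu>. norm (z powi \<nu> * cf (\<lambda>z. \<rho> z $ i $ j) \<nu>)) has_sum
          (\<Sum>\<^sub>\<infinity>\<nu>. norm (cf (\<lambda>z. \<rho> z $ i $ j) \<nu>))) UNIV"
        using has_sum_infsum[of "\<lambda>\<nu>. norm (cf (\<lambda>z. \<rho> z $ i $ j) \<nu>)" UNIV] c z
        by (simp add: wseries_def norm_mult norm_power_int unit_circle_def)
    qed
  qed
  define M where "M = (\<Sum>i\<in>UNIV. \<Sum>j\<in>UNIV. K i j)"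
  show ?thesis
  proof (rule that[of "max 1 M"])
    fix z :: complex and x :: "complex^'a" assume z: "z \<in> unit_circle"
    have "(\<Sum>i\<in>UNIV. \<Sum>j\<in>UNIV. norm (\<rho> z $ i $ j)) \<le> max 1 M"
      unfolding M_def by (rule max.coboundedI2) (intro sum_mono K z)
    then show "norm (\<rho> z *v x) \<le> max 1 M * norm x"
      by (rule order_trans[OF norm_matrix_vector_mult_le mult_right_mono]) simp
  qed simp
qed

text \<open>Writing \<open>v\<close> as \<open>\<alpha> z *v w\<close>, the adjoint of
  \<open>f z\<close> sends \<open>v\<close> to \<open>- \<gamma> z *v w\<close>, and the identity
  makes its squared norm fall short of that of \<open>v\<close> by the form of \<open>a0\<close> at
  \<open>w\<close>. Coercivity of \<open>a0\<close> and boundedness of \<open>\<alpha>\<close> turn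
  this deficit into a fixed fraction of the squared norm of \<open>v\<close>.\<close>

lemma EG_symbol_bound:
  fixes \<alpha> \<alpha>' :: "complex \<Rightarrow> complex^'p^'p" and \<gamma> :: "complex \<Rightarrow> complex^'p^'q"
  assumes \<alpha>: "\<alpha> \<in> wmat UNIV"
    and inv: "\<And>z. z \<in> unit_circle \<Longrightarrow> \<alpha> z ** \<alpha>' z = mat 1"
    and a0: "pos_def a0"
    and id: "\<And>z. z \<in> unit_circle \<Longrightarrow>
      conj_transpose (\<alpha> z) ** \<alpha> z - conj_transpose (\<gamma> z) ** \<gamma> z = a0"
    and f: "\<And>z. z \<in> unit_circle \<Longrightarrow> conj_transpose (\<alpha> z) ** f z = - conj_transpose (\<gamma> z)"
  obtains k where "0 < k" "k < 1"
    "\<And>z v w. z \<in> unit_circle \<Longrightarrow> - 2 * Re (hinner v (f z *v w)) \<le> k * ((norm v)\<^sup>2 + (norm w)\<^sup>2)"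
proof -
  obtain c where c: "0 < c" "\<And>x. c * (norm x)\<^sup>2 \<le> Re (hinner x (a0 *v x))"
    using a0 by (rule pos_def_coercive) blast
  obtain M where M: "1 \<le> M" "\<And>z x. z \<in> unit_circle \<Longrightarrow> norm (\<alpha> z *v x) \<le> M * norm x"
    using \<alpha> by (rule wmat_bounded) blast
  \<comment> \<open>The relative deficit is at least \<open>c / M\<^sup>2\<close>, because
    \<open>norm v \<le> M * norm w\<close>; the minimum with \<open>1 / 2\<close> keeps
    \<open>1 - d\<close> positive.\<close>
  define d where "d = min (1/2) (c / M\<^sup>2)"
  have d: "0 < d" "d < 1" "d \<le> c / M\<^sup>2" using c(1) M(1) by (auto simp: d_def)
  define k where "k = sqrt (1 - d)"
  have k: "0 < k" "k < 1" "k\<^sup>2 = 1 - d" using d by (auto simp: k_def)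
  have fv: "norm (conj_transpose (f z) *v v) \<le> k * norm v" if z: "z \<in> unit_circle" for z and v :: "complex^'p"
  proof -
    let ?w = "\<alpha>' z *v v"
    have v: "\<alpha> z *v ?w = v" by (simp add: matrix_vector_mul_assoc inv[OF z])
    have "conj_transpose (f z) ** \<alpha> z = - \<gamma> z"
      using arg_cong[OF f[OF z], of conj_transpose] by (simp add: conj_transpose_mult conj_transpose_minus)
    then have "conj_transpose (f z) *v v = (- \<gamma> z) *v ?w"
      by (metis v matrix_vector_mul_assoc)
    then have fg: "norm (conj_transpose (f z) *v v) = norm (\<gamma> z *v ?w)"
      by (metis matrix_vector_mult_minus_left norm_minus_cancel)
    have "(norm v)\<^sup>2 - (norm (\<gamma> z *v ?w))\<^sup>2 = Re (hinner ?w (a0 *v ?w))"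
      using norm_gram_diff[OF id[OF z], of ?w] unfolding v .
    then have 1: "(norm (\<gamma> z *v ?w))\<^sup>2 \<le> (norm v)\<^sup>2 - c * (norm ?w)\<^sup>2"
      using c(2)[of ?w] by simp
    have "(norm v)\<^sup>2 \<le> (M * norm ?w)\<^sup>2"
      using M(2)[OF z, of ?w] unfolding v by (intro power_mono) auto
    then have "(norm v)\<^sup>2 / M\<^sup>2 \<le> (norm ?w)\<^sup>2"
      using M(1) by (simp add: power_mult_distrib field_simps)
    then have "c * ((norm v)\<^sup>2 / M\<^sup>2) \<le> c * (norm ?w)\<^sup>2"
      using c(1) by (intro mult_left_mono) auto
    moreover have "d * (norm v)\<^sup>2 \<le> c / M\<^sup>2 * (norm v)\<^sup>2" using d(3) by (rule mult_right_mono) simp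
    ultimately have "(norm (\<gamma> z *v ?w))\<^sup>2 \<le> (1 - d) * (norm v)\<^sup>2" using 1 by (simp add: algebra_simps)
    then have "(norm (\<gamma> z *v ?w))\<^sup>2 \<le> (k * norm v)\<^sup>2" by (simp add: power_mult_distrib k(3))
    then show ?thesis unfolding fg by (rule power2_le_imp_le) (use k in simp)
  qed
  show ?thesis
  proof (rule that[OF k(1,2)])
    fix z :: complex and v :: "complex^'p" and w :: "complex^'q" assume z: "z \<in> unit_circle"
    have "- Re (hinner v (f z *v w)) = - ((conj_transpose (f z) *v v) \<bullet> w)"
      by (simp add: hinner_mult_right Re_hinner)
    also have "\<dots> \<le> norm (conj_transpose (f z) *v v) * norm w"
      using Cauchy_Schwarz_ineq2[of "conj_transpose (f z) *v v" w] by linarith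
    also have "\<dots> \<le> k * norm v * norm w"
      by (intro mult_right_mono fv z) simp
    finally have "- Re (hinner v (f z *v w)) \<le> k * norm v * norm w" .
    moreover have "k * (2 * norm v * norm w) = 2 * (k * norm v * norm w)" by (simp only: mult_ac)
    ultimately have "- 2 * Re (hinner v (f z *v w)) \<le> k * (2 * norm v * norm w)" by linarith
    also have "\<dots> \<le> k * ((norm v)\<^sup>2 + (norm w)\<^sup>2)"
      using k(1) sum_squares_bound[of "norm v" "norm w"] by (intro mult_left_mono) auto
    finally show "- 2 * Re (hinner v (f z *v w)) \<le> k * ((norm v)\<^sup>2 + (norm w)\<^sup>2)" .
  qed
qed

text \<open>The easy half of Nehari's theorem. Since \<open>(f - g) \<psi>\<close> has negative
  spectrum, it is orthogonal to \<open>\<phi>\<close>, so \<open>g\<close> may be replaced by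
  \<open>f\<close>; averaging the pointwise bound over the circle then gives the claim.\<close>

lemma form_contractionI:
  assumes f: "f \<in> wmat UNIV" and g: "(\<lambda>z. f z - g z) \<in> wmat {..-1}"
    and k: "\<And>z v w. z \<in> unit_circle \<Longrightarrow> - 2 * Re (hinner v (f z *v w)) \<le> k * ((norm v)\<^sup>2 + (norm w)\<^sup>2)"
  shows "form_contraction g k"
  unfolding form_contraction_def
proof (intro ballI)
  fix \<phi> :: "complex \<Rightarrow> complex^'b" and \<psi> :: "complex \<Rightarrow> complex^'a"
  assume \<phi>: "\<phi> \<in> wvec {0..}" and \<psi>: "\<psi> \<in> wvec {..0}"
  note U = wvec_UNIV[OF \<phi>] wvec_UNIV[OF \<psi>]
  have f\<psi>: "(\<lambda>z. f z *v \<psi> z) \<in> wvec UNIV"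
    by (rule wvec_mult[OF f U(2)]) auto
  have h\<psi>: "(\<lambda>z. (f z - g z) *v \<psi> z) \<in> wvec {..-1}"
    by (rule wvec_mult[OF g \<psi>]) auto
  have "mip \<phi> (\<lambda>z. f z *v \<psi> z - (f z - g z) *v \<psi> z) = mip \<phi> (\<lambda>z. f z *v \<psi> z)"
    by (simp only: mip_diff_right[OF U(1) f\<psi> wvec_UNIV[OF h\<psi>]]
        mip_disjoint[OF \<phi> h\<psi> int_rays_disjoint(2)]) simp
  then have gf: "mip \<phi> (\<lambda>z. g z *v \<psi> z) = mip \<phi> (\<lambda>z. f z *v \<psi> z)"
    by (simp add: matrix_vector_mult_diff_rdistrib)
  note W = wcirc_hinner_UNIV[OF U(1,1)] wcirc_hinner_UNIV[OF U(2,2)] wcirc_hinner_UNIV[OF U(1) f\<psi>]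
  have W': "(\<lambda>z. of_real k * (hinner (\<phi> z) (\<phi> z) + hinner (\<psi> z) (\<psi> z))) \<in> wcirc UNIV"
    "(\<lambda>z. 2 * hinner (\<phi> z) (f z *v \<psi> z)) \<in> wcirc UNIV"
    by (intro wclass_cmult wclass_add W)+
  have "0 \<le> Re (cf (\<lambda>z. of_real k * (hinner (\<phi> z) (\<phi> z) + hinner (\<psi> z) (\<psi> z)) + 2 * hinner (\<phi> z) (f z *v \<psi> z)) 0)"
  proof (rule Re_cf_0_nonneg[OF wclass_add[OF W']])
    fix z assume "z \<in> unit_circle"
    from k[OF this, of "\<phi> z" "\<psi> z"]
    show "0 \<le> Re (of_real k * (hinner (\<phi> z) (\<phi> z) + hinner (\<psi> z) (\<psi> z)) + 2 * hinner (\<phi> z) (f z *v \<psi> z))"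
      using Re_hinner_self[of "\<phi> z"] Re_hinner_self[of "\<psi> z"] by simp
  qed
  then show "- 2 * Re (mip \<phi> (\<lambda>z. g z *v \<psi> z)) \<le> k * (Re (mip \<phi> \<phi>) + Re (mip \<psi> \<psi>))"
    unfolding gf cf_add[OF W'] cf_cmult[OF wclass_add[OF W(1,2)]] cf_cmult[OF W(3)] cf_add[OF W(1,2)]
    by (simp add: mip_def)
qed

section \<open>Hankel operators\<close>

definition cvec :: "(complex \<Rightarrow> complex^'n) \<Rightarrow> int \<Rightarrow> complex^'n" where
  "cvec \<phi> k = (\<chi> i. cf (\<lambda>z. \<phi> z $ i) k)"

lemma cvec_eq_0: "\<phi> \<in> wvec S \<Longrightarrow> k \<notin> S \<Longrightarrow> cvec \<phi> k = 0"
  by (auto simp: cvec_def wvec_def vec_eq_iff intro: wcirc_cf(2))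

lemma mip_cvec_has_sum:
  "\<phi> \<in> wvec UNIV \<Longrightarrow> \<psi> \<in> wvec UNIV \<Longrightarrow> ((\<lambda>k. hinner (cvec \<phi> k) (cvec \<psi> k)) has_sum mip \<phi> \<psi>) UNIV"
  using mip_has_sum[of \<phi> \<psi>] by (simp add: hinner_def cvec_def)

lemma norm_cvec_has_sum:
  assumes "\<phi> \<in> wvec UNIV"
  shows "((\<lambda>k. (norm (cvec \<phi> k))\<^sup>2) has_sum Re (mip \<phi> \<phi>)) UNIV"
  using has_sum_Re[OF mip_cvec_has_sum[OF assms assms]] by (simp only: Re_hinner_self)

lemma cvec_mult_has_sum:
  assumes g: "g \<in> wmat UNIV" and \<psi>: "\<psi> \<in> wvec UNIV"
  shows "((\<lambda>j. fourier_coeff g (i - j) *v cvec \<psi> j) has_sum cvec (\<lambda>z. g z *v \<psi> z) i) UNIV"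
  unfolding has_sum_vec_iff
proof
  fix a
  have w: "(\<lambda>z. g z $ a $ b) \<in> wcirc UNIV" "(\<lambda>z. \<psi> z $ b) \<in> wcirc UNIV" for b
    using g \<psi> by (auto simp: wmat_def wvec_def)
  have "((\<lambda>j. cf (\<lambda>z. \<psi> z $ b) j * cf (\<lambda>z. g z $ a $ b) (i - j)) has_sum
      conv (cf (\<lambda>z. \<psi> z $ b)) (cf (\<lambda>z. g z $ a $ b)) i) UNIV" for b
    unfolding conv_def
    by (rule has_sum_infsum[OF abs_summable_summable[OF
        has_sum_convolution(4)[OF cf_norm_summable[OF w(2)] cf_norm_summable[OF w(1)]]]])
  moreover have "conv (cf (\<lambda>z. \<psi> z $ b)) (cf (\<lambda>z. g z $ a $ b)) i = cf (\<lambda>z. g z $ a $ b * \<psi> z $ b) i" for b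
    using cf_mult[OF w(2) w(1)] by (simp add: mult.commute)
  ultimately have "((\<lambda>j. \<Sum>b\<in>UNIV. cf (\<lambda>z. \<psi> z $ b) j * cf (\<lambda>z. g z $ a $ b) (i - j)) has_sum
      (\<Sum>b\<in>UNIV. cf (\<lambda>z. g z $ a $ b * \<psi> z $ b) i)) UNIV"
    by (intro has_sum_sum) auto
  moreover have "(\<Sum>b\<in>UNIV. cf (\<lambda>z. g z $ a $ b * \<psi> z $ b) i) = cvec (\<lambda>z. g z *v \<psi> z) i $ a"
    by (simp add: cvec_def matrix_vector_mult_def)
       (rule cf_sum[symmetric], rule wclass_mult[OF w], auto)
  ultimately show "((\<lambda>j. (fourier_coeff g (i - j) *v cvec \<psi> j) $ a) has_sum cvec (\<lambda>z. g z *v \<psi> z) i $ a) UNIV"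
    by (simp add: matrix_vector_mult_def fourier_coeff_nth[OF g] cvec_def mult.commute)
qed

section \<open>Square summable sequences and operator norms\<close>

lemma ell2_normI:
  assumes "((\<lambda>k. (norm (x k))\<^sup>2) has_sum s) UNIV" "\<And>k. k \<notin> J \<Longrightarrow> x k = 0"
  shows "x \<in> ell2 J" "(ell2_norm J x)\<^sup>2 = s"
proof -
  have h: "((\<lambda>k. (norm (x k))\<^sup>2) has_sum s) J"
    by (rule has_sum_cong_neutral[THEN iffD1, OF _ _ _ assms(1)]) (use assms(2) in auto)
  then show "x \<in> ell2 J" using assms(2) by (auto simp: ell2_def has_sum_imp_summable)
  have "0 \<le> s" using has_sum_nonneg[OF h] by simp
  then show "(ell2_norm J x)\<^sup>2 = s" using infsumI[OF h] by (simp add: ell2_norm_def)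
qed

lemma ell2_norm_sq:
  "x \<in> ell2 J \<Longrightarrow> ((\<lambda>k. (norm (x k))\<^sup>2) has_sum (ell2_norm J x)\<^sup>2) UNIV"
proof -
  assume x: "x \<in> ell2 J"
  then have "((\<lambda>k. (norm (x k))\<^sup>2) has_sum (\<Sum>\<^sub>\<infinity>k\<in>J. (norm (x k))\<^sup>2)) UNIV"
    by (subst has_sum_cong_neutral[where S = UNIV and T = J and g = "\<lambda>k. (norm (x k))\<^sup>2"])
       (auto simp: ell2_def intro: has_sum_infsum)
  then show ?thesis by (simp add: ell2_norm_def infsum_nonneg)
qed

lemma ell2_norm_nonneg: "0 \<le> ell2_norm J x"
  by (simp add: ell2_norm_def infsum_nonneg)

lemma ell2_smult:
  assumes "x \<in> ell2 J"
  shows "(\<lambda>j. c *s x j) \<in> ell2 J" "ell2_norm J (\<lambda>j. c *s x j) = norm c * ell2_norm J x"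
proof -
  have h: "((\<lambda>j. (norm (c *s x j))\<^sup>2) has_sum (norm c)\<^sup>2 * (ell2_norm J x)\<^sup>2) UNIV"
    using has_sum_cmult_right[OF ell2_norm_sq[OF assms], of "(norm c)\<^sup>2"]
    by (simp add: norm_complex_smult power_mult_distrib)
  show "(\<lambda>j. c *s x j) \<in> ell2 J"
    by (rule ell2_normI(1)[OF h]) (use assms in \<open>auto simp: ell2_def\<close>)
  have "(ell2_norm J (\<lambda>j. c *s x j))\<^sup>2 = (norm c * ell2_norm J x)\<^sup>2"
    by (subst ell2_normI(2)[OF h]) (use assms in \<open>auto simp: ell2_def power_mult_distrib\<close>)
  then show "ell2_norm J (\<lambda>j. c *s x j) = norm c * ell2_norm J x"
    by (simp add: ell2_norm_nonneg)
qed

lemma strict_contraction_bound: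
  fixes T :: "(int \<Rightarrow> complex^'n) \<Rightarrow> int \<Rightarrow> complex^'m"
  assumes "strict_contraction J K T"
  obtains k where "0 < k" "k < 1" "\<And>x. x \<in> ell2 J \<Longrightarrow> ell2_norm K (T x) \<le> k * ell2_norm J x"
proof -
  from assms have bo: "bounded_operator J K T" and on: "operator_norm J K T < 1"
    by (auto simp: strict_contraction_def)
  obtain B where B: "\<And>x. x \<in> ell2 J \<Longrightarrow> ell2_norm K (T x) \<le> B * ell2_norm J x"
    using bo unfolding bounded_operator_def by blast
  \<comment> \<open>The norm may be zero, and later steps divide by \<open>k\<close>.\<close>
  define k where "k = max (1/2) (operator_norm J K T)"
  \<comment> \<open>A real supremum bounds its set only if the set is bounded above; this comes from
    the boundedness of the operator.\<close>
  have bdd: "bdd_above ((\<lambda>x. ell2_norm K (T x)) ` {x \<in> ell2 J. ell2_norm J x \<le> 1})"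
  proof (rule bdd_aboveI2)
    fix x :: "int \<Rightarrow> complex^'n" assume x: "x \<in> {x \<in> ell2 J. ell2_norm J x \<le> 1}"
    have "B * ell2_norm J x \<le> \<bar>B\<bar> * 1"
      using x ell2_norm_nonneg[of J x] by (intro mult_mono) auto
    then show "ell2_norm K (T x) \<le> \<bar>B\<bar>" using B[of x] x by simp
  qed
  show ?thesis
  proof (rule that[of k])
    show "0 < k" "k < 1" using on by (auto simp: k_def)
    fix x :: "int \<Rightarrow> complex^'n" assume x: "x \<in> ell2 J"
    show "ell2_norm K (T x) \<le> k * ell2_norm J x"
    proof (cases "ell2_norm J x = 0")
      case True
      then show ?thesis using B[OF x] by simp
    next
      case False
      then have n: "0 < ell2_norm J x" using ell2_norm_nonneg[of J x] by simp
      let ?c = "of_real (1 / ell2_norm J x) :: complex"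
      note s = ell2_smult[OF x, of ?c]
      have "ell2_norm J (\<lambda>j. ?c *s x j) = 1" using s(2) n by (simp add: norm_divide)
      then have "ell2_norm K (T (\<lambda>j. ?c *s x j)) \<le> operator_norm J K T"
        unfolding operator_norm_def by (intro cSUP_upper bdd) (use s(1) in auto)
      moreover have "T (\<lambda>j. ?c *s x j) = (\<lambda>i. ?c *s T x i)" and "T x \<in> ell2 K"
        using bo x unfolding bounded_operator_def by blast+
      moreover have "ell2_norm K (\<lambda>i. ?c *s T x i) = norm ?c * ell2_norm K (T x)"
        by (rule ell2_smult(2)) fact
      moreover have "norm ?c = 1 / ell2_norm J x" using n by (simp add: norm_divide)
      ultimately have "ell2_norm K (T x) / ell2_norm J x \<le> k" by (simp add: k_def)
      then show ?thesis using n by (simp add: field_simps)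
    qed
  qed
qed

text \<open>The Hankel operator applied to the coefficients of \<open>\<psi>\<close> gives the
  nonnegative coefficients of \<open>g *v \<psi>\<close>. By Parseval the pairing with
  \<open>\<phi>\<close> becomes an inner product of sequences, estimated by the arithmetic-geometric
  mean inequality with weights \<open>k\<close> and \<open>1/k\<close>; the norm bound turns the
  second weight into \<open>k\<close>.\<close>

lemma form_contraction_of_hankel:
  assumes g: "g \<in> wmat {0..}" and sc: "strict_contraction {..0} {0..} (hankel_plus g)"
  obtains k where "k < 1" "form_contraction g k"
proof -
  obtain k where k: "0 < k" "k < 1"
    "\<And>x. x \<in> ell2 {..0} \<Longrightarrow> ell2_norm {0..} (hankel_plus g x) \<le> k * ell2_norm {..0} x"
    using sc by (rule strict_contraction_bound) blast
  have "form_contraction g k"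
    unfolding form_contraction_def
  proof (intro ballI)
    fix \<phi> :: "complex \<Rightarrow> complex^'b" and \<psi> :: "complex \<Rightarrow> complex^'a"
    assume \<phi>: "\<phi> \<in> wvec {0..}" and \<psi>: "\<psi> \<in> wvec {..0}"
    note U = wvec_UNIV[OF \<phi>] wvec_UNIV[OF \<psi>]
    have g\<psi>: "(\<lambda>z. g z *v \<psi> z) \<in> wvec UNIV"
      by (rule wvec_mult[OF wmat_UNIV[OF g] U(2)]) auto
    let ?y = "cvec \<psi>" and ?T = "hankel_plus g (cvec \<psi>)"
    have y0: "?y j = 0" if "j \<notin> {..0}" for j using cvec_eq_0[OF \<psi> that] .
    have y: "?y \<in> ell2 {..0}" "(ell2_norm {..0} ?y)\<^sup>2 = Re (mip \<psi> \<psi>)"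
      by (rule ell2_normI[OF norm_cvec_has_sum[OF U(2)]], use y0 in simp)+
    have Ti: "?T i = cvec (\<lambda>z. g z *v \<psi> z) i" if "0 \<le> i" for i
    proof -
      have "((\<lambda>j. fourier_coeff g (i - j) *v ?y j) has_sum cvec (\<lambda>z. g z *v \<psi> z) i) {..0}"
        by (rule has_sum_cong_neutral[THEN iffD1, OF _ _ _ cvec_mult_has_sum[OF wmat_UNIV[OF g] U(2)]])
           (use y0 in auto)
      then show ?thesis using that by (simp add: hankel_plus_def infsumI)
    qed
    have T: "?T \<in> ell2 {0..}"
      using sc y(1) by (auto simp: strict_contraction_def bounded_operator_def)
    \<comment> \<open>At negative indices the Hankel image is truncated to zero, but there the
      coefficient of \<open>\<phi>\<close> is zero as well.\<close>
    have inner: "hinner (cvec \<phi> i) (cvec (\<lambda>z. g z *v \<psi> z) i) = hinner (cvec \<phi> i) (?T i)" for i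
      using Ti[of i] cvec_eq_0[OF \<phi>, of i] by (cases "0 \<le> i") auto
    have h1: "((\<lambda>i. - 2 * Re (hinner (cvec \<phi> i) (?T i))) has_sum
        (- 2 * Re (mip \<phi> (\<lambda>z. g z *v \<psi> z)))) UNIV"
      using has_sum_cmult_right[OF has_sum_Re[OF mip_cvec_has_sum[OF U(1) g\<psi>]], of "- 2"]
      by (simp only: inner)
    have h2: "((\<lambda>i. k * (norm (cvec \<phi> i))\<^sup>2 + (1/k) * (norm (?T i))\<^sup>2) has_sum
        (k * Re (mip \<phi> \<phi>) + (1/k) * (ell2_norm {0..} ?T)\<^sup>2)) UNIV"
      by (intro has_sum_add has_sum_cmult_right norm_cvec_has_sum[OF U(1)] ell2_norm_sq[OF T])
    have "- 2 * Re (mip \<phi> (\<lambda>z. g z *v \<psi> z)) \<le> k * Re (mip \<phi> \<phi>) + (1/k) * (ell2_norm {0..} ?T)\<^sup>2"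
    proof (rule has_sum_mono[OF h1 h2])
      fix i
      let ?a = "cvec \<phi> i" and ?b = "?T i"
      have "- Re (hinner ?a ?b) \<le> norm ?a * norm ?b"
        unfolding Re_hinner using Cauchy_Schwarz_ineq2[of ?a ?b] by linarith
      moreover have "2 * (norm ?a * norm ?b) \<le> k * (norm ?a)\<^sup>2 + (1/k) * (norm ?b)\<^sup>2"
      proof -
        have "0 \<le> (k * norm ?a - norm ?b)\<^sup>2 / k" using k(1) by simp
        also have "\<dots> = k * (norm ?a)\<^sup>2 + (1/k) * (norm ?b)\<^sup>2 - 2 * (norm ?a * norm ?b)"
          using k(1) by (simp add: power2_eq_square field_simps)
        finally show ?thesis by simp
      qed
      ultimately show "- 2 * Re (hinner ?a ?b) \<le> k * (norm ?a)\<^sup>2 + (1/k) * (norm ?b)\<^sup>2" by linarith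
    qed
    also have "(1/k) * (ell2_norm {0..} ?T)\<^sup>2 \<le> (1/k) * (k * ell2_norm {..0} ?y)\<^sup>2"
      using k(1) by (intro mult_left_mono power_mono k(3)[OF y(1)] ell2_norm_nonneg) auto
    also have "\<dots> = k * Re (mip \<psi> \<psi>)"
      unfolding power_mult_distrib y(2) using k(1) by (simp add: power2_eq_square)
    finally show "- 2 * Re (mip \<phi> (\<lambda>z. g z *v \<psi> z)) \<le> k * (Re (mip \<phi> \<phi>) + Re (mip \<psi> \<psi>))"
      by (simp add: distrib_left)
  qed
  with k(2) show ?thesis by (rule that)
qed

text \<open>The Laurent polynomial with coefficients \<open>x\<close> on \<open>J\<close>. Such
  polynomials bring finitely supported sequences back into the Wiener class, where
  \<open>form_contraction\<close> can be tested.\<close>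

definition trig :: "int set \<Rightarrow> (int \<Rightarrow> complex^'n) \<Rightarrow> complex \<Rightarrow> complex^'n" where
  "trig J x z = (\<chi> i. \<Sum>j\<in>J. z powi j * x j $ i)"

lemma wseries_trig:
  assumes "finite J"
  shows "wseries unit_circle (\<lambda>z. trig J x z $ i) (\<lambda>j. if j \<in> J then x j $ i else 0)"
proof -
  have "(\<lambda>j. norm (if j \<in> J then x j $ i else 0)) summable_on UNIV"
    by (rule has_sum_imp_summable, rule has_sum_finite_neutralI[of J]) (use assms in auto)
  moreover have "((\<lambda>j. z powi j * (if j \<in> J then x j $ i else 0)) has_sum trig J x z $ i) UNIV" for z
    by (rule has_sum_finite_neutralI[of J]) (use assms in \<open>auto simp: trig_def\<close>)
  ultimately show ?thesis by (simp add: wseries_def)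
qed

lemma trig_wvec: "finite J \<Longrightarrow> J \<subseteq> S \<Longrightarrow> trig J x \<in> wvec S"
  by (auto simp: wvec_def intro!: wclassI[OF wseries_trig])

lemma cvec_trig: "finite J \<Longrightarrow> cvec (trig J x) j = (if j \<in> J then x j else 0)"
  by (simp add: cvec_def cf_eq[OF wseries_trig] vec_eq_iff)

lemma mip_trig:
  assumes "finite J" "\<psi> \<in> wvec UNIV"
  shows "mip (trig J x) \<psi> = (\<Sum>j\<in>J. hinner (x j) (cvec \<psi> j))"
proof (rule has_sum_unique)
  show "((\<lambda>j. hinner (cvec (trig J x) j) (cvec \<psi> j)) has_sum mip (trig J x) \<psi>) UNIV"
    by (rule mip_cvec_has_sum) (use assms trig_wvec[of J UNIV] in auto)
  show "((\<lambda>j. hinner (cvec (trig J x) j) (cvec \<psi> j)) has_sum (\<Sum>j\<in>J. hinner (x j) (cvec \<psi> j))) UNIV"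
    by (rule has_sum_finite_neutralI[of J]) (use assms in \<open>auto simp: cvec_trig\<close>)
qed

lemma form_contraction_finite:
  assumes g: "g \<in> wmat UNIV" and k: "form_contraction g k"
    and F: "finite F" "F \<subseteq> {0..}" and J: "finite J" "J \<subseteq> {..0}"
  shows "- 2 * (\<Sum>i\<in>F. w i \<bullet> (\<Sum>j\<in>J. fourier_coeff g (i - j) *v x j))
      \<le> k * ((\<Sum>i\<in>F. (norm (w i))\<^sup>2) + (\<Sum>j\<in>J. (norm (x j))\<^sup>2))"
proof -
  let ?\<phi> = "trig F w" and ?\<psi> = "trig J x"
  have \<phi>: "?\<phi> \<in> wvec {0..}" and \<psi>: "?\<psi> \<in> wvec {..0}" using F J by (auto intro: trig_wvec)
  have g\<psi>: "(\<lambda>z. g z *v ?\<psi> z) \<in> wvec UNIV"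
    by (rule wvec_mult[OF g wvec_UNIV[OF \<psi>]]) auto
  have "cvec (\<lambda>z. g z *v ?\<psi> z) i = (\<Sum>j\<in>J. fourier_coeff g (i - j) *v x j)" for i
    by (rule has_sum_unique[OF cvec_mult_has_sum[OF g wvec_UNIV[OF \<psi>]]],
        rule has_sum_finite_neutralI[of J])
       (use J in \<open>auto simp: cvec_trig\<close>)
  then have "mip ?\<phi> (\<lambda>z. g z *v ?\<psi> z) = (\<Sum>i\<in>F. hinner (w i) (\<Sum>j\<in>J. fourier_coeff g (i - j) *v x j))"
    using mip_trig[OF F(1) g\<psi>, of w] by simp
  moreover have "mip ?\<phi> ?\<phi> = (\<Sum>i\<in>F. hinner (w i) (w i))"
    using mip_trig[OF F(1) wvec_UNIV[OF \<phi>]] F by (simp add: cvec_trig)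
  moreover have "mip ?\<psi> ?\<psi> = (\<Sum>j\<in>J. hinner (x j) (x j))"
    using mip_trig[OF J(1) wvec_UNIV[OF \<psi>]] J by (simp add: cvec_trig)
  ultimately show ?thesis
    using form_contractionD[OF k \<phi> \<psi>] by (simp only: Re_sum Re_hinner_self Re_hinner)
qed

text \<open>The entries of a square summable sequence are bounded by its norm and the coefficients
  of \<open>g\<close> are absolutely summable. Convergence matters, as \<open>infsum\<close> takes
  the default value 0 on families that are not summable.\<close>

lemma hankel_summable:
  assumes g: "g \<in> wmat UNIV" and x: "x \<in> ell2 {..0}"
  shows "(\<lambda>j. fourier_coeff g (i - j) *v x j) summable_on {..0}"
proof -
  have xb: "norm (x j) \<le> ell2_norm {..0} x" for j
  proof (rule power2_le_imp_le)
    show "(norm (x j))\<^sup>2 \<le> (ell2_norm {..0} x)\<^sup>2"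
      using has_sum_mono_neutral[OF has_sum_finite[of "{j}" "\<lambda>k. (norm (x k))\<^sup>2"] ell2_norm_sq[OF x]] by simp
  qed (rule ell2_norm_nonneg)
  let ?G = "\<lambda>\<nu>. \<Sum>a\<in>UNIV. \<Sum>b\<in>UNIV. norm (fourier_coeff g \<nu> $ a $ b)"
  have "(\<lambda>\<nu>. norm (fourier_coeff g \<nu> $ a $ b)) summable_on UNIV" for a b
    using g cf_norm_summable by (auto simp: fourier_coeff_nth wmat_def)
  then have "?G summable_on UNIV"
    by (intro has_sum_imp_summable[OF has_sum_sum[OF has_sum_sum]]) (rule has_sum_infsum)
  moreover have "bij_betw (\<lambda>j. i - j) UNIV UNIV"
    by (rule bij_betwI[where g = "\<lambda>j. i - j"]) auto
  ultimately have "(\<lambda>j. ?G (i - j)) summable_on UNIV"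
    using summable_on_reindex_bij_betw[of "\<lambda>j. i - j" UNIV UNIV ?G] by simp
  then have "(\<lambda>j. ?G (i - j) * ell2_norm {..0} x) summable_on UNIV"
    by (rule summable_on_cmult_left)
  then have "(\<lambda>j. norm (fourier_coeff g (i - j) *v x j)) summable_on UNIV"
  proof (rule summable_on_comparison_test)
    fix j
    show "norm (fourier_coeff g (i - j) *v x j) \<le> ?G (i - j) * ell2_norm {..0} x"
      by (rule order_trans[OF norm_matrix_vector_mult_le mult_left_mono[OF xb]]) (simp add: sum_nonneg)
  qed simp
  from summable_on_subset_banach[OF abs_summable_summable[OF this]] show ?thesis by simp
qed

text \<open>The form inequality is tested on a finite part \<open>J\<close> of \<open>x\<close> and
  a finite output set \<open>F\<close>; with \<open>F\<close> fixed, \<open>J\<close> then exhausts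
  the nonpositive integers.\<close>

lemma hankel_sum_bound:
  assumes g: "g \<in> wmat UNIV" and k: "form_contraction g k" "0 < k" and x: "x \<in> ell2 {..0}"
    and F: "finite F" "F \<subseteq> {0..}"
  shows "(\<Sum>i\<in>F. (norm (hankel_plus g x i))\<^sup>2) \<le> (k * ell2_norm {..0} x)\<^sup>2"
proof -
  let ?T = "hankel_plus g x" and ?n = "(ell2_norm {..0} x)\<^sup>2"
  define S where "S = (\<Sum>i\<in>F. (norm (?T i))\<^sup>2)"
  \<comment> \<open>The optimal test vector: with \<open>S\<close> as defined above, the inequality
    reads \<open>2 / k * S \<le> S / k + k * ?n\<close>, which is the claimed bound.\<close>
  define w where "w = (\<lambda>i. - (1/k) *\<^sub>R ?T i)"
  let ?u = "\<lambda>J. - 2 * (\<Sum>i\<in>F. w i \<bullet> (\<Sum>j\<in>J. fourier_coeff g (i - j) *v x j))"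
  have "(?u \<longlongrightarrow> - 2 * (\<Sum>i\<in>F. w i \<bullet> ?T i)) (finite_subsets_at_top {..0})"
  proof (intro tendsto_intros)
    fix i assume "i \<in> F"
    then have "((\<lambda>j. fourier_coeff g (i - j) *v x j) has_sum ?T i) {..0}"
      using F(2) has_sum_infsum[OF hankel_summable[OF g x, of i]] by (auto simp: hankel_plus_def)
    then show "((\<lambda>J. \<Sum>j\<in>J. fourier_coeff g (i - j) *v x j) \<longlongrightarrow> ?T i) (finite_subsets_at_top {..0})"
      by (simp add: has_sum_def)
  qed
  moreover have "\<forall>\<^sub>F J in finite_subsets_at_top {..0}. ?u J \<le> k * ((\<Sum>i\<in>F. (norm (w i))\<^sup>2) + ?n)"
    using eventually_finite_subsets_at_top_weakI
  proof (rule eventually_mono)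
    fix J :: "int set" assume J: "finite J \<and> J \<subseteq> {..0}"
    have "(\<Sum>j\<in>J. (norm (x j))\<^sup>2) \<le> ?n"
      using has_sum_mono_neutral[OF has_sum_finite[of J "\<lambda>k. (norm (x k))\<^sup>2"] ell2_norm_sq[OF x]] J by simp
    then have "k * ((\<Sum>i\<in>F. (norm (w i))\<^sup>2) + (\<Sum>j\<in>J. (norm (x j))\<^sup>2)) \<le> k * ((\<Sum>i\<in>F. (norm (w i))\<^sup>2) + ?n)"
      using k(2) by simp
    then show "?u J \<le> k * ((\<Sum>i\<in>F. (norm (w i))\<^sup>2) + ?n)"
      using form_contraction_finite[OF g k(1) F, of J w x] J by linarith
  qed auto
  ultimately have "- 2 * (\<Sum>i\<in>F. w i \<bullet> ?T i) \<le> k * ((\<Sum>i\<in>F. (norm (w i))\<^sup>2) + ?n)"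
    by (rule tendsto_upperbound) simp
  moreover have "- 2 * (\<Sum>i\<in>F. w i \<bullet> ?T i) = 2 / k * S"
    by (simp add: w_def S_def power2_norm_eq_inner sum_distrib_left sum_negf)
  moreover have "(\<Sum>i\<in>F. (norm (w i))\<^sup>2) = S / k\<^sup>2"
    by (simp add: w_def S_def power_mult_distrib power_divide sum_divide_distrib)
  ultimately have "2 / k * S \<le> k * (S / k\<^sup>2 + ?n)" by simp
  also have "\<dots> = S / k + k * ?n" using k(2) by (simp add: power2_eq_square field_simps)
  finally have "S / k \<le> k * ?n" by simp
  then have "S \<le> k * (k * ?n)" using k(2) by (simp add: field_simps)
  then show ?thesis by (simp add: S_def power_mult_distrib power2_eq_square mult_ac)
qed

lemma strict_contraction_hankel:
  fixes g :: "complex \<Rightarrow> complex^'q^'p"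
  assumes g: "g \<in> wmat UNIV" and k: "form_contraction g k" "0 < k" "k < 1"
  shows "strict_contraction {..0} {0..} (hankel_plus g)"
proof -
  let ?T = "hankel_plus g"
  note b = hankel_sum_bound[OF g k(1,2)]
  have T: "?T x \<in> ell2 {0..}" "ell2_norm {0..} (?T x) \<le> k * ell2_norm {..0} x" if x: "x \<in> ell2 {..0}" for x :: "int \<Rightarrow> complex^'q"
  proof -
    have s: "(\<lambda>i. (norm (?T x i))\<^sup>2) summable_on {0..}"
      by (rule nonneg_bdd_above_summable_on) (use b[OF x] in \<open>auto intro!: bdd_aboveI\<close>)
    then show "?T x \<in> ell2 {0..}" by (auto simp: ell2_def hankel_plus_def)
    have "(\<Sum>\<^sub>\<infinity>i\<in>{0..}. (norm (?T x i))\<^sup>2) \<le> (k * ell2_norm {..0} x)\<^sup>2"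
      by (rule infsum_le_finite_sums[OF s b[OF x]])
    then show "ell2_norm {0..} (?T x) \<le> k * ell2_norm {..0} x"
      using k(2) ell2_norm_nonneg[of "{..0}" x] by (simp add: ell2_norm_def real_le_lsqrt infsum_nonneg)
  qed
  have add: "?T (\<lambda>j. x j + y j) = (\<lambda>i. ?T x i + ?T y i)" if "x \<in> ell2 {..0}" "y \<in> ell2 {..0}" for x y :: "int \<Rightarrow> complex^'q"
    using infsum_add[OF hankel_summable[OF g that(1)] hankel_summable[OF g that(2)]]
    by (auto simp: hankel_plus_def matrix_vector_right_distrib)
  have smult: "?T (\<lambda>j. c *s x j) = (\<lambda>i. c *s ?T x i)" if x: "x \<in> ell2 {..0}" for x :: "int \<Rightarrow> complex^'q" and c
  proof
    fix i
    have "((\<lambda>j. c *s (fourier_coeff g (i - j) *v x j)) has_sum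
        c *s (\<Sum>\<^sub>\<infinity>j\<in>{..0}. fourier_coeff g (i - j) *v x j)) {..0}"
      using has_sum_infsum[OF hankel_summable[OF g x, of i]]
      by (simp add: has_sum_vec_iff has_sum_cmult_right)
    from infsumI[OF this] show "?T (\<lambda>j. c *s x j) i = c *s ?T x i"
      by (simp add: hankel_plus_def vector_scalar_commute)
  qed
  have "bounded_operator {..0} {0..} ?T"
    unfolding bounded_operator_def
    by (intro conjI ballI allI exI[of _ k]) (rule T add smult; assumption)+
  moreover have "operator_norm {..0} {0..} ?T \<le> k"
    unfolding operator_norm_def
  proof (rule cSUP_least)
    have "(\<lambda>_. 0 :: complex^'q) \<in> {x \<in> ell2 {..0}. ell2_norm {..0} x \<le> 1}"
      by (simp add: ell2_def ell2_norm_def)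
    then show "{x :: int \<Rightarrow> complex^'q. x \<in> ell2 {..0} \<and> ell2_norm {..0} x \<le> 1} \<noteq> {}" by blast
    fix x :: "int \<Rightarrow> complex^'q"
    assume x: "x \<in> {x \<in> ell2 {..0}. ell2_norm {..0} x \<le> 1}"
    then have "k * ell2_norm {..0} x \<le> k * 1"
      by (intro mult_left_mono) (use k(2) in auto)
    then show "ell2_norm {0..} (?T x) \<le> k" using T(2)[of x] x by simp
  qed
  ultimately show ?thesis using k(3) by (simp add: strict_contraction_def)
qed

section \<open>The twofold problem\<close>

lemma twofold_EG_solution_iff:
  "twofold_EG_solution \<alpha> \<beta> \<gamma> \<delta> g \<longleftrightarrow>
     g \<in> wmat {0..} \<and>
     (\<lambda>z. \<alpha> z + g z ** \<gamma> z - mat 1) \<in> wmat {..-1} \<and>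
     (\<lambda>z. conj_transpose (g z) ** \<alpha> z + \<gamma> z) \<in> wmat {1..} \<and>
     (\<lambda>z. \<delta> z + conj_transpose (g z) ** \<beta> z - mat 1) \<in> wmat {1..} \<and>
     (\<lambda>z. g z ** \<delta> z + \<beta> z) \<in> wmat {..-1}"
  by (simp add: twofold_EG_solution_def wiener_classes)

theorem theorem4p4:
  fixes \<alpha> :: "complex \<Rightarrow> complex^'p^'p"
    and \<beta> :: "complex \<Rightarrow> complex^'q^'p"
    and \<gamma> :: "complex \<Rightarrow> complex^'p^'q"
    and \<delta> :: "complex \<Rightarrow> complex^'q^'q"
    and a0 :: "complex^'p^'p"
    and d0 :: "complex^'q^'q"
  assumes "\<alpha> \<in> wiener_plus" and "\<beta> \<in> wiener_plus"
    and "\<gamma> \<in> wiener_minus" and "\<delta> \<in> wiener_minus"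
    and "a0 = fourier_coeff \<alpha> 0" and "d0 = fourier_coeff \<delta> 0"
  shows "(\<exists>g. twofold_EG_solution \<alpha> \<beta> \<gamma> \<delta> g \<and> strict_contraction {..0} {0..} (hankel_plus g))
     \<longleftrightarrow>
     (pos_def a0 \<and> pos_def d0) \<and>
     (\<forall>\<zeta>\<in>unit_circle.
        conj_transpose (\<alpha> \<zeta>) ** \<alpha> \<zeta> - conj_transpose (\<gamma> \<zeta>) ** \<gamma> \<zeta> = a0 \<and>
        conj_transpose (\<delta> \<zeta>) ** \<delta> \<zeta> - conj_transpose (\<beta> \<zeta>) ** \<beta> \<zeta> = d0 \<and>
        conj_transpose (\<alpha> \<zeta>) ** \<beta> \<zeta> = conj_transpose (\<gamma> \<zeta>) ** \<delta> \<zeta>) \<and>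
     ((\<forall>z. norm z \<le> 1 \<longrightarrow> det (ext_plus \<alpha> z) \<noteq> 0) \<and>
      (\<forall>z. norm z \<ge> 1 \<longrightarrow> det (ext_minus \<delta> z) \<noteq> 0))"
    (is "?L \<longleftrightarrow> (?pos \<and> ?id \<and> ?det)")
proof -
  have \<alpha>: "\<alpha> \<in> wmat {0..}" and \<beta>: "\<beta> \<in> wmat {0..}" and \<gamma>: "\<gamma> \<in> wmat {..0}" and \<delta>: "\<delta> \<in> wmat {..0}"
    using assms(1-4) by (simp_all add: wiener_classes)
  \<comment> \<open>The reflected data: \<delta> takes the place of \<alpha>, and \<beta> that of
    \<gamma>.\<close>
  have \<delta>r: "(\<lambda>z. \<delta> (inverse z)) \<in> wmat {0..}" and \<beta>r: "(\<lambda>z. \<beta> (inverse z)) \<in> wmat {..0}"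
    by (rule wmat_inverse_plus[OF \<delta>], rule wmat_inverse_minus[OF \<beta>])
  have d0: "fourier_coeff (\<lambda>z. \<delta> (inverse z)) 0 = d0"
    using fourier_coeff_inverse[OF wmat_UNIV[OF \<delta>], of 0] assms(6) by simp
  have a0z: "(\<lambda>z. \<alpha> z - a0) \<in> wmat {1..}"
    using wmat_minus_fourier_coeff_0_plus[OF \<alpha>] assms(5) by simp
  have d0z: "(\<lambda>z. \<delta> (inverse z) - d0) \<in> wmat {1..}"
    using wmat_minus_fourier_coeff_0_plus[OF \<delta>r] d0 by simp
  note ext_minus = ext_minus_eq[OF wmat_UNIV[OF \<delta>]]
  show ?thesis
  proof
    assume ?L
    then obtain g where sol: "twofold_EG_solution \<alpha> \<beta> \<gamma> \<delta> g"
      and sc: "strict_contraction {..0} {0..} (hankel_plus g)" by blast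
    have g: "g \<in> wmat {0..}"
      and e1: "(\<lambda>z. \<alpha> z + g z ** \<gamma> z - mat 1) \<in> wmat {..-1}"
      and e2: "(\<lambda>z. conj_transpose (g z) ** \<alpha> z + \<gamma> z) \<in> wmat {1..}"
      and e3: "(\<lambda>z. \<delta> z + conj_transpose (g z) ** \<beta> z - mat 1) \<in> wmat {1..}"
      and e4: "(\<lambda>z. g z ** \<delta> z + \<beta> z) \<in> wmat {..-1}"
      using sol by (simp_all add: twofold_EG_solution_iff)
    obtain k where k: "k < 1" "form_contraction g k"
      by (rule form_contraction_of_hankel[OF g sc])
    let ?h = "\<lambda>z. conj_transpose (g (inverse z))"
    have h: "?h \<in> wmat {0..}" by (rule wmat_adjoint_inverse_plus[OF g])
    have kh: "form_contraction ?h k"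
      by (rule form_contraction_reflect[OF k(2) wmat_UNIV[OF g]])
    note e3r = wmat_inverse_minus0[OF e3]
    \<comment> \<open>Since the adjoint of \<open>?h z\<close> is \<open>g (inverse z)\<close>, the
      reflected fourth equation is the second equation for the reflected data, just as
      \<open>e3r\<close> is the first.\<close>
    have e4r: "(\<lambda>z. conj_transpose (?h z) ** \<delta> (inverse z) + \<beta> (inverse z)) \<in> wmat {1..}"
      using wmat_inverse_plus0[OF e4] by simp
    have pa: "pos_def a0" by (rule EG_pos_def[OF \<alpha> \<gamma> g a0z e1 e2 k(2,1)])
    have pd: "pos_def d0" by (rule EG_pos_def[OF \<delta>r \<beta>r h d0z e3r e4r kh k(1)])
    note ida = EG_identity(1)[OF \<alpha> \<gamma> a0z e1 e2]
    note idd = EG_identity(1)[OF \<delta>r \<beta>r d0z e3r e4r]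
    have ?id
    proof (intro ballI conjI)
      fix z assume z: "z \<in> unit_circle"
      show "conj_transpose (\<alpha> z) ** \<alpha> z - conj_transpose (\<gamma> z) ** \<gamma> z = a0" by (rule ida[OF z])
      show "conj_transpose (\<delta> z) ** \<delta> z - conj_transpose (\<beta> z) ** \<beta> z = d0"
        using idd[OF inverse_unit_circle[OF z]] by simp
      show "conj_transpose (\<alpha> z) ** \<beta> z = conj_transpose (\<gamma> z) ** \<delta> z"
        by (rule EG_identity_mixed[OF \<alpha> \<beta> \<gamma> \<delta> e1 e2 e3 e4 z])
    qed
    moreover have ?det
    proof (intro conjI allI impI)
      fix z :: complex
      show "det (ext_plus \<alpha> z) \<noteq> 0" if "norm z \<le> 1"
        by (rule EG_det_nonzero[OF \<alpha> \<gamma> g ida e1 k(2,1) pa that])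
      show "det (ext_minus \<delta> z) \<noteq> 0" if "norm z \<ge> 1"
        unfolding ext_minus
        by (rule EG_det_nonzero[OF \<delta>r \<beta>r h idd e3r kh k(1) pd])
           (use that in \<open>simp_all add: norm_inverse inverse_le_1_iff\<close>)
    qed
    ultimately show "?pos \<and> ?id \<and> ?det" using pa pd by blast
  next
    assume R: "?pos \<and> ?id \<and> ?det"
    then have pa: "pos_def a0" and pd: "pos_def d0" by auto
    have ida: "conj_transpose (\<alpha> z) ** \<alpha> z - conj_transpose (\<gamma> z) ** \<gamma> z = a0"
      and idd: "conj_transpose (\<delta> z) ** \<delta> z - conj_transpose (\<beta> z) ** \<beta> z = d0"
      and idm: "conj_transpose (\<alpha> z) ** \<beta> z = conj_transpose (\<gamma> z) ** \<delta> z"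
      if "z \<in> unit_circle" for z using R that by blast+
    obtain \<alpha>' where \<alpha>': "\<alpha>' \<in> wmat {0..}"
      "\<And>z. z \<in> unit_circle \<Longrightarrow> \<alpha> z ** \<alpha>' z = mat 1" "\<And>z. z \<in> unit_circle \<Longrightarrow> \<alpha>' z ** \<alpha> z = mat 1"
      by (rule wmat_plus_invertible[OF \<alpha>]) (use R in blast)+
    have "det (ext_plus (\<lambda>z. \<delta> (inverse z)) z) \<noteq> 0" if "norm z \<le> 1" for z
    proof (cases "z = 0")
      case True
      \<comment> \<open>The point \<open>0\<close> corresponds to \<open>\<infinity>\<close>, which condition (iii) leaves out; there (i) applies.\<close>
      then show ?thesis using pos_def_det_nonzero[OF pd] ext_plus_0[OF \<delta>r] d0 by simp
    next
      case False
      then have "norm (inverse z) \<ge> 1" using that by (simp add: norm_inverse one_le_inverse)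
      then have "det (ext_minus \<delta> (inverse z)) \<noteq> 0" using R by blast
      then show ?thesis by (simp add: ext_minus)
    qed
    then obtain \<delta>' where \<delta>': "\<delta>' \<in> wmat {0..}"
      "\<And>z. z \<in> unit_circle \<Longrightarrow> \<delta> (inverse z) ** \<delta>' z = mat 1"
      using wmat_plus_invertible[OF \<delta>r] by blast
    \<comment> \<open>The symbol is built from \<alpha> and \<gamma> only; \<open>f\<delta>\<close>
      below shows that it fits \<delta> and \<beta> equally well.\<close>
    define f where "f = (\<lambda>z. - (conj_transpose (\<alpha>' z) ** conj_transpose (\<gamma> z)))"
    have f: "f \<in> wmat UNIV"
      unfolding f_def
      by (intro wmat_uminus wmat_mult[of _ UNIV _ UNIV] wmat_conj_transpose[OF \<alpha>'(1)]
          wmat_conj_transpose[OF \<gamma>]) auto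
    obtain g where g: "g \<in> wmat {0..}" and "(\<lambda>z. f z - g z) \<in> wmat (- {0..})"
      by (rule wmat_split[OF f])
    then have fg: "(\<lambda>z. f z - g z) \<in> wmat {..-1}"
      by (rule_tac wmat_mono) auto
    have \<alpha>f: "conj_transpose (\<alpha> z) ** f z = - conj_transpose (\<gamma> z)" if z: "z \<in> unit_circle" for z
    proof -
      have "conj_transpose (\<alpha> z) ** conj_transpose (\<alpha>' z) = mat 1"
        using \<alpha>'(3)[OF z] conj_transpose_mult[of "\<alpha>' z" "\<alpha> z"] by simp
      then show ?thesis
        by (simp add: f_def matrix_mult_minus_right matrix_mul_assoc)
    qed
    \<comment> \<open>The mixed identity enters here: it makes a single \<open>f\<close>, and hence
      a single \<open>g\<close>, serve both halves of the problem.\<close>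
    have f\<delta>: "f z ** \<delta> z = - \<beta> z" if z: "z \<in> unit_circle" for z
    proof -
      have "conj_transpose (\<alpha>' z) ** conj_transpose (\<alpha> z) = mat 1"
        using \<alpha>'(2)[OF z] conj_transpose_mult[of "\<alpha> z" "\<alpha>' z"] by simp
      moreover have "f z ** \<delta> z = - (conj_transpose (\<alpha>' z) ** (conj_transpose (\<alpha> z) ** \<beta> z))"
        unfolding idm[OF z] by (simp add: f_def matrix_mult_minus_left matrix_mul_assoc)
      ultimately show ?thesis by (simp add: matrix_mul_assoc)
    qed
    have f\<delta>r: "conj_transpose (\<delta> (inverse z)) ** conj_transpose (f (inverse z)) = - conj_transpose (\<beta> (inverse z))"
      if "z \<in> unit_circle" for z
      using arg_cong[OF f\<delta>[OF inverse_unit_circle[OF that]], of conj_transpose]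
      by (simp add: conj_transpose_mult conj_transpose_minus)
    have "(\<lambda>z. conj_transpose (f (inverse z) - g (inverse z))) \<in> wmat {..-1}"
      by (rule wmat_conj_transpose[OF wmat_inverse_plus0[OF fg]]) auto
    then have fgr: "(\<lambda>z. conj_transpose (f (inverse z)) - conj_transpose (g (inverse z))) \<in> wmat {..-1}"
      by (simp add: conj_transpose_diff)
    note ea = EG_equations[OF \<alpha> \<gamma> \<alpha>'(1,2) a0z _ ida \<alpha>f fg]
    \<comment> \<open>Here the adjoint of \<open>f (inverse z)\<close> is the symbol and the adjoint
      of \<open>g (inverse z)\<close> the candidate solution. The open premise, selfadjointness of
      \<open>d0\<close>, follows from \<open>pd\<close>.\<close>
    note ed = EG_equations[OF \<delta>r \<beta>r \<delta>' d0z _ idd[OF inverse_unit_circle] f\<delta>r fgr]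
    have "twofold_EG_solution \<alpha> \<beta> \<gamma> \<delta> g"
      unfolding twofold_EG_solution_iff
    proof (intro conjI g)
      show "(\<lambda>z. \<alpha> z + g z ** \<gamma> z - mat 1) \<in> wmat {..-1}"
        "(\<lambda>z. conj_transpose (g z) ** \<alpha> z + \<gamma> z) \<in> wmat {1..}"
        using ea pa by (auto simp: pos_def_iff)
      have "(\<lambda>z. \<delta> (inverse z) + conj_transpose (g (inverse z)) ** \<beta> (inverse z) - mat 1) \<in> wmat {..-1}"
        "(\<lambda>z. g (inverse z) ** \<delta> (inverse z) + \<beta> (inverse z)) \<in> wmat {1..}"
        using ed pd by (auto simp: pos_def_iff)
      from wmat_inverse_plus0[OF this(1)] wmat_inverse_minus0[OF this(2)]
      show "(\<lambda>z. \<delta> z + conj_transpose (g z) ** \<beta> z - mat 1) \<in> wmat {1..}"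
        "(\<lambda>z. g z ** \<delta> z + \<beta> z) \<in> wmat {..-1}" by simp_all
    qed
    moreover obtain k where k: "0 < k" "k < 1" "\<And>z v w. z \<in> unit_circle \<Longrightarrow>
        - 2 * Re (hinner v (f z *v w)) \<le> k * ((norm v)\<^sup>2 + (norm w)\<^sup>2)"
      using EG_symbol_bound[OF wmat_UNIV[OF \<alpha>] \<alpha>'(2) pa ida \<alpha>f] by blast
    have "strict_contraction {..0} {0..} (hankel_plus g)"
      by (rule strict_contraction_hankel[OF wmat_UNIV[OF g] form_contractionI[OF f fg k(3)] k(1,2)])
    ultimately show ?L by blast
  qed
qed

end
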